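(* Let $V^-,V^+:\mathbb{N}^d\to\mathbb{R}$ be given and let $\mathcal{L}$ be the generator on $\mathbb{N}^d$ with moves $\gamma_i^{\pm}$ and rates $$c(\eta,\gamma_i^+)=\exp(-\nabla_i^+V^+(\eta)),\qquad c(\eta,\gamma_i^-)=\exp(-\nabla_i^-V^-(\eta))\,\mathbf 1_{\{\eta_i>0\}}.$$ Assume that properties (Irr) and (Rev) hold and that $$\inf_{\eta\in\mathbb{N}^d,\,i\le d}\nabla_i^+V^+(\eta)>-\infty,\qquad \inf\{\nabla_i^-V^-(\eta):\eta\in\mathbb N^d,\ \eta_i\le K\}>-\infty\quad\forall K>0,\ i\le d.$$ Let $\kappa>0$. If $W_p(\mu_t,\nu_t)\le\exp(-\frac{\kappa}{p}t)\,W_p(\mu,\nu)$ holds for all $p\ge1$, all $\mu,\nu\in\mathcal P_p(\mathbb{N}^d)$ and all $t>0$, then for every admissible $\phi$ the convex Sobolev inequality holds with constant $\kappa_\phi=\kappa$, and for every $\alpha\in[1,2]$ the Beckner inequality holds with constant $\kappa_\alpha=\alpha\kappa$.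
   Context: Setting: $d\ge1$, $\mathbb{N}=\{0,1,2,\dots\}$, $\Omega=\mathbb{N}^d$ with canonical basis $(\mathbf e_i)_{i\le d}$. The set of moves is $G=\{\gamma_i^+,\gamma_i^-:1\le i\le d\}$, with $\gamma_i^+\eta=\eta+\mathbf e_i$ and $\gamma_i^-\eta=\eta-\mathbf e_i\mathbf 1_{\{\eta_i>0\}}$. For a function $F$ on $\mathbb{N}^d$, $\nabla_i^{\pm}F(\eta)=F(\gamma_i^{\pm}\eta)-F(\eta)$. Given rates $c:\Omega\times G\to[0,\infty)$, $\mathcal{L}f(\eta)=\sum_{i=1}^d c(\eta,\gamma_i^+)\nabla_i^+f(\eta)+c(\eta,\gamma_i^-)\nabla_i^-f(\eta)$. (Irr): $\mathcal L$ is irreducible and admits an invariant probability measure $\mathbf m$ with $\sum_{\eta\in\Omega,\sigma\in G}c(\eta,\sigma)\mathbf m(\eta)<\infty$ (the associated continuous time Markov chain is then non-explosive). (Rev): with the involution $(\gamma_i^{\pm})^{-1}:=\gamma_i^{\mp}$ of $G$ one has $\sigma^{-1}(\sigma\eta)=\eta$ whenever $\mathbf m(\eta)c(\eta,\sigma)>0$, and $\sum_{\eta,\sigma}F(\eta,\sigma)c(\eta,\sigma)\mathbf m(\eta)=\sum_{\eta,\sigma}F(\sigma\eta,\sigma^{-1})c(\eta,\sigma)\mathbf m(\eta)$ for all bounded $F:\Omega\times G\to\mathbb R$. (Here necessarily $\mathbf m=\frac1Z\exp(-V^+-V^-)$.) Distance: $d(\eta,\bar\eta)=\sum_{i=1}^d|\eta_i-\bar\eta_i|$.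 $\mathcal P_p(\mathbb{N}^d)$ is the set of probability measures on $\mathbb N^d$ with finite $p$-th moment, and $W_p(\mu,\nu)=\big(\inf_{\pi\in\Pi(\mu,\nu)}\sum_{\eta',\eta''}d(\eta',\eta'')^p\pi(\eta',\eta'')\big)^{1/p}$, with $\Pi(\mu,\nu)$ the set of couplings. $\mu_t$ denotes the law at time $t$ of the continuous time Markov chain with generator $\mathcal L$ and initial distribution $\mu$ (likewise $\nu_t$). Admissible functions: $\phi:[0,\infty)\to[0,\infty)$ is admissible if it is convex, twice differentiable on $(0,\infty)$, and $\Phi(a,b):=(\phi'(b)-\phi'(a))(b-a)$ is convex on $(0,\infty)^2$. For $f:\Omega\to(0,\infty)$ with $\sum_\eta f(\eta)\mathbf m(\eta)<\infty$, $\mathcal H^\phi(f|\mathbf m)=\sum_\eta\phi(f(\eta))\mathbf m(\eta)-\phi\big(\sum_\eta f(\eta)\mathbf m(\eta)\big)\in[0,\infty]$. The convex Sobolev inequality with constant $\kappa_\phi$ is: for all such $f$, $$\kappa_\phi\,\mathcal H^\phi(f|\mathbf m)\le\frac12\sum_{\eta\in\Omega,\sigma\in G}c(\eta,\sigma)\,\Phi(f(\eta),f(\sigma\eta))\,\mathbf m(\eta).$$ Let $\phi_1(a)=a\log a-a+1$ and $\phi_\alpha(a)=\frac{1}{\alpha-1}(a^\alpha-a)-a+1$ for $\alpha\in(1,2]$. The Beckner inequality with constant $\kappa_\alpha$ is the convex Sobolev inequality for $\phi=\phi_\alpha$ (for $\alpha=1$: the modified logarithmic Sobolev inequality). *)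

theory Defs
  imports "HOL-Probability.Probability"
begin

text \<open>The state space \<open>\<nat>\<^sup>d\<close> is the type \<^typ>\<open>nat ^ 'd\<close>, with \<open>d = CARD('d) \<ge> 1\<close>; the \<open>i\<close>-th canonical
  basis vector is \<open>axis i 1\<close>.\<close>

datatype 'd move = Up 'd | Down 'd

instance move :: (finite) finite
proof
  have "(UNIV :: 'a move set) \<subseteq> range Up \<union> range Down"
    by (metis UNIV_I UnCI move.exhaust rangeI subsetI)
  then show "finite (UNIV :: 'a move set)"
    by (rule finite_subset) simp
qed

primrec act :: "'d move \<Rightarrow> nat ^ 'd \<Rightarrow> nat ^ 'd::finite" where
  "act (Up i) \<eta> = \<eta> + axis i 1"
| "act (Down i) \<eta> = (if \<eta> $ i > 0 then \<eta> - axis i 1 else \<eta>)"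

primrec inv_move :: "'d move \<Rightarrow> 'd move" where
  "inv_move (Up i) = Down i"
| "inv_move (Down i) = Up i"

definition grad :: "'d move \<Rightarrow> (nat ^ 'd::finite \<Rightarrow> real) \<Rightarrow> nat ^ 'd \<Rightarrow> real" where
  "grad \<sigma> F \<eta> = F (act \<sigma> \<eta>) - F \<eta>"

type_synonym 'd rates = "nat ^ 'd \<Rightarrow> 'd move \<Rightarrow> real"

fun potential_rates :: "(nat ^ 'd::finite \<Rightarrow> real) \<Rightarrow> (nat ^ 'd \<Rightarrow> real) \<Rightarrow> 'd rates" where
  "potential_rates Vp Vm \<eta> (Up i) = exp (- grad (Up i) Vp \<eta>)"
| "potential_rates Vp Vm \<eta> (Down i) = exp (- grad (Down i) Vm \<eta>) * of_bool (\<eta> $ i > 0)"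


section \<open>The continuous time Markov chain\<close>

definition total_rate :: "'d::finite rates \<Rightarrow> nat ^ 'd \<Rightarrow> real" where
  "total_rate c \<eta> = (\<Sum>\<sigma>\<in>UNIV. c \<eta> \<sigma>)"

text \<open>\<open>trans_upto c n t x y\<close> is the probability that the chain which, in state \<open>\<eta>\<close>, waits an
  exponential time of parameter \<open>\<Sum>\<sigma>. c \<eta> \<sigma>\<close> and then performs the move \<open>\<sigma>\<close> with probability
  proportional to \<open>c \<eta> \<sigma>\<close>, is in \<open>y\<close> at time \<open>t\<close> having performed at most \<open>n\<close> moves, when started
  in \<open>x\<close>: one conditions on the time \<open>s\<close> and the direction \<open>\<sigma>\<close> of the first move. A move that does
  not change the state affects neither the generator nor the law of the chain.\<close>

primrec trans_upto ::
  "'d::finite rates \<Rightarrow> nat \<Rightarrow> real \<Rightarrow> nat ^ 'd \<Rightarrow> nat ^ 'd \<Rightarrow> ennreal" where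
  "trans_upto c 0 t x y = ennreal (exp (- total_rate c x * t)) * indicator {x} y"
| "trans_upto c (Suc n) t x y =
     ennreal (exp (- total_rate c x * t)) * indicator {x} y +
     (\<integral>\<^sup>+ s \<in> {0..t}. ennreal (exp (- total_rate c x * s)) *
        (\<Sum>\<sigma>\<in>UNIV. ennreal (c x \<sigma>) * trans_upto c n (t - s) (act \<sigma> x) y) \<partial>lborel)"

text \<open>Feller's construction of the minimal transition function, i.e. of the transition function of
  the chain with generator \<open>f \<mapsto> (\<lambda>\<eta>. \<Sum>\<sigma>. c \<eta> \<sigma> * grad \<sigma> f \<eta>)\<close>. It has total mass one from every
  state exactly when the chain is non-explosive, which is why \<open>law_at\<close> is valued in measures.\<close>

definition trans_prob :: "'d::finite rates \<Rightarrow> real \<Rightarrow> nat ^ 'd \<Rightarrow> nat ^ 'd \<Rightarrow> ennreal" where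
  "trans_prob c t x y = (SUP n. trans_upto c n t x y)"

definition law_at :: "'d::finite rates \<Rightarrow> (nat ^ 'd) pmf \<Rightarrow> real \<Rightarrow> (nat ^ 'd) measure" where
  "law_at c \<mu> t = density (count_space UNIV) (\<lambda>y. \<integral>\<^sup>+ x. trans_prob c t x y \<partial>measure_pmf \<mu>)"

definition irreducible_rates :: "'d::finite rates \<Rightarrow> bool" where
  "irreducible_rates c \<longleftrightarrow>
     (\<forall>\<eta> \<xi>. (\<lambda>x y. \<exists>\<sigma>. c x \<sigma> > 0 \<and> y = act \<sigma> x)\<^sup>*\<^sup>* \<eta> \<xi>)"

definition invariant_pmf :: "'d::finite rates \<Rightarrow> (nat ^ 'd) pmf \<Rightarrow> bool" where
  "invariant_pmf c m \<longleftrightarrow> (\<forall>t\<ge>0. law_at c m t = measure_pmf m)"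

definition Irr :: "'d::finite rates \<Rightarrow> (nat ^ 'd) pmf \<Rightarrow> bool" where
  "Irr c m \<longleftrightarrow> irreducible_rates c \<and> invariant_pmf c m \<and>
     (\<lambda>(\<eta>, \<sigma>). c \<eta> \<sigma> * pmf m \<eta>) summable_on UNIV"

definition Rev :: "'d::finite rates \<Rightarrow> (nat ^ 'd) pmf \<Rightarrow> bool" where
  "Rev c m \<longleftrightarrow>
     (\<forall>\<eta> \<sigma>. pmf m \<eta> * c \<eta> \<sigma> > 0 \<longrightarrow> act (inv_move \<sigma>) (act \<sigma> \<eta>) = \<eta>) \<and>
     (\<forall>F :: nat ^ 'd \<Rightarrow> 'd move \<Rightarrow> real. bounded (range (\<lambda>(\<eta>, \<sigma>). F \<eta> \<sigma>)) \<longrightarrow>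
        (\<Sum>\<^sub>\<infinity>(\<eta>, \<sigma>)\<in>UNIV. F \<eta> \<sigma> * c \<eta> \<sigma> * pmf m \<eta>) =
        (\<Sum>\<^sub>\<infinity>(\<eta>, \<sigma>)\<in>UNIV. F (act \<sigma> \<eta>) (inv_move \<sigma>) * c \<eta> \<sigma> * pmf m \<eta>))"


section \<open>Wasserstein distances\<close>

definition dist1 :: "nat ^ 'd::finite \<Rightarrow> nat ^ 'd \<Rightarrow> real" where
  "dist1 \<eta> \<xi> = (\<Sum>i\<in>UNIV. \<bar>real (\<eta> $ i) - real (\<xi> $ i)\<bar>)"

definition finite_moment :: "real \<Rightarrow> (nat ^ 'd::finite) pmf set" where
  "finite_moment p = {\<mu>. integrable (measure_pmf \<mu>) (\<lambda>\<eta>. dist1 \<eta> 0 powr p)}"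

definition couplings ::
  "(nat ^ 'd::finite) measure \<Rightarrow> (nat ^ 'd) measure \<Rightarrow> ((nat ^ 'd) \<times> (nat ^ 'd)) measure set" where
  "couplings \<mu> \<nu> = {\<pi>. sets \<pi> = UNIV \<and>
     distr \<pi> (count_space UNIV) fst = \<mu> \<and> distr \<pi> (count_space UNIV) snd = \<nu>}"

definition root_ennreal :: "real \<Rightarrow> ennreal \<Rightarrow> ennreal" where
  "root_ennreal p x = (if x = \<infinity> then \<infinity> else ennreal (enn2real x powr (1 / p)))"

definition wasserstein ::
  "real \<Rightarrow> (nat ^ 'd::finite) measure \<Rightarrow> (nat ^ 'd) measure \<Rightarrow> ennreal" where
  "wasserstein p \<mu> \<nu> =
     root_ennreal p (INF \<pi>\<in>couplings \<mu> \<nu>. \<integral>\<^sup>+ (\<eta>, \<xi>). ennreal (dist1 \<eta> \<xi> powr p) \<partial>\<pi>)"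


section \<open>Convex Sobolev and Beckner inequalities\<close>

definition bregman_symm :: "(real \<Rightarrow> real) \<Rightarrow> real \<Rightarrow> real \<Rightarrow> real" where
  "bregman_symm \<phi> a b = (deriv \<phi> b - deriv \<phi> a) * (b - a)"

text \<open>Only the values of \<open>\<phi>\<close> on \<open>[0, \<infinity>)\<close> matter.\<close>

definition admissible :: "(real \<Rightarrow> real) \<Rightarrow> bool" where
  "admissible \<phi> \<longleftrightarrow>
     (\<forall>a\<ge>0. \<phi> a \<ge> 0) \<and> convex_on {0..} \<phi> \<and>
     (\<forall>a>0. \<phi> differentiable (at a) \<and> deriv \<phi> differentiable (at a)) \<and>
     convex_on ({0<..} \<times> {0<..}) (\<lambda>(a, b). bregman_symm \<phi> a b)"

text \<open>For \<open>\<phi> \<ge> 0\<close> convex on \<open>[0, \<infinity>)\<close> and \<open>f > 0\<close>, the subtraction below is not truncated, by Jensen's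
  inequality, and the summands of \<open>dirichlet\<close> are nonnegative, by monotonicity of \<open>deriv \<phi>\<close>.\<close>

definition phi_entropy ::
  "(real \<Rightarrow> real) \<Rightarrow> (nat ^ 'd::finite) pmf \<Rightarrow> (nat ^ 'd \<Rightarrow> real) \<Rightarrow> ennreal" where
  "phi_entropy \<phi> m f =
     (\<integral>\<^sup>+ \<eta>. ennreal (\<phi> (f \<eta>)) \<partial>measure_pmf m) - ennreal (\<phi> (\<integral> \<eta>. f \<eta> \<partial>measure_pmf m))"

definition dirichlet ::
  "'d::finite rates \<Rightarrow> (real \<Rightarrow> real) \<Rightarrow> (nat ^ 'd) pmf \<Rightarrow> (nat ^ 'd \<Rightarrow> real) \<Rightarrow> ennreal" where
  "dirichlet c \<phi> m f =
     (\<integral>\<^sup>+ \<eta>. (\<Sum>\<sigma>\<in>UNIV. ennreal (c \<eta> \<sigma> * bregman_symm \<phi> (f \<eta>) (f (act \<sigma> \<eta>)))) \<partial>measure_pmf m)"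

definition convex_sobolev ::
  "'d::finite rates \<Rightarrow> (nat ^ 'd) pmf \<Rightarrow> (real \<Rightarrow> real) \<Rightarrow> real \<Rightarrow> bool" where
  "convex_sobolev c m \<phi> \<kappa> \<longleftrightarrow>
     (\<forall>f. (\<forall>\<eta>. f \<eta> > 0) \<longrightarrow> integrable (measure_pmf m) f \<longrightarrow>
        ennreal \<kappa> * phi_entropy \<phi> m f \<le> ennreal (1 / 2) * dirichlet c \<phi> m f)"

definition beckner_fun :: "real \<Rightarrow> real \<Rightarrow> real" where
  "beckner_fun \<alpha> a =
     (if \<alpha> = 1 then a * ln a - a + 1 else (a powr \<alpha> - a) / (\<alpha> - 1) - a + 1)"

definition beckner :: "'d::finite rates \<Rightarrow> (nat ^ 'd) pmf \<Rightarrow> real \<Rightarrow> real \<Rightarrow> bool" where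
  "beckner c m \<alpha> \<kappa> \<longleftrightarrow> convex_sobolev c m (beckner_fun \<alpha>) \<kappa>"

end

(* Applied to point masses at neighbours x and x + e_i, the W_p contraction for all p provides couplings
   of the two chains which, for p large, hardly ever get further apart than distance one and have met
   by time t with probability at least about kappa t. To first order in t this is a condition on the
   rates: the rate x -> x + e_i exceeds what is needed to compensate for the increase of the other rates
   along the edge, the same holds for x + e_i -> x, and the two surpluses add up to at least kappa.

   The condition yields a coupling of the jumps from the two ends of an edge. Because the birth rates
   derive from a potential and the chain is reversible, the induced motion on edges preserves the measure
   m(x) c(x, x + e_i): it is not reversible, but balanced on each square. As Phi is convex and vanishes on
   the diagonal, the Dirichlet form contracts at rate kappa (alpha kappa for the Beckner functions), and
   summing up the dissipation of the entropy yields the inequality.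

   The condition survives the truncation to cubes {0..N}^d. So only finite chains are needed before N
   tends to infinity, and for these the semigroup can be replaced by the Euler scheme f -> f + h L f. *)

theory Submission
  imports Defs
begin


section \<open>Entropy functions\<close>

text \<open>If the surplus jumps of an edge were simply sent to the diagonal, convexity would yield
  the rate \<kappa> and nothing better. They are therefore lumped with the unmoved pair into one
  pair whose ends are drawn slightly together; to first order \<open>\<Phi>\<close> of that pair
  decreases at \<beta> times the surplus, which is how \<alpha> \<kappa> arises for the Beckner
  functions. The Euler step suits this because, for small h, it writes the new values at the two
  ends of an edge as a convex combination of old pairs: Jensen's inequality applies and
  \<open>\<Phi>\<close> is never differentiated. The price is an error of order h^2 per step, which
  lowers the rate by a multiple of h only. The constant in it depends on the cube, but h tends to 0
  before the cube grows. Summing the dissipation recovers the whole entropy only if the iterates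
  converge to their mean. This follows from the same contraction, applied to (b - a)^2 in place of
  \<open>\<Phi>\<close>: its energies are summable, so the increments along all edges die
  out.\<close>

text \<open>For \<open>\<beta> = 1\<close> the last condition follows from the others. The Beckner functions satisfy it with
  \<open>\<beta> = \<alpha>\<close>, which is where the better constant comes from.\<close>

definition edge_functional :: "real \<Rightarrow> (real \<Rightarrow> real \<Rightarrow> real) \<Rightarrow> bool" where
  "edge_functional \<beta> \<Phi> \<longleftrightarrow>
     (\<forall>a>0. \<Phi> a a = 0) \<and> (\<forall>a>0. \<forall>b>0. \<Phi> a b = \<Phi> b a) \<and> (\<forall>a>0. \<forall>b>0. \<Phi> a b \<ge> 0) \<and>
     convex_on ({0<..} \<times> {0<..}) (\<lambda>(a, b). \<Phi> a b) \<and>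
     (\<forall>a>0. \<forall>b>0. \<forall>u\<ge>0. \<forall>v\<ge>0. u + v < 1 \<longrightarrow>
        \<Phi> (a + u * (b - a)) (b - v * (b - a)) \<le> (1 - (u + v)) * (1 - (\<beta> - 1) * (u + v)) * \<Phi> a b)"

text \<open>The contracted pair is the convex combination of (a, b), (b, b) and (a, a) with weights
  1 - (u + v), u and v, and \<open>\<Phi>\<close> vanishes at the last two.\<close>

lemma edge_functional_convex:
  assumes diag: "\<And>a. a > 0 \<Longrightarrow> \<Phi> a a = 0"
    and sym: "\<And>a b. a > 0 \<Longrightarrow> b > 0 \<Longrightarrow> \<Phi> a b = \<Phi> b a"
    and nonneg: "\<And>a b. a > 0 \<Longrightarrow> b > 0 \<Longrightarrow> \<Phi> a b \<ge> 0"
    and conv: "convex_on ({0<..} \<times> {0<..}) (\<lambda>(a, b). \<Phi> a b)"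
  shows "edge_functional 1 \<Phi>"
proof -
  have "\<Phi> (a + u * (b - a)) (b - v * (b - a)) \<le> (1 - (u + v)) * \<Phi> a b"
    if "a > 0" "b > 0" "u \<ge> 0" "v \<ge> 0" "u + v < 1" for a b u v :: real
  proof -
    let ?w = "\<lambda>k::nat. if k = 0 then 1 - (u + v) else if k = 1 then u else v"
    let ?z = "\<lambda>k::nat. if k = 0 then (a, b) else if k = 1 then (b, b) else (a, a)"
    have "(\<lambda>(a, b). \<Phi> a b) (\<Sum>k\<in>{0,1,2}. ?w k *\<^sub>R ?z k) \<le> (\<Sum>k\<in>{0,1,2}. ?w k * (\<lambda>(a, b). \<Phi> a b) (?z k))"
      by (rule convex_on_sum[OF _ _ conv]) (use that in auto)
    moreover have "(\<Sum>k\<in>{0,1,2}. ?w k *\<^sub>R ?z k) = (a + u * (b - a), b - v * (b - a))"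
      by (simp add: algebra_simps)
    ultimately show ?thesis
      using diag[OF that(1)] diag[OF that(2)] by simp
  qed
  then show ?thesis
    using assms by (auto simp: edge_functional_def)
qed

text \<open>The quadratic functional is the tool for showing that the Euler iterates converge to a
  constant.\<close>

lemma edge_functional_square: "edge_functional 1 (\<lambda>a b. (b - a)\<^sup>2)"
proof (rule edge_functional_convex)
  have "convex_on UNIV (\<lambda>x::real \<times> real. (snd x - fst x)\<^sup>2)"
  proof (rule convex_onI)
    fix t :: real and x y :: "real \<times> real"
    assume t: "0 < t" "t < 1"
    let ?p = "snd x - fst x" and ?q = "snd y - fst y"
    have "snd ((1 - t) *\<^sub>R x + t *\<^sub>R y) - fst ((1 - t) *\<^sub>R x + t *\<^sub>R y) = (1 - t) * ?p + t * ?q"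
      by (simp add: algebra_simps)
    moreover have "((1 - t) * ?p + t * ?q)\<^sup>2 \<le> (1 - t) * ?p\<^sup>2 + t * ?q\<^sup>2"
    proof -
      have "(1 - t) * ?p\<^sup>2 + t * ?q\<^sup>2 - ((1 - t) * ?p + t * ?q)\<^sup>2 = t * (1 - t) * (?p - ?q)\<^sup>2"
        by (simp add: power2_eq_square algebra_simps)
      moreover have "\<dots> \<ge> 0" using t by simp
      ultimately show ?thesis by linarith
    qed
    ultimately show "(snd ((1 - t) *\<^sub>R x + t *\<^sub>R y) - fst ((1 - t) *\<^sub>R x + t *\<^sub>R y))\<^sup>2
        \<le> (1 - t) * ?p\<^sup>2 + t * ?q\<^sup>2" by simp
  qed simp
  then have "convex_on ({0<..} \<times> {0<..}) (\<lambda>x::real \<times> real. (snd x - fst x)\<^sup>2)"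
    by (rule convex_on_subset) (auto simp: convex_Times)
  then show "convex_on ({0<..} \<times> {0<..}) (\<lambda>(a::real, b). (b - a)\<^sup>2)"
    by (simp add: split_def)
qed (auto simp: power2_commute)

text \<open>What the entropy argument uses of \<phi>: the tangent inequality controls one Euler
  step, continuity the limit of the iterates, nonnegativity the monotone limit over cubes. Only
  positive arguments occur.\<close>

definition entropy_density :: "(real \<Rightarrow> real) \<Rightarrow> bool" where
  "entropy_density \<phi> \<longleftrightarrow> (\<forall>a>0. \<phi> a \<ge> 0 \<and> isCont \<phi> a) \<and>
     (\<forall>a>0. \<forall>b>0. \<phi> a + deriv \<phi> a * (b - a) \<le> \<phi> b)"

lemma entropy_density_bregman_nonneg:
  assumes "entropy_density \<phi>" "a > 0" "b > 0"
  shows "bregman_symm \<phi> a b \<ge> 0"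
proof -
  have "\<phi> a + deriv \<phi> a * (b - a) \<le> \<phi> b" "\<phi> b + deriv \<phi> b * (a - b) \<le> \<phi> a"
    using assms by (auto simp: entropy_density_def)
  then show ?thesis
    by (simp add: bregman_symm_def algebra_simps)
qed

lemma convex_on_tangent:
  assumes "convex_on {0<..} \<phi>" "(\<phi> has_real_derivative D) (at a)" "a > 0" "(b::real) > 0"
  shows "\<phi> a + D * (b - a) \<le> \<phi> b"
  using convex_on_imp_above_tangent[OF assms(1), of a b D] assms
  by (simp add: interior_open has_field_derivative_at_within algebra_simps)

lemma entropy_density_admissible:
  assumes "admissible \<phi>"
  shows "entropy_density \<phi>"
proof -
  have "convex_on {0<..} \<phi>"
    using assms by (auto simp: admissible_def intro: convex_on_subset)
  moreover have "(\<phi> has_real_derivative deriv \<phi> a) (at a)" if "a > 0" for a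
    using assms that by (simp add: admissible_def DERIV_deriv_iff_real_differentiable)
  moreover have "\<phi> a \<ge> 0" if "a > 0" for a
    using assms that by (simp add: admissible_def)
  ultimately show ?thesis
    by (auto simp: entropy_density_def intro!: DERIV_isCont convex_on_tangent)
qed

lemma edge_functional_admissible:
  assumes "admissible \<phi>"
  shows "edge_functional 1 (bregman_symm \<phi>)"
proof (rule edge_functional_convex)
  show "convex_on ({0<..} \<times> {0<..}) (\<lambda>(a, b). bregman_symm \<phi> a b)"
    using assms by (simp add: admissible_def)
  show "bregman_symm \<phi> a b \<ge> 0" if "a > 0" "b > 0" for a b
    using entropy_density_bregman_nonneg entropy_density_admissible[OF assms] that by blast
qed (auto simp: bregman_symm_def algebra_simps)

section \<open>The Beckner functions\<close>

definition beckner_deriv :: "real \<Rightarrow> real \<Rightarrow> real" where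
  "beckner_deriv \<alpha> a = (if \<alpha> = 1 then ln a else \<alpha> / (\<alpha> - 1) * (a powr (\<alpha> - 1) - 1))"

lemma DERIV_beckner_fun:
  assumes "a > 0"
  shows "(beckner_fun \<alpha> has_real_derivative beckner_deriv \<alpha> a) (at a)"
proof (cases "\<alpha> = 1")
  case True
  have "((\<lambda>a. a * ln a - a + 1) has_real_derivative ln a) (at a)"
    using assms by (auto intro!: derivative_eq_intros)
  then show ?thesis
    using True by (simp add: beckner_fun_def[abs_def] beckner_deriv_def)
next
  case False
  have "((\<lambda>a. (a powr \<alpha> - a) / (\<alpha> - 1) - a + 1) has_real_derivative
      (\<alpha> * a powr (\<alpha> - 1) - 1) / (\<alpha> - 1) - 1) (at a)"
    using assms False by (auto intro!: derivative_eq_intros simp: powr_diff)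
  moreover have "(\<alpha> * a powr (\<alpha> - 1) - 1) / (\<alpha> - 1) - 1 = beckner_deriv \<alpha> a"
    using False by (simp add: beckner_deriv_def divide_simps) (simp add: algebra_simps)
  ultimately show ?thesis
    using False by (simp add: beckner_fun_def[abs_def])
qed

lemma DERIV_beckner_deriv:
  assumes "a > 0"
  shows "(beckner_deriv \<alpha> has_real_derivative \<alpha> * a powr (\<alpha> - 2)) (at a)"
proof (cases "\<alpha> = 1")
  case True
  have "(ln has_real_derivative a powr - 1) (at a)"
    using assms by (auto intro!: derivative_eq_intros simp: powr_minus divide_simps)
  then show ?thesis
    using True by (simp add: beckner_deriv_def[abs_def])
next
  case False
  have "((\<lambda>a. \<alpha> / (\<alpha> - 1) * (a powr (\<alpha> - 1) - 1)) has_real_derivative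
      \<alpha> / (\<alpha> - 1) * ((\<alpha> - 1) * a powr (\<alpha> - 1 - 1))) (at a)"
    using assms by (auto intro!: derivative_eq_intros)
  moreover have "\<alpha> / (\<alpha> - 1) * ((\<alpha> - 1) * a powr (\<alpha> - 1 - 1)) = \<alpha> * a powr (\<alpha> - 2)"
    using False by (simp add: diff_diff_eq)
  ultimately show ?thesis
    using False by (simp add: beckner_deriv_def[abs_def])
qed

lemma deriv_beckner_fun: "a > 0 \<Longrightarrow> deriv (beckner_fun \<alpha>) a = beckner_deriv \<alpha> a"
  by (rule DERIV_imp_deriv) (rule DERIV_beckner_fun)

lemma entropy_density_beckner:
  assumes "\<alpha> \<ge> 1"
  shows "entropy_density (beckner_fun \<alpha>)"
proof -
  have conv: "convex_on {0<..} (beckner_fun \<alpha>)"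
    by (rule f''_ge0_imp_convex[where f' = "beckner_deriv \<alpha>" and f'' = "\<lambda>a. \<alpha> * a powr (\<alpha> - 2)"])
      (use assms in \<open>auto intro: DERIV_beckner_fun DERIV_beckner_deriv\<close>)
  have tangent: "beckner_fun \<alpha> a + deriv (beckner_fun \<alpha>) a * (b - a) \<le> beckner_fun \<alpha> b"
    if "a > 0" "b > 0" for a b
    using convex_on_tangent[OF conv DERIV_beckner_fun] that by (simp add: deriv_beckner_fun)
  moreover have "beckner_fun \<alpha> a \<ge> 0" if "a > 0" for a
    using tangent[of 1 a] that
    by (simp add: deriv_beckner_fun beckner_fun_def beckner_deriv_def split: if_splits)
  ultimately show ?thesis
    by (auto simp: entropy_density_def intro: DERIV_isCont DERIV_beckner_fun)
qed

text \<open>Positivity of the Hessian of the Bregman divergence of \<open>beckner_fun \<alpha>\<close>.\<close>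

lemma beckner_hessian_nonneg:
  fixes \<alpha> a b p r :: real
  assumes \<alpha>: "1 \<le> \<alpha>" "\<alpha> \<le> 2" and pos: "a > 0" "b > 0"
  shows "p\<^sup>2 * (a powr (\<alpha> - 2) + (2 - \<alpha>) * a powr (\<alpha> - 3) * (b - a))
      - 2 * p * r * a powr (\<alpha> - 2) + r\<^sup>2 * b powr (\<alpha> - 2) \<ge> 0"
proof -
  define x where "x = a powr (\<alpha> - 2)"
  define y where "y = b powr (\<alpha> - 2)"
  have xy: "x > 0" "y > 0" using pos by (auto simp: x_def y_def)
  \<comment> \<open>Weighted arithmetic-geometric mean with weights \<alpha> - 1 and 2 - \<alpha>.
    It bounds the coefficient of p^2 below by x^2 / y, after which the form dominates the complete
    square (p x - r y)^2 / y.\<close>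
  have a1: "a powr (\<alpha> - 1) * b powr (2 - \<alpha>) \<le> (\<alpha> - 1) * a + (2 - \<alpha>) * b"
    by (rule Youngs_inequality_0) (use assms in auto)
  have a3: "a powr (\<alpha> - 3) * a = x"
    using pos powr_add[of a "\<alpha> - 3" 1] by (simp add: x_def)
  have a31: "a powr (\<alpha> - 3) * a powr (\<alpha> - 1) = x\<^sup>2"
    by (simp add: x_def power2_eq_square flip: powr_add)
  have b2: "b powr (2 - \<alpha>) = 1 / y"
    using powr_minus[of b "\<alpha> - 2"] by (simp add: y_def field_simps)
  have "x + (2 - \<alpha>) * a powr (\<alpha> - 3) * (b - a) = a powr (\<alpha> - 3) * ((\<alpha> - 1) * a + (2 - \<alpha>) * b)"
    unfolding a3[symmetric] by (simp add: algebra_simps)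
  also have "\<dots> \<ge> a powr (\<alpha> - 3) * (a powr (\<alpha> - 1) * b powr (2 - \<alpha>))"
    by (rule mult_left_mono[OF a1]) simp
  also have "a powr (\<alpha> - 3) * (a powr (\<alpha> - 1) * b powr (2 - \<alpha>)) = x\<^sup>2 / y"
    using a31 b2 by (simp flip: mult.assoc)
  finally have "p\<^sup>2 * (x\<^sup>2 / y) \<le> p\<^sup>2 * (x + (2 - \<alpha>) * a powr (\<alpha> - 3) * (b - a))"
    by (rule mult_left_mono) simp
  moreover have "p\<^sup>2 * (x\<^sup>2 / y) - 2 * p * r * x + r\<^sup>2 * y = (p * x - r * y)\<^sup>2 / y"
    using xy by (simp add: field_simps power2_eq_square)
  moreover have "\<dots> \<ge> 0" using xy by simp
  ultimately show ?thesis
    unfolding x_def[symmetric] y_def[symmetric] by linarith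
qed

text \<open>Convexity is checked along segments. \<open>bregman_symm\<close> is the sum of the two
  one-sided Bregman divergences, so its second derivative is \<alpha> times the sum of two forms
  from \<open>beckner_hessian_nonneg\<close> with the roles of the ends exchanged.\<close>

lemma convex_bregman_beckner:
  assumes \<alpha>: "1 \<le> \<alpha>" "\<alpha> \<le> 2"
  shows "convex_on ({0<..} \<times> {0<..}) (\<lambda>(a, b). bregman_symm (beckner_fun \<alpha>) a b)"
proof (rule convex_onI)
  fix t :: real and x y :: "real \<times> real"
  assume t: "0 < t" "t < 1" and xy: "x \<in> {0<..} \<times> {0<..}" "y \<in> {0<..} \<times> {0<..}"
  define p where "p = fst y - fst x"
  define r where "r = snd y - snd x"
  define A where "A s = fst x + s * p" for s
  define B where "B s = snd x + s * r" for s
  let ?\<psi> = "beckner_deriv \<alpha>"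
  let ?d = "\<lambda>s. \<alpha> * s powr (\<alpha> - 2)"
  let ?dd = "\<lambda>s. \<alpha> * ((\<alpha> - 2) * s powr (\<alpha> - 3))"
  define g where "g s = (?\<psi> (B s) - ?\<psi> (A s)) * (B s - A s)" for s
  define g' where "g' s = (?d (B s) * r - ?d (A s) * p) * (B s - A s)
      + (?\<psi> (B s) - ?\<psi> (A s)) * (r - p)" for s
  define g'' where "g'' s = (?dd (B s) * r\<^sup>2 - ?dd (A s) * p\<^sup>2) * (B s - A s)
      + 2 * (?d (B s) * r - ?d (A s) * p) * (r - p)" for s
  have A': "(A has_real_derivative p) (at s)" and B': "(B has_real_derivative r) (at s)" for s
    by (auto simp: A_def[abs_def] B_def[abs_def] intro!: derivative_eq_intros)
  have pos: "A s > 0 \<and> B s > 0" if "0 \<le> s" "s \<le> 1" for s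
  proof -
    have "(1 - s) * u + s * v > 0" if "u > 0" "v > 0" for u v :: real
      using that \<open>0 \<le> s\<close> \<open>s \<le> 1\<close> by (cases "s = 1") (auto intro: add_pos_nonneg)
    from this[of "fst x" "fst y"] this[of "snd x" "snd y"] xy show ?thesis
      by (auto simp: A_def B_def p_def r_def algebra_simps)
  qed
  have "convex_on {0..1} g"
  proof (rule f''_ge0_imp_convex[where f' = g' and f'' = g''])
    fix s :: real assume "s \<in> {0..1}"
    then have s: "A s > 0" "B s > 0" using pos by auto
    note [derivative_intros] = DERIV_chain2[OF DERIV_beckner_deriv A'] DERIV_chain2[OF DERIV_beckner_deriv B']
    show "DERIV g s :> g' s"
      unfolding g_def[abs_def] g'_def using s A'[of s] B'[of s]
      by (auto intro!: derivative_eq_intros)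
    have d: "((\<lambda>s. s powr (\<alpha> - 2)) has_real_derivative (\<alpha> - 2) * z powr (\<alpha> - 3)) (at z)"
      if "z > 0" for z
    proof -
      have "((\<lambda>s. s powr (\<alpha> - 2)) has_real_derivative (\<alpha> - 2) * z powr (\<alpha> - 2 - 1)) (at z)"
        by (rule has_real_derivative_powr[OF that])
      then show ?thesis by (simp add: diff_diff_eq)
    qed
    note [derivative_intros] = DERIV_chain2[OF d A'] DERIV_chain2[OF d B']
    show "DERIV g' s :> g'' s"
      unfolding g'_def[abs_def] g''_def using s A'[of s] B'[of s]
      by (auto intro!: derivative_eq_intros simp: algebra_simps power2_eq_square)
    have "g'' s = \<alpha> *
       ((p\<^sup>2 * (A s powr (\<alpha> - 2) + (2 - \<alpha>) * A s powr (\<alpha> - 3) * (B s - A s))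
          - 2 * p * r * A s powr (\<alpha> - 2) + r\<^sup>2 * B s powr (\<alpha> - 2))
      + (r\<^sup>2 * (B s powr (\<alpha> - 2) + (2 - \<alpha>) * B s powr (\<alpha> - 3) * (A s - B s))
          - 2 * r * p * B s powr (\<alpha> - 2) + p\<^sup>2 * A s powr (\<alpha> - 2)))"
      unfolding g''_def by (simp add: algebra_simps power2_eq_square)
    also have "\<dots> \<ge> 0"
      using \<alpha> by (intro mult_nonneg_nonneg add_nonneg_nonneg beckner_hessian_nonneg s) auto
    finally show "g'' s \<ge> 0" .
  qed simp
  then have "g ((1 - t) *\<^sub>R 0 + t *\<^sub>R 1) \<le> (1 - t) * g 0 + t * g 1"
    by (rule convex_onD) (use t in auto)
  moreover have g: "g s = (\<lambda>(a, b). bregman_symm (beckner_fun \<alpha>) a b) ((1 - s) *\<^sub>R x + s *\<^sub>R y)"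
    if "0 \<le> s" "s \<le> 1" for s
  proof -
    have "(1 - s) *\<^sub>R x + s *\<^sub>R y = (A s, B s)"
      by (cases x, cases y) (simp add: A_def B_def p_def r_def algebra_simps)
    then show ?thesis
      using pos[OF that] by (simp add: bregman_symm_def deriv_beckner_fun g_def)
  qed
  ultimately show "(\<lambda>(a, b). bregman_symm (beckner_fun \<alpha>) a b) ((1 - t) *\<^sub>R x + t *\<^sub>R y)
      \<le> (1 - t) * (\<lambda>(a, b). bregman_symm (beckner_fun \<alpha>) a b) x
        + t * (\<lambda>(a, b). bregman_symm (beckner_fun \<alpha>) a b) y"
    using g[of t] g[of 0] g[of 1] t by simp
qed (simp add: convex_Times)

text \<open>The two ends are treated differently. At a the chord of the concave power gains u times
  the full increment, more than the required q u; at b the chord would go the wrong way, and the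
  tangent, of slope q b^(q-1), gains q v because b^(q-1) (b - a) is at least the increment of the
  power.\<close>

lemma powr_increment_contract:
  fixes a b u v q :: real
  assumes q: "0 \<le> q" "q \<le> 1" and ab: "0 < a" "a \<le> b" and uv: "0 \<le> u" "0 \<le> v" "u + v < 1"
  shows "(b - v * (b - a)) powr q - (a + u * (b - a)) powr q
     \<le> (1 - q * (u + v)) * (b powr q - a powr q)"
proof -
  have conc: "convex_on {0<..} (\<lambda>x. - (x powr q))"
  proof (rule f''_ge0_imp_convex[where f' = "\<lambda>x. - (q * x powr (q - 1))"
        and f'' = "\<lambda>x. - (q * ((q - 1) * x powr (q - 1 - 1)))"])
    show "0 \<le> - (q * ((q - 1) * x powr (q - 1 - 1)))" for x
    proof -
      have "0 \<le> q * ((1 - q) * x powr (q - 1 - 1))" using q by simp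
      also have "\<dots> = - (q * ((q - 1) * x powr (q - 1 - 1)))" by (metis minus_diff_eq mult_minus_left mult_minus_right)
      finally show ?thesis .
    qed
  qed (auto intro!: derivative_eq_intros)
  have bv: "b - v * (b - a) > 0"
  proof -
    have "v * (b - a) \<le> 1 * (b - a)" by (rule mult_right_mono) (use uv ab in auto)
    then show ?thesis using ab by simp
  qed
  have left: "(1 - u) * a powr q + u * b powr q \<le> (a + u * (b - a)) powr q"
    using convex_onD[OF conc, of u a b] uv ab by (simp add: algebra_simps)
  have "- (b powr q) + - (q * b powr (q - 1)) * ((b - v * (b - a)) - b) \<le> - ((b - v * (b - a)) powr q)"
    by (rule convex_on_tangent[OF conc]) (use ab bv in \<open>auto intro!: derivative_eq_intros\<close>)
  then have right: "(b - v * (b - a)) powr q \<le> b powr q - q * v * (b powr (q - 1) * (b - a))"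
    by (simp add: algebra_simps)
  have "b powr (q - 1) \<le> a powr (q - 1)"
    using powr_mono2'[of "q - 1" a b] q ab by simp
  then have "a * b powr (q - 1) \<le> a * a powr (q - 1)"
    using ab by (intro mult_left_mono) auto
  also have "\<dots> = a powr q" using powr_add[of a 1 "q - 1"] ab by simp
  finally have "b powr (q - 1) * (b - a) \<ge> b powr q - a powr q"
    using powr_add[of b 1 "q - 1"] ab by (simp add: algebra_simps)
  then have "q * v * (b powr (q - 1) * (b - a)) \<ge> q * v * (b powr q - a powr q)"
    by (rule mult_left_mono) (use q uv in auto)
  moreover have "q * u * (b powr q - a powr q) \<le> 1 * u * (b powr q - a powr q)"
    by (intro mult_right_mono) (use q uv ab powr_mono2[of q a b] in auto)
  ultimately show ?thesis
    using left right by (simp add: algebra_simps)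
qed

text \<open>For \<alpha> > 1 the functional is a multiple of the product of b - a, which shrinks by
  exactly 1 - (u + v), and of the increment of the power \<alpha> - 1, which shrinks by 1 -
  (\<alpha> - 1) (u + v). For \<alpha> = 1 convexity suffices.\<close>

lemma edge_functional_beckner:
  assumes \<alpha>: "1 \<le> \<alpha>" "\<alpha> \<le> 2"
  shows "edge_functional \<alpha> (bregman_symm (beckner_fun \<alpha>))"
proof -
  let ?\<Phi> = "bregman_symm (beckner_fun \<alpha>)"
  have nonneg: "?\<Phi> a b \<ge> 0" if "a > 0" "b > 0" for a b
    using entropy_density_bregman_nonneg entropy_density_beckner \<alpha> that by blast
  have one: "edge_functional 1 ?\<Phi>"
    by (rule edge_functional_convex)
      (use nonneg convex_bregman_beckner[OF \<alpha>] in \<open>auto simp: bregman_symm_def algebra_simps\<close>)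
  show ?thesis
  proof (cases "\<alpha> = 1")
    case True
    then show ?thesis using one by simp
  next
    case False
    then have \<alpha>1: "\<alpha> > 1" using \<alpha> by simp
    have sym: "?\<Phi> a b = ?\<Phi> b a" for a b
      by (simp add: bregman_symm_def algebra_simps)
    have \<Phi>: "?\<Phi> a b = \<alpha> / (\<alpha> - 1) * (b powr (\<alpha> - 1) - a powr (\<alpha> - 1)) * (b - a)"
      if "a > 0" "b > 0" for a b
      using that \<alpha>1 by (simp add: bregman_symm_def deriv_beckner_fun beckner_deriv_def algebra_simps)
    have le: "?\<Phi> (a + u * (b - a)) (b - v * (b - a)) \<le> (1 - (u + v)) * (1 - (\<alpha> - 1) * (u + v)) * ?\<Phi> a b"
      if "a > 0" "a \<le> b" "u \<ge> 0" "v \<ge> 0" "u + v < 1" for a b u v :: real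
    proof -
      have pos: "a + u * (b - a) > 0" "b - v * (b - a) > 0"
      proof -
        have "v * (b - a) \<le> 1 * (b - a)" by (rule mult_right_mono) (use that in auto)
        then show "b - v * (b - a) > 0" using that by simp
      qed (use that in \<open>simp add: add_pos_nonneg\<close>)
      have diff: "b - v * (b - a) - (a + u * (b - a)) = (1 - (u + v)) * (b - a)"
        by (simp add: algebra_simps)
      let ?D = "\<alpha> / (\<alpha> - 1) * ((1 - (u + v)) * (b - a))"
      have "?\<Phi> (a + u * (b - a)) (b - v * (b - a))
          = ?D * ((b - v * (b - a)) powr (\<alpha> - 1) - (a + u * (b - a)) powr (\<alpha> - 1))"
        unfolding \<Phi>[OF pos] diff by simp
      also have "\<dots> \<le> ?D * ((1 - (\<alpha> - 1) * (u + v)) * (b powr (\<alpha> - 1) - a powr (\<alpha> - 1)))"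
        by (intro mult_left_mono powr_increment_contract) (use that \<alpha> \<alpha>1 in auto)
      also have "\<dots> = (1 - (u + v)) * (1 - (\<alpha> - 1) * (u + v)) * ?\<Phi> a b"
        using that by (subst \<Phi>) (auto simp: mult_ac)
      finally show ?thesis .
    qed
    have "?\<Phi> (a + u * (b - a)) (b - v * (b - a)) \<le> (1 - (u + v)) * (1 - (\<alpha> - 1) * (u + v)) * ?\<Phi> a b"
      if "a > 0" "b > 0" "u \<ge> 0" "v \<ge> 0" "u + v < 1" for a b u v :: real
    proof (cases "a \<le> b")
      case True
      then show ?thesis using le that by blast
    next
      case False
      have eqs: "a + u * (b - a) = a - u * (a - b)" "b - v * (b - a) = b + v * (a - b)"
        by (auto simp: algebra_simps)
      have "?\<Phi> (a + u * (b - a)) (b - v * (b - a)) = ?\<Phi> (b + v * (a - b)) (a - u * (a - b))"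
        unfolding eqs by (rule sym)
      also have "\<dots> \<le> (1 - (v + u)) * (1 - (\<alpha> - 1) * (v + u)) * ?\<Phi> b a"
        by (rule le) (use that False in auto)
      also have "\<dots> = (1 - (u + v)) * (1 - (\<alpha> - 1) * (u + v)) * ?\<Phi> a b"
        unfolding sym[of b a] add.commute[of v u] ..
      finally show ?thesis .
    qed
    with one show ?thesis
      unfolding edge_functional_def by simp
  qed
qed


section \<open>Edge couplings on a finite cube\<close>

lemma sum_moves: "(\<Sum>\<sigma>\<in>UNIV. g \<sigma>) = (\<Sum>i\<in>UNIV. g (Up i)) + (\<Sum>i\<in>UNIV. g (Down i))"
  for g :: "'d::finite move \<Rightarrow> 'a::comm_monoid_add"
proof -
  have eq: "(UNIV :: 'd move set) = range Up \<union> range Down"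
    by (metis UNIV_I UnCI move.exhaust rangeI subsetI subset_antisym top_greatest)
  have "(\<Sum>\<sigma>\<in>UNIV. g \<sigma>) = sum g (range Up) + sum g (range Down)"
    unfolding eq by (rule sum.union_disjoint) auto
  also have "sum g (range Up) = (\<Sum>i\<in>UNIV. g (Up i))"
    by (subst sum.reindex) (auto simp: inj_def)
  also have "sum g (range Down) = (\<Sum>i\<in>UNIV. g (Down i))"
    by (subst sum.reindex) (auto simp: inj_def)
  finally show ?thesis .
qed

lemma sum_moves_split:
  "(\<Sum>\<sigma>\<in>UNIV. g \<sigma>) = g (Up i) + g (Down i) + (\<Sum>\<sigma>\<in>-{Up i, Down i}. g \<sigma>)"
  for g :: "'d::finite move \<Rightarrow> real"
proof -
  have "(\<Sum>\<sigma>\<in>UNIV. g \<sigma>) = sum g {Up i, Down i} + sum g (-{Up i, Down i})"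
    by (subst sum.union_disjoint[symmetric]) auto
  then show ?thesis by simp
qed

lemma sum_moves_except:
  "(\<Sum>\<sigma>\<in>-{Up i, Down i}. g \<sigma>) = (\<Sum>j\<in>-{i}. g (Up j) + g (Down j))"
  for g :: "'d::finite move \<Rightarrow> real"
proof -
  have "(\<Sum>\<sigma>\<in>-{Up i, Down i}. g \<sigma>) = (\<Sum>\<sigma>\<in>UNIV. if \<sigma> \<in> {Up i, Down i} then 0 else g \<sigma>)"
    by (intro sum.mono_neutral_cong_left) auto
  also have "\<dots> = (\<Sum>j\<in>UNIV. if j = i then 0 else g (Up j)) + (\<Sum>j\<in>UNIV. if j = i then 0 else g (Down j))"
    unfolding sum_moves by (intro arg_cong2[of _ _ _ _ "(+)"] sum.cong) auto
  also have "(\<Sum>j\<in>UNIV. if j = i then 0 else g (Up j)) = (\<Sum>j\<in>-{i}. g (Up j))"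
    by (intro sum.mono_neutral_cong_right) auto
  also have "(\<Sum>j\<in>UNIV. if j = i then 0 else g (Down j)) = (\<Sum>j\<in>-{i}. g (Down j))"
    by (intro sum.mono_neutral_cong_right) auto
  finally show ?thesis by (simp add: sum.distrib)
qed

declare One_nat_def [simp del]

lemma axis_one_nth [simp]: "axis i (1 :: nat) $ j = (if i = j then 1 else 0)"
  by (simp add: axis_def)

lemma act_Down_Up [simp]: "act (Down i) (x + axis i 1) = x"
  by (simp add: axis_def vec_eq_iff)

lemma nat_vec_induct [case_names 0 Suc]:
  fixes x :: "nat ^ 'd::finite"
  assumes "P 0" and "\<And>x i. P x \<Longrightarrow> P (x + axis i 1)"
  shows "P x"
proof (induction "\<Sum>i\<in>UNIV. x $ i" arbitrary: x rule: less_induct)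
  case less
  show ?case
  proof (cases "x = 0")
    case False
    then obtain i where i: "x $ i > 0" by (auto simp: vec_eq_iff)
    have "(\<Sum>j\<in>UNIV. (x - axis i 1) $ j) < (\<Sum>j\<in>UNIV. x $ j)"
      by (rule sum_strict_mono_ex1) (use i in \<open>auto intro!: exI[of _ i]\<close>)
    then have "P (x - axis i 1 + axis i 1)"
      by (intro assms(2) less)
    moreover have "x - axis i 1 + axis i 1 = x" using i by (auto simp: vec_eq_iff)
    ultimately show ?thesis by simp
  qed (simp add: assms(1))
qed

definition cube :: "nat \<Rightarrow> (nat ^ 'd::finite) set" where
  "cube N = {x. \<forall>i. x $ i \<le> N}"

lemma finite_cube: "finite (cube N :: (nat ^ 'd::finite) set)"
proof -
  have "(cube N :: (nat ^ 'd) set) \<subseteq> vec_lambda ` (PiE UNIV (\<lambda>_. {..N}))"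
  proof
    fix x :: "nat ^ 'd" assume "x \<in> cube N"
    then have "($) x \<in> PiE UNIV (\<lambda>_. {..N})" by (auto simp: cube_def)
    moreover have "x = vec_lambda (($) x)" by simp
    ultimately show "x \<in> vec_lambda ` (PiE UNIV (\<lambda>_. {..N}))" by blast
  qed
  then show ?thesis by (rule finite_subset) (intro finite_imageI finite_PiE, auto)
qed

lemma zero_in_cube: "0 \<in> cube N"
  by (simp add: cube_def)

lemma plus_axis_in_cube: "x \<in> cube N \<Longrightarrow> x $ i < N \<Longrightarrow> x + axis i 1 \<in> cube N"
  by (auto simp: cube_def axis_def)

text \<open>Points on the two opposite faces have no partner under the shift; there the terms
  vanish, typically because the downward rate is zero at 0 and the truncated upward rate at
  \<open>N\<close>.\<close>

lemma sum_cube_shift: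
  fixes G H :: "nat ^ 'd::finite \<Rightarrow> real"
  assumes "\<And>x. x \<in> cube N \<Longrightarrow> x $ i = 0 \<Longrightarrow> G x = 0"
    and "\<And>x. x \<in> cube N \<Longrightarrow> x $ i = N \<Longrightarrow> H x = 0"
    and "\<And>x. x \<in> cube N \<Longrightarrow> x $ i < N \<Longrightarrow> G (x + axis i 1) = H x"
  shows "sum G (cube N) = sum H (cube N)"
proof -
  have "sum G (cube N) = sum G {x \<in> cube N. x $ i > 0}"
    by (rule sum.mono_neutral_right) (use assms in \<open>auto simp: finite_cube\<close>)
  also have "\<dots> = sum H {x \<in> cube N. x $ i < N}"
  proof (rule sum.reindex_bij_witness[where i = "\<lambda>x. x + axis i 1" and j = "\<lambda>x. x - axis i 1"])
    fix x :: "nat ^ 'd" assume x: "x \<in> {x \<in> cube N. x $ i > 0}"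
    show eq: "x - axis i 1 + axis i 1 = x"
      using x by (auto simp: vec_eq_iff axis_def)
    show mem: "x - axis i 1 \<in> {x \<in> cube N. x $ i < N}"
      using x by (auto simp: cube_def axis_def intro: le_trans[OF diff_le_self] less_le_trans[OF diff_less])
    show "H (x - axis i 1) = G x"
      using assms(3)[of "x - axis i 1"] mem eq by simp
  next
    fix x :: "nat ^ 'd" assume x: "x \<in> {x \<in> cube N. x $ i < N}"
    show "x + axis i 1 \<in> {x \<in> cube N. x $ i > 0}"
      using x plus_axis_in_cube[of x N i] by simp
  qed (auto simp: vec_eq_iff)
  also have "\<dots> = sum H (cube N)"
    by (rule sum.mono_neutral_left)
      (use assms(2) finite_cube in \<open>auto simp: cube_def intro: le_neq_implies_less\<close>)
  finally show ?thesis .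
qed

text \<open>The rate from x to x + e_i has two duties: it accompanies a further step up of the upper
  end, hence the term \<open>c (x + axis i 1) (Up i)\<close>, and it compensates the other moves
  that are faster at the upper end. This is what is left.\<close>

definition up_slack :: "'d::finite rates \<Rightarrow> nat ^ 'd \<Rightarrow> 'd \<Rightarrow> real" where
  "up_slack c x i = c x (Up i) - c (x + axis i 1) (Up i)
     - (\<Sum>\<sigma>\<in>-{Up i, Down i}. max 0 (c (x + axis i 1) \<sigma> - c x \<sigma>))"

definition down_slack :: "'d::finite rates \<Rightarrow> nat ^ 'd \<Rightarrow> 'd \<Rightarrow> real" where
  "down_slack c x i = c (x + axis i 1) (Down i) - c x (Down i)
     - (\<Sum>\<sigma>\<in>-{Up i, Down i}. max 0 (c x \<sigma> - c (x + axis i 1) \<sigma>))"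

text \<open>The two ends \<open>x\<close> and \<open>y = x + axis i 1\<close> of an edge move jointly: with index 0 both ends perform
  \<open>\<sigma>\<close>, with index 1 the end \<open>y\<close> performs \<open>\<sigma>\<close> while \<open>x\<close> moves to \<open>y\<close>, with index 2 the end \<open>x\<close>
  performs \<open>\<sigma>\<close> while \<open>y\<close> moves to \<open>x\<close>. What remains of the rates from \<open>x\<close> to \<open>y\<close> and from \<open>y\<close> to \<open>x\<close> is
  \<open>up_slack\<close> and \<open>down_slack\<close>, and merges the two ends.\<close>

definition cpl_rate :: "'d::finite rates \<Rightarrow> nat ^ 'd \<Rightarrow> 'd \<Rightarrow> 'd move \<Rightarrow> nat \<Rightarrow> real" where
  "cpl_rate c x i \<sigma> k = (let a = c x \<sigma>; b = c (x + axis i 1) \<sigma> in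
     if \<sigma> = Up i then (if k = 0 then b else 0)
     else if \<sigma> = Down i then (if k = 0 then a else 0)
     else if k = 0 then min a b else if k = 1 then max 0 (b - a) else max 0 (a - b))"

definition cpl_target :: "nat ^ 'd \<Rightarrow> 'd \<Rightarrow> 'd move \<Rightarrow> nat \<Rightarrow> (nat ^ 'd::finite) \<times> (nat ^ 'd)" where
  "cpl_target x i \<sigma> k = (let y = x + axis i 1 in
     if k = 0 then (act \<sigma> x, act \<sigma> y) else if k = 1 then (y, act \<sigma> y) else (act \<sigma> x, x))"

text \<open>The generator of the motion on edges, without merging, applied to \<open>g\<close> at
  the edge from x to x + e_i, one move at a time.\<close>

definition edge_flux ::
  "'d::finite rates \<Rightarrow> (nat ^ 'd \<Rightarrow> nat ^ 'd \<Rightarrow> real) \<Rightarrow> nat ^ 'd \<Rightarrow> 'd \<Rightarrow> 'd move \<Rightarrow> real" where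
  "edge_flux c g x i \<sigma> = (\<Sum>k<3. cpl_rate c x i \<sigma> k *
     (case_prod g (cpl_target x i \<sigma> k) - g x (x + axis i 1)))"

lemma sum_lessThan_3: "(\<Sum>k<3. g k) = g 0 + g 1 + g (2::nat)" for g :: "nat \<Rightarrow> 'a::comm_monoid_add"
  by (simp add: numeral_3_eq_3 numeral_2_eq_2 One_nat_def)

text \<open>\<open>up_path\<close> is the form in which the potential of the birth rates enters. The
  weights are positive on the whole lattice and not normalized on the cube.\<close>

locale cube_chain =
  fixes N :: nat and c :: "'d::finite rates" and m :: "nat ^ 'd \<Rightarrow> real" and \<kappa> :: real
  assumes rate_nonneg: "\<And>x \<sigma>. c x \<sigma> \<ge> 0"
    and up_pos: "\<And>x i. x $ i < N \<Longrightarrow> c x (Up i) > 0"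
    and up_zero: "\<And>x i. x $ i \<ge> N \<Longrightarrow> c x (Up i) = 0"
    and down_zero: "\<And>x i. x $ i = 0 \<Longrightarrow> c x (Down i) = 0"
    and weight_pos: "\<And>x. m x > 0"
    and detailed_balance: "\<And>x i. x $ i < N \<Longrightarrow>
       m x * c x (Up i) = m (x + axis i 1) * c (x + axis i 1) (Down i)"
    and up_path: "\<And>x i j. i \<noteq> j \<Longrightarrow> c x (Up i) * c (x + axis i 1) (Up j) = c x (Up j) * c (x + axis j 1) (Up i)"
    and up_slack_nonneg: "\<And>x i. x $ i < N \<Longrightarrow> up_slack c x i \<ge> 0"
    and down_slack_nonneg: "\<And>x i. x $ i < N \<Longrightarrow> down_slack c x i \<ge> 0"
    and slack_ge: "\<And>x i. x $ i < N \<Longrightarrow> up_slack c x i + down_slack c x i \<ge> \<kappa>"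
    and kappa_pos: "\<kappa> > 0"
begin

section \<open>Generator, Euler step and stationarity of the edge measure\<close>

definition gen :: "(nat ^ 'd \<Rightarrow> real) \<Rightarrow> nat ^ 'd \<Rightarrow> real" where
  "gen f x = (\<Sum>\<sigma>\<in>UNIV. c x \<sigma> * grad \<sigma> f x)"

text \<open>Values off the cube are frozen, so that iterates of a positive function stay positive
  everywhere.\<close>

definition euler :: "real \<Rightarrow> (nat ^ 'd \<Rightarrow> real) \<Rightarrow> nat ^ 'd \<Rightarrow> real" where
  "euler h f x = f x + h * gen f x * of_bool (x \<in> cube N)"

definition energy :: "(real \<Rightarrow> real \<Rightarrow> real) \<Rightarrow> (nat ^ 'd \<Rightarrow> real) \<Rightarrow> real" where
  "energy \<Phi> f = (\<Sum>x\<in>cube N. \<Sum>i\<in>UNIV. m x * c x (Up i) * \<Phi> (f x) (f (x + axis i 1)))"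

text \<open>A crude bound for the total jump rate on the cube. Its size is irrelevant, since h tends
  to 0 with the cube fixed.\<close>

definition K :: real where
  "K = (\<Sum>x\<in>cube N. \<Sum>\<sigma>\<in>UNIV. c x \<sigma>)"

lemma total_le_K: "x \<in> cube N \<Longrightarrow> (\<Sum>\<sigma>\<in>UNIV. c x \<sigma>) \<le> K"
  unfolding K_def by (rule member_le_sum) (auto simp: finite_cube rate_nonneg intro: sum_nonneg)

lemma sum_by_parts:
  "(\<Sum>x\<in>cube N. m x * u x * gen f x)
    = -
      (\<Sum>x\<in>cube N. \<Sum>i\<in>UNIV. m x * c x (Up i) * ((u (x + axis i 1) - u x) * (f (x + axis i 1) - f x)))"
proof -
  let ?G = "\<lambda>i x. m x * u x * (c x (Down i) * grad (Down i) f x)"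
  let ?H = "\<lambda>i x. m x * c x (Up i) * (u (x + axis i 1) * (f x - f (x + axis i 1)))"
  have shift: "sum (?G i) (cube N) = sum (?H i) (cube N)" for i
  proof (rule sum_cube_shift[where i = i])
    fix x :: "nat ^ 'd" assume "x $ i < N"
    then show "?G i (x + axis i 1) = ?H i x"
      using detailed_balance[of x i] by (simp add: grad_def)
  qed (auto simp: down_zero up_zero)
  have "(\<Sum>x\<in>cube N. m x * u x * gen f x)
     = (\<Sum>x\<in>cube N. \<Sum>i\<in>UNIV. m x * u x * (c x (Up i) * grad (Up i) f x)) + (\<Sum>x\<in>cube N. \<Sum>i\<in>UNIV. ?G i x)"
    unfolding gen_def sum_moves by (simp add: sum_distrib_left distrib_left sum.distrib)
  also have "(\<Sum>x\<in>cube N. \<Sum>i\<in>UNIV. ?G i x) = (\<Sum>i\<in>UNIV. \<Sum>x\<in>cube N. ?G i x)"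
    by (rule sum.swap)
  also have "\<dots> = (\<Sum>i\<in>UNIV. \<Sum>x\<in>cube N. ?H i x)"
    by (simp only: shift)
  also have "\<dots> = (\<Sum>x\<in>cube N. \<Sum>i\<in>UNIV. ?H i x)"
    by (rule sum.swap)
  finally have "(\<Sum>x\<in>cube N. m x * u x * gen f x) =
      (\<Sum>x\<in>cube N. \<Sum>i\<in>UNIV. m x * u x * (c x (Up i) * grad (Up i) f x) + ?H i x)"
    by (simp only: sum.distrib)
  also have "\<dots> = (\<Sum>x\<in>cube N. \<Sum>i\<in>UNIV.
      - (m x * c x (Up i) * ((u (x + axis i 1) - u x) * (f (x + axis i 1) - f x))))"
    by (intro sum.cong refl) (simp add: grad_def algebra_simps)
  finally show ?thesis
    by (simp only: sum_negf)
qed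

text \<open>The edges of one line form a birth and death chain that is reversible for the weights
  m(x) c(x, x + e_i): with y = x + e_i, detailed balance turns m(x) c(x, Up i) c(y, Up i) into m(y)
  c(y, Up i) c(y, Down i), the flow back.\<close>

lemma flux_line_balance:
  "(\<Sum>x\<in>cube N. m x * c x (Up i) * (edge_flux c g x i (Up i) + edge_flux c g x i (Down i))) = 0"
proof -
  let ?y = "\<lambda>x. x + axis i 1 :: nat ^ 'd"
  let ?A = "\<lambda>x. m x * c x (Up i) * (c (?y x) (Up i) * (g (?y x) (?y (?y x)) - g x (?y x)))"
  let ?G = "\<lambda>x. m x * c x (Up i) * (c x (Down i) * (g (act (Down i) x) x - g x (?y x)))"
  have "edge_flux c g x i (Up i) = c (?y x) (Up i) * (g (?y x) (?y (?y x)) - g x (?y x))" for x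
    by (simp add: edge_flux_def sum_lessThan_3 cpl_rate_def cpl_target_def Let_def)
  moreover have "edge_flux c g x i (Down i) = c x (Down i) * (g (act (Down i) x) x - g x (?y x))" for x
    by (simp add: edge_flux_def sum_lessThan_3 cpl_rate_def cpl_target_def Let_def del: act.simps)
  ultimately have "(\<Sum>x\<in>cube N. m x * c x (Up i) * (edge_flux c g x i (Up i) + edge_flux c g x i (Down i)))
     = sum ?A (cube N) + sum ?G (cube N)"
    by (simp add: distrib_left sum.distrib del: act.simps)
  also have "sum ?G (cube N) = sum (\<lambda>x. - ?A x) (cube N)"
  proof (rule sum_cube_shift[where i = i])
    fix x :: "nat ^ 'd" assume "x $ i < N"
    then show "?G (?y x) = - ?A x"
      using detailed_balance[of x i] unfolding act_Down_Up by (simp add: algebra_simps)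
  qed (auto simp: down_zero up_zero)
  finally show ?thesis by (simp add: sum_negf)
qed

text \<open>The variables \<open>b\<close>, \<open>t\<close>, \<open>l\<close>, \<open>r\<close> stand for the values of a function at the bottom, top, left and right edge
  of a square. Edges move from bottom to top and from left to right at rate \<open>min U W\<close>, back at rate \<open>min W D\<close>, and
  around the corners at the remaining rates. Each edge receives as much as it emits.\<close>

lemma square_balance:
  fixes U W D :: real
  shows "(min U W * (t - b) + max 0 (W - U) * (r - b) + max 0 (U - W) * (l - b))
    + (min W D * (b - t) + max 0 (D - W) * (r - t) + max 0 (W - D) * (l - t))
    + ((min U W * (r - l) + max 0 (W - U) * (t - l) + max 0 (U - W) * (b - l))
    + (min W D * (l - r) + max 0 (D - W) * (t - r) + max 0 (W - D) * (b - r))) = 0"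
  by (cases "U \<le> W"; cases "W \<le> D") (simp_all add: min_def max_def algebra_simps)

text \<open>The contribution of the two \<open>i\<close>-edges of the square with lowest corner x:
  the one at x attempts \<open>Up j\<close>, the opposite one \<open>Down j\<close>.\<close>

definition square_flux :: "(nat ^ 'd \<Rightarrow> nat ^ 'd \<Rightarrow> real) \<Rightarrow> nat ^ 'd \<Rightarrow> 'd \<Rightarrow> 'd \<Rightarrow> real" where
  "square_flux g x i j = m x * c x (Up i) * edge_flux c g x i (Up j) + 
     (if x $ j < N then m (x + axis j 1) * c (x + axis j 1) (Up i) * edge_flux c g (x + axis j 1) i (Down j) else 0)"

text \<open>Both monotone paths from x to the opposite corner carry the same weight, by the path
  identity, so one number \<open>W\<close> governs both mixed corners, while \<open>U\<close> and
  \<open>D\<close> belong to the lowest and the highest corner. With these three numbers the four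
  edges exchange mass as in \<open>square_balance\<close>.\<close>

lemma square_flux_antisym:
  assumes sym: "\<And>x y. g x y = g y x" and ij: "i \<noteq> j"
  shows "square_flux g x i j + square_flux g x j i = 0"
proof (cases "x $ i < N \<and> x $ j < N")
  case False
  then have "x $ i \<ge> N \<or> x $ j \<ge> N" by auto
  moreover have "square_flux g x i j = 0 \<and> square_flux g x j i = 0" if "x $ i \<ge> N" "i \<noteq> j" for i j
  proof -
    have "c x (Up i) = 0" "c (x + axis j 1) (Up i) = 0"
      using that by (auto simp: up_zero)
    then show ?thesis
      using that by (simp add: square_flux_def edge_flux_def sum_lessThan_3 cpl_rate_def Let_def)
  qed
  ultimately show ?thesis using ij by (metis add.right_neutral)
next
  case True
  define xi xj t where "xi = x + axis i 1" and "xj = x + axis j 1" and "t = x + axis i 1 + axis j 1"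
  have t: "xi + axis j 1 = t" "xj + axis i 1 = t"
    by (auto simp: t_def xi_def xj_def add_ac)
  define U where "U = m x * c x (Up i) * c x (Up j)"
  define W where "W = m x * c x (Up i) * c xi (Up j)"
  define D where "D = m t * c t (Down i) * c t (Down j)"
  have acts: "act (Down j) xj = x" "act (Down i) xi = x" "act (Down j) t = xi" "act (Down i) t = xj"
    using act_Down_Up[of j x] act_Down_Up[of i x] act_Down_Up[of j xi] act_Down_Up[of i xj]
    unfolding t unfolding xi_def xj_def by blast+
  have less: "xi $ j < N" "xj $ i < N"
    using True ij by (simp_all add: xi_def xj_def)
  have db: "m x * c x (Up i) = m xi * c xi (Down i)" "m x * c x (Up j) = m xj * c xj (Down j)"
    "m xi * c xi (Up j) = m t * c t (Down j)" "m xj * c xj (Up i) = m t * c t (Down i)"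
    using detailed_balance[of x i] detailed_balance[of x j] True
      detailed_balance[OF less(1)] detailed_balance[OF less(2)]
    unfolding t unfolding xi_def xj_def by blast+
  have path: "c x (Up i) * c xi (Up j) = c x (Up j) * c xj (Up i)"
    using up_path[OF ij, of x] by (simp add: xi_def xj_def)
  have W1: "m x * c x (Up j) * c xj (Up i) = W"
    unfolding W_def mult.assoc path ..
  have W2: "m xj * c xj (Up i) * c xj (Down j) = W"
    unfolding W1[symmetric] db(2) by (simp only: mult_ac)
  have W3: "m xi * c xi (Up j) * c xi (Down i) = W"
    unfolding W_def db(1) by (simp only: mult_ac)
  note W = W1 W2 W3
  have D: "m xj * c xj (Up i) * c t (Down j) = D" "m xi * c xi (Up j) * c t (Down i) = D"
    unfolding db(3,4) by (simp_all only: D_def mult_ac)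
  have U: "m x * c x (Up j) * c x (Up i) = U" by (simp add: U_def mult_ac)
  have flux: "w * edge_flux c g z k \<sigma> = min (w * c z \<sigma>) (w * c (z + axis k 1) \<sigma>)
        * (g (act \<sigma> z) (act \<sigma> (z + axis k 1)) - g z (z + axis k 1))
      + max 0 (w * c (z + axis k 1) \<sigma> - w * c z \<sigma>) * (g (z + axis k 1) (act \<sigma> (z + axis k 1)) - g z (z + axis k 1))
      + max 0 (w * c z \<sigma> - w * c (z + axis k 1) \<sigma>) * (g (act \<sigma> z) z - g z (z + axis k 1))"
    if "w \<ge> 0" "\<sigma> \<noteq> Up k" "\<sigma> \<noteq> Down k" for w z k \<sigma>
  proof -
    have dist: "min (w * a) (w * b) = w * min a b" "max 0 (w * a - w * b) = w * max 0 (a - b)" for a b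
      using \<open>w \<ge> 0\<close> by (simp_all add: min_mult_distrib_left max_mult_distrib_left right_diff_distrib)
    show ?thesis
      using that unfolding dist
      by (simp add: edge_flux_def sum_lessThan_3 cpl_rate_def cpl_target_def Let_def distrib_left mult.assoc
          del: act.simps)
  qed
  have nonneg: "m z * c z \<sigma> \<ge> 0" for z \<sigma>
    using weight_pos[of z] rate_nonneg[of z \<sigma>] by simp
  have up: "act (Up i) x = xi" "act (Up j) x = xj" "act (Up i) xj = t" "act (Up j) xi = t"
    using t by (simp_all add: xi_def xj_def)
  have Us: "m x * c x (Up i) * c x (Up j) = U" "m x * c x (Up i) * c xi (Up j) = W"
    "m t * c t (Down i) * c t (Down j) = D"
    by (simp_all add: U_def W_def D_def)
  note eqs = t up acts W D U Us xi_def[symmetric] xj_def[symmetric]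
  have f1: "m x * c x (Up i) * edge_flux c g x i (Up j) = min U W * (g xj t - g x xi)
      + max 0 (W - U) * (g xi t - g x xi) + max 0 (U - W) * (g xj x - g x xi)"
    using flux[of "m x * c x (Up i)" "Up j" i x] nonneg ij unfolding eqs by simp
  have f2: "m xj * c xj (Up i) * edge_flux c g xj i (Down j) = min W D * (g x xi - g xj t)
      + max 0 (D - W) * (g t xi - g xj t) + max 0 (W - D) * (g x xj - g xj t)"
    using flux[of "m xj * c xj (Up i)" "Down j" i xj] nonneg ij unfolding eqs by simp
  have f3: "m x * c x (Up j) * edge_flux c g x j (Up i) = min U W * (g xi t - g x xj)
      + max 0 (W - U) * (g xj t - g x xj) + max 0 (U - W) * (g xi x - g x xj)"
    using flux[of "m x * c x (Up j)" "Up i" j x] nonneg ij unfolding eqs by simp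
  have f4: "m xi * c xi (Up j) * edge_flux c g xi j (Down i) = min W D * (g x xj - g xi t)
      + max 0 (D - W) * (g t xj - g xi t) + max 0 (W - D) * (g x xi - g xi t)"
    using flux[of "m xi * c xi (Up j)" "Down i" j xi] nonneg ij unfolding eqs by simp
  show ?thesis
    using square_balance[of U W "g xj t" "g x xi" "g xi t" "g x xj" D] True
    unfolding square_flux_def xi_def[symmetric] xj_def[symmetric]
    by (simp add: f1 f2 f3 f4 sym[of t xi] sym[of xj x] sym[of xi x] sym[of t xj])
qed

text \<open>Stationarity of the edge measure. Moves in the direction of the edge cancel along lines;
  the remaining ones are grouped by squares and form a double sum that is antisymmetric in the two
  directions.\<close>

lemma flux_balance:
  assumes sym: "\<And>x y. g x y = g y x"
  shows "(\<Sum>x\<in>cube N. \<Sum>i\<in>UNIV. m x * c x (Up i) * (\<Sum>\<sigma>\<in>UNIV. edge_flux c g x i \<sigma>)) = 0"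
proof -
  let ?q = "\<lambda>x i. m x * c x (Up i)"
  have down: "(\<Sum>x\<in>cube N. ?q x i * edge_flux c g x i (Down j))
      = (\<Sum>x\<in>cube N. if x $ j < N then ?q (x + axis j 1) i * edge_flux c g (x + axis j 1) i (Down j) else 0)"
    if "i \<noteq> j" for i j
  proof (rule sum_cube_shift[where i = j])
    fix x :: "nat ^ 'd" assume "x $ j = 0"
    then have "c x (Down j) = 0" "c (x + axis i 1) (Down j) = 0"
      using that by (auto simp: down_zero)
    then show "?q x i * edge_flux c g x i (Down j) = 0"
      using that by (simp add: edge_flux_def sum_lessThan_3 cpl_rate_def Let_def)
  qed auto
  have sq: "(\<Sum>x\<in>cube N. ?q x i * (edge_flux c g x i (Up j) + edge_flux c g x i (Down j)))
      = (\<Sum>x\<in>cube N. square_flux g x i j)" if "i \<noteq> j" for i j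
    using down[OF that] by (simp add: square_flux_def distrib_left sum.distrib)
  have "(\<Sum>x\<in>cube N. \<Sum>i\<in>UNIV. ?q x i * (\<Sum>\<sigma>\<in>UNIV. edge_flux c g x i \<sigma>))
     = (\<Sum>i\<in>UNIV. \<Sum>x\<in>cube N. ?q x i * (\<Sum>\<sigma>\<in>UNIV. edge_flux c g x i \<sigma>))"
    by (rule sum.swap)
  also have "\<dots> = (\<Sum>i\<in>UNIV. (\<Sum>x\<in>cube N. ?q x i * (edge_flux c g x i (Up i) + edge_flux c g x i (Down i)))
      + (\<Sum>x\<in>cube N. \<Sum>j\<in>-{i}. ?q x i * (edge_flux c g x i (Up j) + edge_flux c g x i (Down j))))"
    (is "(\<Sum>i\<in>UNIV. ?l i) = (\<Sum>i\<in>UNIV. ?r i)")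
  proof (rule sum.cong)
    fix i
    show "?l i = ?r i"
      unfolding sum_moves_split[where i = i] sum_moves_except by (simp add: distrib_left sum.distrib sum_distrib_left)
  qed simp
  also have "\<dots> = (\<Sum>i\<in>UNIV. \<Sum>j\<in>-{i}. \<Sum>x\<in>cube N. square_flux g x i j)"
  proof (rule sum.cong)
    fix i :: 'd
    have "(\<Sum>x\<in>cube N. \<Sum>j\<in>-{i}. ?q x i * (edge_flux c g x i (Up j) + edge_flux c g x i (Down j)))
      = (\<Sum>j\<in>-{i}. \<Sum>x\<in>cube N. ?q x i * (edge_flux c g x i (Up j) + edge_flux c g x i (Down j)))"
      by (rule sum.swap)
    also have "\<dots> = (\<Sum>j\<in>-{i}. \<Sum>x\<in>cube N. square_flux g x i j)"
      by (rule sum.cong) (auto intro!: sq)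
    finally show "?r i = (\<Sum>j\<in>-{i}. \<Sum>x\<in>cube N. square_flux g x i j)"
      unfolding flux_line_balance by simp
  qed simp
  also have "\<dots> = (\<Sum>i\<in>UNIV. \<Sum>j\<in>UNIV. if i = j then 0 else \<Sum>x\<in>cube N. square_flux g x i j)"
    (is "_ = (\<Sum>i\<in>UNIV. \<Sum>j\<in>UNIV. ?T i j)")
    by (intro sum.cong refl sum.mono_neutral_cong_left) auto
  finally have eq: "(\<Sum>x\<in>cube N. \<Sum>i\<in>UNIV. ?q x i * (\<Sum>\<sigma>\<in>UNIV. edge_flux c g x i \<sigma>)) = (\<Sum>i\<in>UNIV. \<Sum>j\<in>UNIV. ?T i j)" .
  have anti: "?T i j = - ?T j i" for i j
  proof (cases "i = j")
    case False
    then have "square_flux g x i j = - square_flux g x j i" for x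
      using square_flux_antisym[of g i j x, OF sym] by simp
    then have "(\<Sum>x\<in>cube N. square_flux g x i j) = - (\<Sum>x\<in>cube N. square_flux g x j i)"
      by (simp only: sum_negf)
    then show ?thesis
      using False by simp
  qed simp
  have "(\<Sum>i\<in>UNIV. \<Sum>j\<in>UNIV. ?T i j) = (\<Sum>i\<in>UNIV. \<Sum>j\<in>UNIV. - ?T j i)"
    by (intro sum.cong refl anti)
  also have "\<dots> = - (\<Sum>i\<in>UNIV. \<Sum>j\<in>UNIV. ?T j i)"
    by (simp only: sum_negf)
  also have "(\<Sum>i\<in>UNIV. \<Sum>j\<in>UNIV. ?T j i) = (\<Sum>i\<in>UNIV. \<Sum>j\<in>UNIV. ?T i j)"
    by (rule sum.swap)
  finally show ?thesis using eq by simp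
qed

end


section \<open>Contraction of the Dirichlet form\<close>

context cube_chain
begin

section \<open>One Euler step of a coupled edge\<close>

lemma cpl_rate_nonneg: "cpl_rate c x i \<sigma> k \<ge> 0"
  using rate_nonneg by (simp add: cpl_rate_def Let_def)

text \<open>The first marginal of the edge coupling. All moves of x other than the one to x + e_i
  are reproduced exactly; the coupled moves use up part of that one, and the slack term is the
  rest.\<close>

lemma gen_fst:
  "gen f x = (\<Sum>\<sigma>\<in>UNIV. \<Sum>k<3. cpl_rate c x i \<sigma> k * (f (fst (cpl_target x i \<sigma> k)) - f x))
     + up_slack c x i * (f (x + axis i 1) - f x)"
proof -
  let ?y = "x + axis i 1"
  have rest: "(\<Sum>k<3. cpl_rate c x i \<sigma> k * (f (fst (cpl_target x i \<sigma> k)) - f x))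
     = c x \<sigma> * grad \<sigma> f x + max 0 (c ?y \<sigma> - c x \<sigma>) * (f ?y - f x)" if "\<sigma> \<notin> {Up i, Down i}" for \<sigma>
  proof -
    have "c x \<sigma> = min (c x \<sigma>) (c ?y \<sigma>) + max 0 (c x \<sigma> - c ?y \<sigma>)" by simp
    then have "c x \<sigma> * grad \<sigma> f x = min (c x \<sigma>) (c ?y \<sigma>) * grad \<sigma> f x + max 0 (c x \<sigma> - c ?y \<sigma>) * grad \<sigma> f x"
      by (metis distrib_right)
    then show ?thesis
      using that by (simp add: sum_lessThan_3 cpl_rate_def cpl_target_def Let_def grad_def)
  qed
  have "(\<Sum>\<sigma>\<in>UNIV. \<Sum>k<3. cpl_rate c x i \<sigma> k * (f (fst (cpl_target x i \<sigma> k)) - f x))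
     = c ?y (Up i) * (f ?y - f x) + c x (Down i) * grad (Down i) f x
       + (\<Sum>\<sigma>\<in>-{Up i, Down i}. c x \<sigma> * grad \<sigma> f x + max 0 (c ?y \<sigma> - c x \<sigma>) * (f ?y - f x))"
    unfolding sum_moves_split[where i = i]
    by (intro arg_cong2[of _ _ _ _ "(+)"] sum.cong refl rest)
      (simp_all add: sum_lessThan_3 cpl_rate_def cpl_target_def Let_def grad_def del: act.simps(2))
  moreover have "gen f x = c x (Up i) * (f ?y - f x) + c x (Down i) * grad (Down i) f x
      + (\<Sum>\<sigma>\<in>-{Up i, Down i}. c x \<sigma> * grad \<sigma> f x)"
    unfolding gen_def sum_moves_split[where i = i] by (simp add: grad_def del: act.simps(2))
  ultimately show ?thesis
    by (simp add: up_slack_def sum.distrib sum_distrib_right[symmetric] left_diff_distrib)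
qed

lemma gen_snd:
  "gen f (x + axis i 1) =
     (\<Sum>\<sigma>\<in>UNIV. \<Sum>k<3. cpl_rate c x i \<sigma> k * (f (snd (cpl_target x i \<sigma> k)) - f (x + axis i 1)))
     + down_slack c x i * (f x - f (x + axis i 1))"
proof -
  let ?y = "x + axis i 1"
  have rest: "(\<Sum>k<3. cpl_rate c x i \<sigma> k * (f (snd (cpl_target x i \<sigma> k)) - f ?y))
     = c ?y \<sigma> * grad \<sigma> f ?y + max 0 (c x \<sigma> - c ?y \<sigma>) * (f x - f ?y)" if "\<sigma> \<notin> {Up i, Down i}" for \<sigma>
  proof -
    have "c ?y \<sigma> = min (c x \<sigma>) (c ?y \<sigma>) + max 0 (c ?y \<sigma> - c x \<sigma>)" by simp
    then have "c ?y \<sigma> * grad \<sigma> f ?y = min (c x \<sigma>) (c ?y \<sigma>) * grad \<sigma> f ?y + max 0 (c ?y \<sigma> - c x \<sigma>) * grad \<sigma> f ?y"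
      by (metis distrib_right)
    then show ?thesis
      using that by (simp add: sum_lessThan_3 cpl_rate_def cpl_target_def Let_def grad_def)
  qed
  have "(\<Sum>\<sigma>\<in>UNIV. \<Sum>k<3. cpl_rate c x i \<sigma> k * (f (snd (cpl_target x i \<sigma> k)) - f ?y))
     = c ?y (Up i) * grad (Up i) f ?y + c x (Down i) * (f x - f ?y)
       + (\<Sum>\<sigma>\<in>-{Up i, Down i}. c ?y \<sigma> * grad \<sigma> f ?y + max 0 (c x \<sigma> - c ?y \<sigma>) * (f x - f ?y))"
    unfolding sum_moves_split[where i = i]
    by (intro arg_cong2[of _ _ _ _ "(+)"] sum.cong refl rest)
      (simp_all add: sum_lessThan_3 cpl_rate_def cpl_target_def Let_def grad_def del: act.simps(2))
  moreover have "gen f ?y = c ?y (Up i) * grad (Up i) f ?y + c ?y (Down i) * (f x - f ?y)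
      + (\<Sum>\<sigma>\<in>-{Up i, Down i}. c ?y \<sigma> * grad \<sigma> f ?y)"
    unfolding gen_def sum_moves_split[where i = i] by (simp add: grad_def del: act.simps(2))
  ultimately show ?thesis
    by (simp add: down_slack_def sum.distrib sum_distrib_right[symmetric] left_diff_distrib)
qed

text \<open>With \<open>h * K\<close> at most 1/4, the coupled jumps and the merging together take
  at most half of the weight in one Euler step.\<close>

lemma cpl_total_le:
  assumes "x \<in> cube N" "x $ i < N"
  shows "(\<Sum>\<sigma>\<in>UNIV. \<Sum>k<3. cpl_rate c x i \<sigma> k) + (up_slack c x i + down_slack c x i) \<le> 2 * K"
proof -
  let ?y = "x + axis i 1"
  let ?M = "\<lambda>\<sigma>. max 0 (c ?y \<sigma> - c x \<sigma>)" and ?M' = "\<lambda>\<sigma>. max 0 (c x \<sigma> - c ?y \<sigma>)"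
  have rest: "(\<Sum>k<3. cpl_rate c x i \<sigma> k) \<le> c x \<sigma> + c ?y \<sigma>" if "\<sigma> \<in> -{Up i, Down i}" for \<sigma>
    using that rate_nonneg[of x \<sigma>] rate_nonneg[of ?y \<sigma>]
    by (simp add: sum_lessThan_3 cpl_rate_def Let_def min_def max_def)
  have "(\<Sum>\<sigma>\<in>UNIV. \<Sum>k<3. cpl_rate c x i \<sigma> k)
      \<le> c ?y (Up i) + c x (Down i) + (\<Sum>\<sigma>\<in>-{Up i, Down i}. c x \<sigma> + c ?y \<sigma>)"
    unfolding sum_moves_split[where i = i]
    by (intro add_mono sum_mono rest) (simp_all add: sum_lessThan_3 cpl_rate_def Let_def)
  moreover have "up_slack c x i \<le> c x (Up i) - c ?y (Up i)" "down_slack c x i \<le> c ?y (Down i) - c x (Down i)"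
    unfolding up_slack_def down_slack_def by (simp_all add: sum_nonneg)
  moreover have "(\<Sum>\<sigma>\<in>UNIV. c x \<sigma>) + (\<Sum>\<sigma>\<in>UNIV. c ?y \<sigma>) \<le> 2 * K"
    using total_le_K[OF assms(1)] total_le_K[OF plus_axis_in_cube[OF assms]] by simp
  ultimately show ?thesis
    using rate_nonneg[of ?y "Up i"] rate_nonneg[of x "Down i"]
    unfolding sum_moves_split[where i = i and g = "c x"] sum_moves_split[where i = i and g = "c ?y"] sum.distrib
    by linarith
qed

lemma euler_pos:
  assumes f: "\<And>x. f x > 0" and h: "h > 0" "h * K \<le> 1 / 4"
  shows "euler h f x > 0"
proof (cases "x \<in> cube N")
  case True
  have "gen f x \<ge> (\<Sum>\<sigma>\<in>UNIV. c x \<sigma> * (- f x))"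
    unfolding gen_def grad_def
    by (intro sum_mono mult_left_mono rate_nonneg) (use f in \<open>simp add: less_imp_le\<close>)
  also have "(\<Sum>\<sigma>\<in>UNIV. c x \<sigma> * (- f x)) = - ((\<Sum>\<sigma>\<in>UNIV. c x \<sigma>) * f x)"
    by (simp add: sum_negf sum_distrib_right)
  also have "\<dots> \<ge> - (K * f x)"
    using total_le_K[OF True] f[of x] by (simp add: mult_right_mono)
  finally have "h * gen f x \<ge> h * (- (K * f x))"
    by (rule mult_left_mono) (use h in auto)
  moreover have "h * K * f x \<le> 1 / 4 * f x"
    by (rule mult_right_mono) (use h f[of x] in auto)
  ultimately have "f x + h * gen f x > 0"
    using f[of x] by (simp only: mult.assoc mult_minus_right)
  then show ?thesis
    using True by (simp add: euler_def)
next
  case False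
  then show ?thesis using f by (simp add: euler_def)
qed

text \<open>The pair of new values is a convex combination of the coupled targets and of one
  residual pair. By Jensen the targets produce the flux term; the residual pair carries the
  contraction, through the last clause of \<open>edge_functional\<close>.\<close>

lemma euler_edge:
  assumes \<Phi>: "edge_functional \<beta> \<Phi>" and \<beta>: "1 \<le> \<beta>" "\<beta> \<le> 2"
    and f: "\<And>x. f x > 0" and h: "h > 0" "h * K \<le> 1 / 4"
    and x: "x \<in> cube N" "x $ i < N"
  shows "\<Phi> (euler h f x) (euler h f (x + axis i 1))
    \<le> (1 - \<beta> * \<kappa> * h + 8 * K\<^sup>2 * h\<^sup>2) * \<Phi> (f x) (f (x + axis i 1))
      + h * (\<Sum>\<sigma>\<in>UNIV. edge_flux c (\<lambda>x y. \<Phi> (f x) (f y)) x i \<sigma>)"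
proof -
  define y where "y = x + axis i 1"
  define a b where "a = f x" and "b = f y"
  define p q where "p = up_slack c x i" and "q = down_slack c x i"
  let ?I = "UNIV \<times> {..<3} :: ('d move \<times> nat) set"
  let ?w = "\<lambda>(\<sigma>, k). cpl_rate c x i \<sigma> k"
  let ?z = "\<lambda>(\<sigma>, k). cpl_target x i \<sigma> k"
  define w where "w e = ?w e" for e
  define z where "z e = (f (fst (?z e)), f (snd (?z e)))" for e
  define s where "s = 1 - h * sum w ?I"
  have pq: "p \<ge> 0" "q \<ge> 0" "p + q \<ge> \<kappa>"
    using up_slack_nonneg down_slack_nonneg slack_ge x(2) by (auto simp: p_def q_def)
  have w: "w e \<ge> 0" for e
    using cpl_rate_nonneg by (simp add: w_def split: prod.splits)
  have sumI: "(\<Sum>e\<in>?I. G (fst e) (snd e)) = (\<Sum>\<sigma>\<in>UNIV. \<Sum>k<3. G \<sigma> k)" for G :: "'d move \<Rightarrow> nat \<Rightarrow> real"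
    by (simp add: sum.cartesian_product split_def)
  have sw: "sum w ?I = (\<Sum>\<sigma>\<in>UNIV. \<Sum>k<3. cpl_rate c x i \<sigma> k)"
    using sumI[of "cpl_rate c x i"] by (simp add: w_def[abs_def] split_def)
  have "h * (sum w ?I + (p + q)) \<le> h * (2 * K)"
    using cpl_total_le[OF x] h(1) unfolding sw p_def q_def by simp
  then have s_ge: "s \<ge> 1 / 2 + h * (p + q)"
    using h unfolding s_def distrib_left by linarith
  have hpq: "h * (p + q) \<ge> 0" using pq h by simp
  then have s: "s \<ge> 1 / 2" "s > 0" using s_ge by auto
  \<comment> \<open>Relative to the weight \<open>s\<close> of the residual outcome, the slacks pull
    the two values together by the fractions \<open>u\<close> and \<open>v\<close>;
    \<open>s_ge\<close> ensures u + v < 1.\<close>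
  define u v where "u = h * p / s" and "v = h * q / s"
  have uv: "u \<ge> 0" "v \<ge> 0" "u + v < 1"
    using pq h s s_ge by (auto simp: u_def v_def divide_simps distrib_left)
  have ab: "a > 0" "b > 0" using f by (auto simp: a_def b_def)
  define z0 where "z0 = (a + u * (b - a), b - v * (b - a))"
  have z0: "fst z0 > 0" "snd z0 > 0"
  proof -
    have "(1 - u) * a + u * b > 0" "v * a + (1 - v) * b > 0"
      using uv ab by (simp_all add: add_pos_nonneg add_nonneg_pos)
    then show "fst z0 > 0" "snd z0 > 0" by (auto simp: z0_def algebra_simps)
  qed
  have yb: "y \<in> cube N" using plus_axis_in_cube[OF x] by (simp add: y_def)
  have fst_eq: "s * fst z0 + (\<Sum>e\<in>?I. h * w e * fst (z e)) = euler h f x"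
  proof -
    have "gen f x = (\<Sum>e\<in>?I. w e * (fst (z e) - a)) + p * (b - a)"
      using gen_fst[of f x i] sumI[of "\<lambda>\<sigma> k. cpl_rate c x i \<sigma> k * (f (fst (cpl_target x i \<sigma> k)) - f x)"]
      by (simp add: w_def z_def a_def b_def p_def y_def split_def)
    then have "h * gen f x = (\<Sum>e\<in>?I. h * w e * fst (z e)) - h * sum w ?I * a + h * p * (b - a)"
      by (simp add: right_diff_distrib sum_subtractf sum_distrib_left sum_distrib_right distrib_left mult.assoc)
    moreover have "s * fst z0 = s * a + h * p * (b - a)"
      using s by (simp add: z0_def u_def distrib_left)
    ultimately show ?thesis
      using x by (simp add: euler_def s_def a_def algebra_simps)
  qed
  have snd_eq: "s * snd z0 + (\<Sum>e\<in>?I. h * w e * snd (z e)) = euler h f y"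
  proof -
    have "gen f y = (\<Sum>e\<in>?I. w e * (snd (z e) - b)) + q * (a - b)"
      using gen_snd[of f x i] sumI[of "\<lambda>\<sigma> k. cpl_rate c x i \<sigma> k * (f (snd (cpl_target x i \<sigma> k)) - f y)"]
      by (simp add: w_def z_def a_def b_def q_def y_def split_def)
    then have "h * gen f y = (\<Sum>e\<in>?I. h * w e * snd (z e)) - h * sum w ?I * b + h * q * (a - b)"
      by (simp add: right_diff_distrib sum_subtractf sum_distrib_left sum_distrib_right distrib_left mult.assoc)
    moreover have "s * snd z0 = s * b - h * q * (b - a)"
      using s by (simp add: z0_def v_def right_diff_distrib)
    ultimately show ?thesis
      using yb by (simp add: euler_def s_def b_def algebra_simps)
  qed
  let ?\<Phi> = "\<lambda>(a, b). \<Phi> a b"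
  have conv: "convex_on ({0<..} \<times> {0<..}) ?\<Phi>"
    using \<Phi> by (simp add: edge_functional_def)
  \<comment> \<open>\<open>None\<close> stands for the residual pair, \<open>Some e\<close> for a
    coupled jump.\<close>
  let ?W = "\<lambda>e. case e of None \<Rightarrow> s | Some e \<Rightarrow> h * w e"
  let ?Z = "\<lambda>e. case e of None \<Rightarrow> z0 | Some e \<Rightarrow> z e"
  have I: "finite (insert None (Some ` ?I))" by simp
  have sum_opt: "(\<Sum>e\<in>insert None (Some ` ?I). G e) = G None + (\<Sum>e\<in>?I. G (Some e))" for G :: "_ \<Rightarrow> 'e::ab_group_add"
    by (subst sum.insert) (auto simp: sum.reindex)
  have "?\<Phi> (\<Sum>e\<in>insert None (Some ` ?I). ?W e *\<^sub>R ?Z e) \<le> (\<Sum>e\<in>insert None (Some ` ?I). ?W e * ?\<Phi> (?Z e))"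
  proof (rule convex_on_sum[OF I _ conv])
    show "sum ?W (insert None (Some ` ?I)) = 1"
      unfolding sum_opt by (simp add: s_def sum_distrib_left)
    show "?W e \<ge> 0" for e using s w h by (auto split: option.splits)
    show "?Z e \<in> {0<..} \<times> {0<..}" for e
      using z0 f by (auto simp: z_def split: option.splits simp: mem_Times_iff)
  qed simp
  also have "(\<Sum>e\<in>insert None (Some ` ?I). ?W e *\<^sub>R ?Z e) = (euler h f x, euler h f y)"
    unfolding sum_opt fst_eq[symmetric] snd_eq[symmetric]
    by (intro prod_eqI) (simp_all add: fst_sum snd_sum)
  finally have jensen: "\<Phi> (euler h f x) (euler h f y) \<le> s * ?\<Phi> z0 + (\<Sum>e\<in>?I. h * w e * ?\<Phi> (z e))"
    unfolding sum_opt by simp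
  have stay: "s * ?\<Phi> z0 \<le> (s - \<beta> * \<kappa> * h + 8 * K\<^sup>2 * h\<^sup>2) * \<Phi> a b"
  proof -
    have nn: "\<Phi> a b \<ge> 0" using \<Phi> ab by (simp add: edge_functional_def)
    have "?\<Phi> z0 \<le> (1 - (u + v)) * (1 - (\<beta> - 1) * (u + v)) * \<Phi> a b"
      using \<Phi> ab uv unfolding z0_def edge_functional_def by simp
    then have "s * ?\<Phi> z0 \<le> s * ((1 - (u + v)) * (1 - (\<beta> - 1) * (u + v)) * \<Phi> a b)"
      using s by (intro mult_left_mono) auto
    also have "\<dots> = (s * (1 - (u + v)) * (1 - (\<beta> - 1) * (u + v))) * \<Phi> a b"
      by simp
    also have "s * (1 - (u + v)) * (1 - (\<beta> - 1) * (u + v)) \<le> s - \<beta> * \<kappa> * h + 8 * K\<^sup>2 * h\<^sup>2"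
    proof -
      define r where "r = h * (p + q)"
      have uv_r: "u + v = r / s" by (simp add: u_def v_def r_def add_divide_distrib distrib_left)
      have r: "0 \<le> r" "h * \<kappa> \<le> r" "r \<le> 2 * K * h"
      proof -
        have "sum w ?I \<ge> 0" using w by (simp add: sum_nonneg)
        then have "p + q \<le> 2 * K"
          using cpl_total_le[OF x] unfolding sw[symmetric] p_def[symmetric] q_def[symmetric] by linarith
        from mult_left_mono[OF this, of h] h show "r \<le> 2 * K * h" by (simp add: r_def mult_ac)
        show "0 \<le> r" "h * \<kappa> \<le> r"
          using pq h hpq by (simp_all add: r_def)
      qed
      \<comment> \<open>Expanding with u + v = r / s leaves the remainder (\<beta> - 1) r^2 / s.
        From r at most 2 K h, s at least 1/2 and \<beta> - 1 at most 1 comes the constant 8.\<close>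
      have "s * (1 - (u + v)) * (1 - (\<beta> - 1) * (u + v)) = s - \<beta> * r + (\<beta> - 1) * r\<^sup>2 / s"
        unfolding uv_r using s by (simp add: field_simps power2_eq_square)
      moreover have "\<beta> * (h * \<kappa>) \<le> \<beta> * r"
        using r \<beta> by (intro mult_left_mono) auto
      moreover have "(\<beta> - 1) * r\<^sup>2 / s \<le> 8 * K\<^sup>2 * h\<^sup>2"
      proof -
        have "(\<beta> - 1) * r\<^sup>2 / s \<le> 1 * (2 * K * h)\<^sup>2 / (1 / 2)"
          using \<beta> r s by (intro frac_le mult_mono power_mono) auto
        then show ?thesis by (simp add: power_mult_distrib)
      qed
      ultimately show ?thesis by (simp add: mult_ac)
    qed
    finally show ?thesis
      using nn by (simp add: mult_right_mono)
  qed
  have flux: "(\<Sum>\<sigma>\<in>UNIV. edge_flux c (\<lambda>x y. \<Phi> (f x) (f y)) x i \<sigma>) = (\<Sum>e\<in>?I. w e * ?\<Phi> (z e)) - sum w ?I * \<Phi> a b"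
  proof -
    have "(\<Sum>\<sigma>\<in>UNIV. edge_flux c (\<lambda>x y. \<Phi> (f x) (f y)) x i \<sigma>) = (\<Sum>e\<in>?I. w e * (?\<Phi> (z e) - \<Phi> a b))"
      unfolding edge_flux_def y_def[symmetric] a_def[symmetric] b_def[symmetric] sumI[symmetric]
      by (simp add: w_def z_def split_def)
    then show ?thesis by (simp add: right_diff_distrib sum_subtractf sum_distrib_right)
  qed
  define S where "S = (\<Sum>e\<in>?I. w e * ?\<Phi> (z e))"
  define R where "R = sum w ?I"
  have "(\<Sum>e\<in>?I. h * w e * ?\<Phi> (z e)) = h * S"
    by (simp add: S_def sum_distrib_left mult.assoc)
  then have "\<Phi> (euler h f x) (euler h f y) \<le> (s - \<beta> * \<kappa> * h + 8 * K\<^sup>2 * h\<^sup>2) * \<Phi> a b + h * S"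
    using jensen stay by linarith
  also have "\<dots> = (1 - \<beta> * \<kappa> * h + 8 * K\<^sup>2 * h\<^sup>2) * \<Phi> a b + h * (S - R * \<Phi> a b)"
    by (simp add: s_def R_def[symmetric] algebra_simps)
  finally show ?thesis
    unfolding flux y_def[symmetric] a_def[symmetric] b_def[symmetric] S_def[symmetric] R_def[symmetric] .
qed

text \<open>Summed against the edge measure the flux terms vanish by stationarity, and only the
  contraction factor of a single edge survives.\<close>

lemma energy_euler:
  assumes \<Phi>: "edge_functional \<beta> \<Phi>" and \<beta>: "1 \<le> \<beta>" "\<beta> \<le> 2"
    and f: "\<And>x. f x > 0" and h: "h > 0" "h * K \<le> 1 / 4"
  shows "energy \<Phi> (euler h f) \<le> (1 - \<beta> * \<kappa> * h + 8 * K\<^sup>2 * h\<^sup>2) * energy \<Phi> f"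
proof -
  let ?q = "\<lambda>x i. m x * c x (Up i)" and ?r = "1 - \<beta> * \<kappa> * h + 8 * K\<^sup>2 * h\<^sup>2"
  let ?F = "\<lambda>x i. \<Sum>\<sigma>\<in>UNIV. edge_flux c (\<lambda>x y. \<Phi> (f x) (f y)) x i \<sigma>"
  have "?q x i * \<Phi> (euler h f x) (euler h f (x + axis i 1))
      \<le> ?r * (?q x i * \<Phi> (f x) (f (x + axis i 1))) + h * (?q x i * ?F x i)" if "x \<in> cube N" for x i
  proof (cases "x $ i < N")
    case True
    have "?q x i \<ge> 0" using weight_pos[of x] rate_nonneg[of x "Up i"] by simp
    from mult_left_mono[OF euler_edge[OF assms that True] this] show ?thesis
      by (simp add: algebra_simps)
  qed (simp add: up_zero)
  then have "energy \<Phi> (euler h f) \<le> (\<Sum>x\<in>cube N. \<Sum>i\<in>UNIV.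
      ?r * (?q x i * \<Phi> (f x) (f (x + axis i 1))) + h * (?q x i * ?F x i))"
    unfolding energy_def by (intro sum_mono)
  also have "\<dots> = ?r * energy \<Phi> f + h * (\<Sum>x\<in>cube N. \<Sum>i\<in>UNIV. ?q x i * ?F x i)"
    unfolding energy_def by (simp only: sum.distrib sum_distrib_left)
  also have "(\<Sum>x\<in>cube N. \<Sum>i\<in>UNIV. ?q x i * ?F x i) = 0"
    by (rule flux_balance) (use \<Phi> f in \<open>simp add: edge_functional_def\<close>)
  finally show ?thesis by simp
qed

lemma energy_nonneg:
  assumes "edge_functional \<beta> \<Phi>" "\<And>x. f x > 0"
  shows "energy \<Phi> f \<ge> 0"
  unfolding energy_def using assms weight_pos rate_nonneg
  by (intro sum_nonneg mult_nonneg_nonneg) (auto simp: edge_functional_def less_imp_le)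

text \<open>The tangent of \<phi> at the old value bounds the loss of entropy by its first order
  part, and summation by parts identifies that part as the energy. No second order term
  appears.\<close>

lemma entropy_euler:
  assumes \<phi>: "entropy_density \<phi>" and f: "\<And>x. f x > 0" and h: "h > 0" "h * K \<le> 1 / 4"
  shows "(\<Sum>x\<in>cube N. m x * \<phi> (f x)) - (\<Sum>x\<in>cube N. m x * \<phi> (euler h f x)) \<le> h * energy (bregman_symm \<phi>) f"
proof -
  have "m x * \<phi> (f x) - m x * \<phi> (euler h f x) \<le> - h * (m x * deriv \<phi> (f x) * gen f x)" if "x \<in> cube N" for x
  proof -
    have "\<phi> (f x) + deriv \<phi> (f x) * (euler h f x - f x) \<le> \<phi> (euler h f x)"
      using \<phi> f euler_pos[OF f h] by (simp add: entropy_density_def)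
    then have "\<phi> (f x) - \<phi> (euler h f x) \<le> - h * (deriv \<phi> (f x) * gen f x)"
      using that by (simp add: euler_def algebra_simps)
    from mult_left_mono[OF this, of "m x"] weight_pos[of x] show ?thesis
      by (simp add: algebra_simps)
  qed
  then have "(\<Sum>x\<in>cube N. m x * \<phi> (f x)) - (\<Sum>x\<in>cube N. m x * \<phi> (euler h f x))
      \<le> (\<Sum>x\<in>cube N. - h * (m x * deriv \<phi> (f x) * gen f x))"
    unfolding sum_subtractf[symmetric] by (rule sum_mono)
  also have "\<dots> = - h * (\<Sum>x\<in>cube N. m x * deriv \<phi> (f x) * gen f x)"
    by (simp only: sum_distrib_left)
  also have "\<dots> = h * energy (bregman_symm \<phi>) f"
    unfolding sum_by_parts[of "\<lambda>x. deriv \<phi> (f x)"] by (simp add: energy_def bregman_symm_def)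
  finally show ?thesis .
qed

lemma mean_euler: "(\<Sum>x\<in>cube N. m x * euler h f x) = (\<Sum>x\<in>cube N. m x * f x)"
proof -
  have "(\<Sum>x\<in>cube N. m x * euler h f x) = (\<Sum>x\<in>cube N. m x * f x) + h * (\<Sum>x\<in>cube N. m x * 1 * gen f x)"
    unfolding sum_distrib_left sum.distrib[symmetric] by (intro sum.cong) (auto simp: euler_def algebra_simps)
  then show ?thesis
    unfolding sum_by_parts[of "\<lambda>_. 1"] by simp
qed

section \<open>Iteration of the Euler step\<close>

definition iter :: "real \<Rightarrow> (nat ^ 'd \<Rightarrow> real) \<Rightarrow> nat \<Rightarrow> nat ^ 'd \<Rightarrow> real" where
  "iter h f n = (euler h ^^ n) f"

lemma iter_simps: "iter h f 0 = f" "iter h f (Suc n) = euler h (iter h f n)"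
  by (simp_all add: iter_def)

lemma iter_pos:
  assumes "\<And>x. f x > 0" "h > 0" "h * K \<le> 1 / 4"
  shows "iter h f n x > 0"
  using assms by (induction n arbitrary: x) (simp_all add: iter_simps euler_pos)

lemma mean_iter: "(\<Sum>x\<in>cube N. m x * iter h f n x) = (\<Sum>x\<in>cube N. m x * f x)"
  by (induction n) (simp_all add: iter_simps mean_euler)

text \<open>Each step removes at least the fraction (\<beta> \<kappa> - 8 K^2 h) h of the energy,
  and the losses telescope. This is the discrete version of integrating an exponentially decaying
  dissipation over time.\<close>

lemma sum_energy_iter:
  assumes \<Phi>: "edge_functional \<beta> \<Phi>" and \<beta>: "1 \<le> \<beta>" "\<beta> \<le> 2"
    and f: "\<And>x. f x > 0" and h: "h > 0" "h * K \<le> 1 / 4"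
  shows "(\<beta> * \<kappa> - 8 * K\<^sup>2 * h) * (h * (\<Sum>k<n. energy \<Phi> (iter h f k))) \<le> energy \<Phi> f"
proof -
  let ?E = "\<lambda>k. energy \<Phi> (iter h f k)"
  have "(\<beta> * \<kappa> - 8 * K\<^sup>2 * h) * h * ?E k \<le> ?E k - ?E (Suc k)" for k
    using energy_euler[where f = "iter h f k", OF \<Phi> \<beta> iter_pos[OF f h] h] by (simp add: iter_simps algebra_simps power2_eq_square)
  then have "(\<Sum>k<n. (\<beta> * \<kappa> - 8 * K\<^sup>2 * h) * h * ?E k) \<le> (\<Sum>k<n. ?E k - ?E (Suc k))"
    by (rule sum_mono)
  also have "\<dots> = ?E 0 - ?E n" by (rule sum_lessThan_telescope')
  also have "\<dots> \<le> energy \<Phi> f" using energy_nonneg[OF \<Phi> iter_pos[OF f h]] by (simp add: iter_simps)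
  finally show ?thesis by (simp add: sum_distrib_left mult.assoc)
qed

lemma entropy_iter:
  assumes \<phi>: "entropy_density \<phi>" and f: "\<And>x. f x > 0" and h: "h > 0" "h * K \<le> 1 / 4"
  shows "(\<Sum>x\<in>cube N. m x * \<phi> (f x)) - (\<Sum>x\<in>cube N. m x * \<phi> (iter h f n x))
     \<le> h * (\<Sum>k<n. energy (bregman_symm \<phi>) (iter h f k))"
proof (induction n)
  case (Suc n)
  then show ?case
    using entropy_euler[where f = "iter h f n", OF \<phi> iter_pos[OF f h] h] by (simp add: iter_simps distrib_left)
qed (simp add: iter_simps)

text \<open>The quadratic energies are summable, so increments along the edges of the cube tend to
  0; the edges connect every point of the cube to the origin, and the weighted mean is
  conserved.\<close>

lemma iter_tendsto:
  assumes f: "\<And>x. f x > 0" and h: "h > 0" "h * K \<le> 1 / 4" "8 * K\<^sup>2 * h < \<kappa>"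
  assumes x: "x \<in> cube N"
  shows "(\<lambda>n. iter h f n x) \<longlonglongrightarrow> (\<Sum>x\<in>cube N. m x * f x) / sum m (cube N)"
proof -
  let ?\<Phi> = "\<lambda>a b :: real. (b - a)\<^sup>2"
  let ?E = "\<lambda>k. energy ?\<Phi> (iter h f k)"
  let ?d = "(\<kappa> - 8 * K\<^sup>2 * h) * h"
  have E: "?E k \<ge> 0" for k by (rule energy_nonneg[OF edge_functional_square iter_pos[OF f h(1,2)]])
  have d: "?d > 0" using h by simp
  have "(\<Sum>k<n. ?E k) \<le> energy ?\<Phi> f / ?d" for n
    using sum_energy_iter[where n = n and f = f, OF edge_functional_square _ _ f h(1,2)] d by (simp add: field_simps)
  then have "summable ?E"
    by (intro summableI_nonneg_bounded[of _ "energy ?\<Phi> f / ?d"] E)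
  then have E0: "?E \<longlonglongrightarrow> 0" by (rule summable_LIMSEQ_zero)
  have edge: "(\<lambda>n. iter h f n (x + axis i 1) - iter h f n x) \<longlonglongrightarrow> 0" if x: "x \<in> cube N" "x $ i < N" for x i
  proof -
    define q where "q = m x * c x (Up i)"
    have q: "q > 0" using weight_pos up_pos[OF x(2)] by (simp add: q_def)
    have nn: "0 \<le> m z * c z (Up j) * t\<^sup>2" for z j t
      using weight_pos[of z] rate_nonneg[of z "Up j"] by simp
    have le: "(iter h f n (x + axis i 1) - iter h f n x)\<^sup>2 \<le> ?E n / q" for n
    proof -
      let ?t = "\<lambda>x i. m x * c x (Up i) * (iter h f n (x + axis i 1) - iter h f n x)\<^sup>2"
      have "?t x i \<le> (\<Sum>i\<in>UNIV. ?t x i)" by (rule member_le_sum) (auto intro: nn)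
      also have "\<dots> \<le> ?E n" unfolding energy_def
        by (rule member_le_sum[OF x(1)]) (auto intro: sum_nonneg nn finite_cube)
      finally show ?thesis using q by (simp add: q_def[symmetric] field_simps)
    qed
    have "(\<lambda>n. ?E n / q) \<longlonglongrightarrow> 0" using tendsto_divide[OF E0 tendsto_const, of q] q by simp
    then have "(\<lambda>n. (iter h f n (x + axis i 1) - iter h f n x)\<^sup>2) \<longlonglongrightarrow> 0"
      by (rule tendsto_sandwich[OF _ _ tendsto_const, rotated 2]) (simp_all add: le)
    then show ?thesis by simp
  qed
  have to_0: "(\<lambda>n. iter h f n x - iter h f n 0) \<longlonglongrightarrow> 0" if "x \<in> cube N" for x
    using that
  proof (induction x rule: nat_vec_induct)
    case (Suc x i)
    have x: "x \<in> cube N" "x $ i < N"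
    proof -
      show "x \<in> cube N"
        using Suc.prems unfolding cube_def by (auto intro: add_leD1)
      show "x $ i < N"
        using Suc.prems[unfolded cube_def, simplified, rule_format, of i] by simp
    qed
    then have "(\<lambda>n. (iter h f n (x + axis i 1) - iter h f n x) + (iter h f n x - iter h f n 0)) \<longlonglongrightarrow> 0 + 0"
      by (intro tendsto_add edge Suc.IH)
    then show ?case by simp
  qed simp
  have M: "sum m (cube N) > 0"
    using weight_pos zero_in_cube[of N] by (intro sum_pos) (auto simp: finite_cube)
  have "(\<lambda>n. iter h f n x - (\<Sum>z\<in>cube N. m z * iter h f n z) / sum m (cube N)) \<longlonglongrightarrow> 0"
  proof -
    have "iter h f n x - (\<Sum>z\<in>cube N. m z * iter h f n z) / sum m (cube N)
        = (iter h f n x - iter h f n 0) - (\<Sum>z\<in>cube N. m z * (iter h f n z - iter h f n 0)) / sum m (cube N)" for n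
    proof -
      have "(\<Sum>z\<in>cube N. m z * (iter h f n z - iter h f n 0))
          = (\<Sum>z\<in>cube N. m z * iter h f n z) - sum m (cube N) * iter h f n 0"
        by (simp only: right_diff_distrib sum_subtractf sum_distrib_right)
      then show ?thesis using M by (simp add: diff_divide_distrib)
    qed
    moreover have "(\<lambda>n. (iter h f n x - iter h f n 0) - (\<Sum>z\<in>cube N. m z * (iter h f n z - iter h f n 0)) / sum m (cube N))
        \<longlonglongrightarrow> 0 - (\<Sum>z\<in>cube N. m z * 0) / sum m (cube N)"
      using M by (intro tendsto_intros to_0 x) auto
    ultimately show ?thesis by (simp only: mult_zero_right sum.neutral_const div_0 diff_0_right)
  qed
  then show ?thesis
    unfolding mean_iter by (rule LIM_zero_cancel)
qed

text \<open>For fixed h, as n grows, the entropy lost along the iterates becomes the full relative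
  entropy, bounded by summed energies. Then h decreases to 0 and removes the discretization error
  from the constant.\<close>

lemma entropy_energy_bound:
  assumes \<phi>: "entropy_density \<phi>" and \<Phi>: "edge_functional \<beta> (bregman_symm \<phi>)" and \<beta>: "1 \<le> \<beta>" "\<beta> \<le> 2"
    and f: "\<And>x. f x > 0"
  shows "\<beta> * \<kappa> * ((\<Sum>x\<in>cube N. m x * \<phi> (f x))
      - sum m (cube N) * \<phi> ((\<Sum>x\<in>cube N. m x * f x) / sum m (cube N))) \<le> energy (bregman_symm \<phi>) f"
proof -
  define H where "H = (\<Sum>x\<in>cube N. m x * \<phi> (f x))
      - sum m (cube N) * \<phi> ((\<Sum>x\<in>cube N. m x * f x) / sum m (cube N))"
  have M: "sum m (cube N) > 0"
    using weight_pos zero_in_cube[of N] by (intro sum_pos) (auto simp: finite_cube)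
  have mean: "(\<Sum>x\<in>cube N. m x * f x) / sum m (cube N) > 0"
    using M f weight_pos zero_in_cube[of N] by (intro divide_pos_pos sum_pos) (auto simp: finite_cube)
  have bound: "(\<beta> * \<kappa> - 8 * K\<^sup>2 * h) * H \<le> energy (bregman_symm \<phi>) f"
    if h: "h > 0" "h * K \<le> 1 / 4" "8 * K\<^sup>2 * h < \<kappa>" for h
  proof (rule LIMSEQ_le_const2)
    have conv: "(\<lambda>n. \<phi> (iter h f n x)) \<longlonglongrightarrow> \<phi> ((\<Sum>x\<in>cube N. m x * f x) / sum m (cube N))" if "x \<in> cube N" for x
      using \<phi> mean by (intro isCont_tendsto_compose[OF _ iter_tendsto[OF f h that]]) (simp add: entropy_density_def)
    have "(\<lambda>n. \<Sum>x\<in>cube N. m x * \<phi> (iter h f n x))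
        \<longlonglongrightarrow> (\<Sum>x\<in>cube N. m x * \<phi> ((\<Sum>x\<in>cube N. m x * f x) / sum m (cube N)))"
      by (intro tendsto_sum tendsto_mult tendsto_const conv)
    then show "(\<lambda>n. (\<beta> * \<kappa> - 8 * K\<^sup>2 * h) * ((\<Sum>x\<in>cube N. m x * \<phi> (f x)) - (\<Sum>x\<in>cube N. m x * \<phi> (iter h f n x))))
       \<longlonglongrightarrow> (\<beta> * \<kappa> - 8 * K\<^sup>2 * h) * H"
      unfolding H_def sum_distrib_right by (rule tendsto_mult[OF tendsto_const tendsto_diff[OF tendsto_const]])
    have "\<kappa> \<le> \<beta> * \<kappa>" using \<beta> kappa_pos by simp
    then have d: "\<beta> * \<kappa> - 8 * K\<^sup>2 * h \<ge> 0" using h by simp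
    show "\<exists>n0. \<forall>n\<ge>n0. (\<beta> * \<kappa> - 8 * K\<^sup>2 * h) *
        ((\<Sum>x\<in>cube N. m x * \<phi> (f x)) - (\<Sum>x\<in>cube N. m x * \<phi> (iter h f n x))) \<le> energy (bregman_symm \<phi>) f"
      using order_trans[OF mult_left_mono[OF entropy_iter[where f = f, OF \<phi> f h(1,2)] d]
          sum_energy_iter[where f = f, OF \<Phi> \<beta> f h(1,2)]]
      by blast
  qed
  have "((\<lambda>h. (\<beta> * \<kappa> - 8 * K\<^sup>2 * h) * H) \<longlongrightarrow> (\<beta> * \<kappa> - 8 * K\<^sup>2 * 0) * H) (at_right 0)"
    by (intro tendsto_intros)
  moreover have "\<forall>\<^sub>F h in at_right 0. (\<beta> * \<kappa> - 8 * K\<^sup>2 * h) * H \<le> energy (bregman_symm \<phi>) f"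
  proof -
    have "((\<lambda>h. h * K) \<longlongrightarrow> 0 * K) (at_right 0)" "((\<lambda>h. 8 * K\<^sup>2 * h) \<longlongrightarrow> 8 * K\<^sup>2 * 0) (at_right 0)"
      by (intro tendsto_intros)+
    then have "\<forall>\<^sub>F h in at_right 0. h * K < 1 / 4" "\<forall>\<^sub>F h in at_right 0. 8 * K\<^sup>2 * h < \<kappa>"
      using kappa_pos order_tendstoD(2)[of "\<lambda>h. h * K" _ _ "1 / 4"] order_tendstoD(2)[of "\<lambda>h. 8 * K\<^sup>2 * h" _ _ \<kappa>]
      by auto
    moreover have "\<forall>\<^sub>F h in at_right 0. h > (0::real)"
      by (simp add: eventually_at_right_less)
    ultimately show ?thesis
      by eventually_elim (rule bound, auto)
  qed
  ultimately have "(\<beta> * \<kappa> - 8 * K\<^sup>2 * 0) * H \<le> energy (bregman_symm \<phi>) f"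
    by (rule tendsto_upperbound) simp
  then show ?thesis by (simp add: H_def)
qed

end


section \<open>Short time behaviour\<close>

lemma measurable_trans_upto [measurable]: "(\<lambda>t. trans_upto c n t x y) \<in> borel_measurable borel"
proof (induction n arbitrary: x)
  case (Suc n)
  have [measurable]: "(\<lambda>t. trans_upto c n t x y) \<in> borel_measurable borel" for x
    by (rule Suc)
  \<comment> \<open>The domain of integration depends on t; as a condition on the pair (s, t) it is
    jointly measurable.\<close>
  have ind: "(indicator {0..t} s :: ennreal) = (if 0 \<le> s \<and> s \<le> t then 1 else 0)" for s t :: real
    by (simp add: indicator_def)
  show ?case
    unfolding trans_upto.simps ind by measurable
qed simp

lemma ennreal_sum_rates:
  assumes "\<And>x \<sigma>. c x \<sigma> \<ge> 0"
  shows "(\<Sum>\<sigma>\<in>UNIV. ennreal (c x \<sigma>)) = ennreal (total_rate c x)"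
  using assms by (simp add: total_rate_def)

text \<open>Conditioning on the first jump, the induction hypothesis leaves exp (- q t) plus the
  integral of q exp (- q s) over [0, t], with q the total rate; together they are 1.\<close>

lemma trans_upto_mass_le:
  assumes c: "\<And>x \<sigma>. c x \<sigma> \<ge> 0" and "t \<ge> 0"
  shows "(\<integral>\<^sup>+y. trans_upto c n t x y \<partial>count_space UNIV) \<le> 1"
  using \<open>t \<ge> 0\<close>
proof (induction n arbitrary: t x)
  case 0
  have "total_rate c x \<ge> 0" using c by (simp add: total_rate_def sum_nonneg)
  then show ?case using 0 by (simp add: nn_integral_cmult mult_nonneg_nonneg)
next
  case (Suc n)
  let ?q = "total_rate c x"
  have q: "?q \<ge> 0" using c by (simp add: total_rate_def sum_nonneg)
  have "(\<integral>\<^sup>+y. (\<integral>\<^sup>+ s \<in> {0..t}. ennreal (exp (- ?q * s)) *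
        (\<Sum>\<sigma>\<in>UNIV. ennreal (c x \<sigma>) * trans_upto c n (t - s) (act \<sigma> x) y) \<partial>lborel) \<partial>count_space UNIV)
    = (\<integral>\<^sup>+ s. (\<integral>\<^sup>+y. ennreal (exp (- ?q * s)) *
        (\<Sum>\<sigma>\<in>UNIV. ennreal (c x \<sigma>) * trans_upto c n (t - s) (act \<sigma> x) y) * indicator {0..t} s \<partial>count_space UNIV) \<partial>lborel)"
    by (rule nn_integral_count_space_nn_integral[symmetric]) auto
  also have "\<dots> \<le> (\<integral>\<^sup>+ s. ennreal (?q * exp (- ?q * s)) * indicator {0..t} s \<partial>lborel)"
  proof (rule nn_integral_mono)
    fix s :: real
    show "(\<integral>\<^sup>+y. ennreal (exp (- ?q * s)) *
        (\<Sum>\<sigma>\<in>UNIV. ennreal (c x \<sigma>) * trans_upto c n (t - s) (act \<sigma> x) y) * indicator {0..t} s \<partial>count_space UNIV)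
      \<le> ennreal (?q * exp (- ?q * s)) * indicator {0..t} s"
    proof (cases "s \<in> {0..t}")
      case True
      have "(\<integral>\<^sup>+y. ennreal (exp (- ?q * s)) *
          (\<Sum>\<sigma>\<in>UNIV. ennreal (c x \<sigma>) * trans_upto c n (t - s) (act \<sigma> x) y) \<partial>count_space UNIV)
        = ennreal (exp (- ?q * s)) * (\<Sum>\<sigma>\<in>UNIV. ennreal (c x \<sigma>) * (\<integral>\<^sup>+y. trans_upto c n (t - s) (act \<sigma> x) y \<partial>count_space UNIV))"
        by (simp add: nn_integral_cmult nn_integral_sum)
      also have "\<dots> \<le> ennreal (exp (- ?q * s)) * (\<Sum>\<sigma>\<in>UNIV. ennreal (c x \<sigma>) * 1)"
        using True by (intro mult_left_mono sum_mono Suc.IH) auto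
      also have "\<dots> = ennreal (?q * exp (- ?q * s))"
        using q by (simp add: ennreal_sum_rates[of c x, OF c] ennreal_mult mult.commute)
      finally show ?thesis using True by simp
    qed simp
  qed
  also have "\<dots> = ennreal (- exp (- ?q * t) - - exp (- ?q * 0))"
    by (rule nn_integral_FTC_Icc) (use q Suc.prems in \<open>auto intro!: derivative_eq_intros\<close>)
  finally have "(\<integral>\<^sup>+y. trans_upto c (Suc n) t x y \<partial>count_space UNIV)
     \<le> ennreal (exp (- ?q * t)) + ennreal (1 - exp (- ?q * t))"
    by (simp add: nn_integral_add nn_integral_cmult add_left_mono)
  also have "\<dots> = 1"
    using q Suc.prems by (subst ennreal_plus[symmetric]) (auto simp: mult_nonneg_nonneg)
  finally show ?case .
qed

lemma trans_upto_mono: "trans_upto c n t x y \<le> trans_upto c (Suc n) t x y"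
proof (induction n arbitrary: t x)
  case (Suc n)
  show ?case
    unfolding trans_upto.simps(2)[of c "Suc n"] trans_upto.simps(2)[of c n]
    by (intro add_left_mono nn_integral_mono mult_right_mono mult_left_mono sum_mono Suc[unfolded trans_upto.simps(2)]) auto
qed simp

lemma emeasure_law_at_return:
  "emeasure (law_at c (return_pmf x) t) A = (\<integral>\<^sup>+y\<in>A. trans_prob c t x y \<partial>count_space UNIV)"
  by (simp add: law_at_def emeasure_density)

lemma law_at_mass_le:
  assumes "\<And>x \<sigma>. c x \<sigma> \<ge> 0" "t \<ge> 0"
  shows "emeasure (law_at c (return_pmf x) t) A \<le> 1"
proof -
  have "emeasure (law_at c (return_pmf x) t) A \<le> (\<integral>\<^sup>+y. trans_prob c t x y \<partial>count_space UNIV)"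
    unfolding emeasure_law_at_return by (intro nn_integral_mono) (simp add: indicator_def)
  also have "\<dots> = (SUP n. \<integral>\<^sup>+y. trans_upto c n t x y \<partial>count_space UNIV)"
    unfolding trans_prob_def
    by (rule nn_integral_monotone_convergence_SUP) (auto intro!: incseq_SucI le_funI trans_upto_mono)
  also have "\<dots> \<le> 1"
    by (intro SUP_least trans_upto_mass_le assms)
  finally show ?thesis .
qed

definition jump_rate :: "'d::finite rates \<Rightarrow> nat ^ 'd \<Rightarrow> (nat ^ 'd) set \<Rightarrow> real" where
  "jump_rate c x W = (\<Sum>\<sigma>\<in>UNIV. c x \<sigma> * of_bool (act \<sigma> x \<in> W))"

definition two_step_rate :: "'d::finite rates \<Rightarrow> nat ^ 'd \<Rightarrow> real" where
  "two_step_rate c x = total_rate c x + (\<Sum>\<sigma>\<in>UNIV. total_rate c (act \<sigma> x))"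

text \<open>Only paths with exactly one jump are kept. Whatever the jump time and the move, the
  exponents of the two waiting times add up to at most \<open>two_step_rate c x * t\<close>.\<close>

lemma trans_prob_one_jump:
  assumes c: "\<And>x \<sigma>. c x \<sigma> \<ge> 0" and t: "t \<ge> 0"
  shows "trans_prob c t x y \<ge> ennreal (t * (1 - two_step_rate c x * t) * jump_rate c x {y})"
proof -
  let ?Q = "two_step_rate c x"
  have q: "total_rate c x \<ge> 0" for x using c by (simp add: total_rate_def sum_nonneg)
  have J: "jump_rate c x {y} \<ge> 0" using c by (simp add: jump_rate_def sum_nonneg)
  have "ennreal (t * (1 - ?Q * t) * jump_rate c x {y}) \<le> ennreal (exp (- (?Q * t)) * jump_rate c x {y} * t)"
    using t J mult_right_mono[OF exp_ge_add_one_self[of "- (?Q * t)"], of "jump_rate c x {y} * t"]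
    by (intro ennreal_leI) (simp add: mult_ac)
  also have "\<dots> = (\<integral>\<^sup>+s\<in>{0..t}. ennreal (exp (- (?Q * t)) * jump_rate c x {y}) \<partial>lborel)"
    using t J by (simp add: nn_integral_cmult_indicator ennreal_mult)
  also have "\<dots> \<le> (\<integral>\<^sup>+ s \<in> {0..t}. ennreal (exp (- total_rate c x * s)) *
        (\<Sum>\<sigma>\<in>UNIV. ennreal (c x \<sigma>) * trans_upto c 0 (t - s) (act \<sigma> x) y) \<partial>lborel)"
  proof (rule nn_integral_mono)
    fix s :: real
    have "ennreal (exp (- (?Q * t)) * jump_rate c x {y}) \<le> ennreal (exp (- total_rate c x * s)) *
        (\<Sum>\<sigma>\<in>UNIV. ennreal (c x \<sigma>) * trans_upto c 0 (t - s) (act \<sigma> x) y)" if s: "0 \<le> s" "s \<le> t"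
    proof -
      have le: "exp (- (?Q * t)) \<le> exp (- total_rate c x * s) * exp (- total_rate c (act \<sigma> x) * (t - s))" for \<sigma>
      proof -
        have "total_rate c (act \<sigma> x) \<le> (\<Sum>\<sigma>\<in>UNIV. total_rate c (act \<sigma> x))"
          by (rule member_le_sum) (use q in auto)
        then have "total_rate c x * s + total_rate c (act \<sigma> x) * (t - s) \<le> ?Q * t"
          unfolding two_step_rate_def distrib_right using s q by (intro add_mono mult_mono) (auto intro: sum_nonneg)
        then show ?thesis by (simp add: exp_add[symmetric])
      qed
      have "exp (- (?Q * t)) * jump_rate c x {y} \<le> exp (- total_rate c x * s) *
          (\<Sum>\<sigma>\<in>UNIV. c x \<sigma> * (exp (- total_rate c (act \<sigma> x) * (t - s)) * indicator {act \<sigma> x} y))"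
        unfolding jump_rate_def sum_distrib_left
      proof (rule sum_mono)
        fix \<sigma>
        show "exp (- (?Q * t)) * (c x \<sigma> * of_bool (act \<sigma> x \<in> {y}))
          \<le> exp (- total_rate c x * s) * (c x \<sigma> * (exp (- total_rate c (act \<sigma> x) * (t - s)) * indicator {act \<sigma> x} y))"
          using mult_left_mono[OF le c[of x \<sigma>], of \<sigma>] by (auto simp: indicator_def mult_ac)
      qed
      then have "ennreal (exp (- (?Q * t)) * jump_rate c x {y}) \<le> ennreal (exp (- total_rate c x * s) *
          (\<Sum>\<sigma>\<in>UNIV. c x \<sigma> * (exp (- total_rate c (act \<sigma> x) * (t - s)) * indicator {act \<sigma> x} y)))"
        by (rule ennreal_leI)
      also have "\<dots> = ennreal (exp (- total_rate c x * s)) *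
        (\<Sum>\<sigma>\<in>UNIV. ennreal (c x \<sigma>) * trans_upto c 0 (t - s) (act \<sigma> x) y)"
        using c by (simp add: ennreal_mult sum_nonneg ennreal_indicator flip: sum_ennreal)
      finally show ?thesis .
    qed
    then show "ennreal (exp (- (?Q * t)) * jump_rate c x {y}) * indicator {0..t} s \<le>
        ennreal (exp (- total_rate c x * s)) *
        (\<Sum>\<sigma>\<in>UNIV. ennreal (c x \<sigma>) * trans_upto c 0 (t - s) (act \<sigma> x) y) * indicator {0..t} s"
      by (cases "s \<in> {0..t}") auto
  qed
  also have "\<dots> \<le> trans_upto c (Suc 0) t x y"
    by simp
  also have "\<dots> \<le> trans_prob c t x y"
    unfolding trans_prob_def by (rule SUP_upper) simp
  finally show ?thesis .
qed

lemma trans_prob_stay: "trans_prob c t x x \<ge> ennreal (1 - total_rate c x * t)"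
proof -
  have "ennreal (1 - total_rate c x * t) \<le> ennreal (exp (- total_rate c x * t))"
    using exp_ge_add_one_self[of "- total_rate c x * t"] by (intro ennreal_leI) simp
  also have "\<dots> = trans_upto c 0 t x x" by simp
  also have "\<dots> \<le> trans_prob c t x x" unfolding trans_prob_def by (rule SUP_upper) simp
  finally show ?thesis .
qed

definition jump_error :: "'d::finite rates \<Rightarrow> nat ^ 'd \<Rightarrow> real" where
  "jump_error c x = two_step_rate c x * total_rate c x"

lemma jump_rate_le:
  assumes "\<And>x \<sigma>. c x \<sigma> \<ge> 0"
  shows "0 \<le> jump_rate c x W" "jump_rate c x W \<le> total_rate c x" "0 \<le> jump_error c x" "0 \<le> two_step_rate c x"
proof -
  show "jump_rate c x W \<le> total_rate c x"
    unfolding jump_rate_def total_rate_def by (rule sum_mono) (use assms in auto)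
qed (use assms in \<open>auto simp: jump_rate_def total_rate_def jump_error_def two_step_rate_def
    intro!: sum_nonneg mult_nonneg_nonneg add_nonneg_nonneg\<close>)

lemma law_at_ge:
  assumes c: "\<And>x \<sigma>. c x \<sigma> \<ge> 0" and t: "t \<ge> 0"
  shows "measure (law_at c (return_pmf x) t) W \<ge> t * jump_rate c x W - jump_error c x * t\<^sup>2"
proof -
  let ?M = "law_at c (return_pmf x) t"
  \<comment> \<open>One jump reaches finitely many points, so the bounds for single points can be
    added.\<close>
  define S where "S = W \<inter> range (\<lambda>\<sigma>. act \<sigma> x)"
  have S: "finite S" by (simp add: S_def)
  have fin: "emeasure ?M A \<noteq> \<infinity>" for A
    using law_at_mass_le[where c = c and x = x and A = A, OF c t] by (auto simp: top_unique)
  have one: "measure ?M {y} \<ge> t * (1 - two_step_rate c x * t) * jump_rate c x {y}" for y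
  proof -
    have "emeasure ?M {y} = trans_prob c t x y"
      unfolding emeasure_law_at_return by (simp add: nn_integral_indicator_singleton mult.commute)
    moreover have "emeasure ?M {y} = ennreal (measure ?M {y})"
      using fin[of "{y}"] by (simp add: emeasure_eq_ennreal_measure)
    ultimately have "ennreal (t * (1 - two_step_rate c x * t) * jump_rate c x {y}) \<le> ennreal (measure ?M {y})"
      using trans_prob_one_jump[where c = c and x = x and y = y, OF c t] by simp
    then show ?thesis by (simp add: ennreal_le_iff)
  qed
  have "t * (1 - two_step_rate c x * t) * jump_rate c x W = (\<Sum>y\<in>S. t * (1 - two_step_rate c x * t) * jump_rate c x {y})"
  proof -
    have "(\<Sum>y\<in>S. jump_rate c x {y}) = (\<Sum>\<sigma>\<in>UNIV. \<Sum>y\<in>S. c x \<sigma> * of_bool (act \<sigma> x = y))"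
      unfolding jump_rate_def by (subst sum.swap) simp
    also have "\<dots> = jump_rate c x W"
      unfolding jump_rate_def sum_distrib_left[symmetric]
      by (intro sum.cong arg_cong2[of _ _ _ _ "(*)"] refl) (simp add: S of_bool_def S_def sum.delta)
    finally show ?thesis by (simp only: sum_distrib_left[symmetric])
  qed
  also have "\<dots> \<le> (\<Sum>y\<in>S. measure ?M {y})" by (rule sum_mono) (rule one)
  also have "\<dots> = measure ?M S"
    by (rule measure_eq_sum_singleton[symmetric]) (use S fin in \<open>auto simp: law_at_def\<close>)
  also have "\<dots> \<le> measure ?M W"
    using fin[of W] by (intro measure_mono_fmeasurable) (auto simp: S_def law_at_def fmeasurable_def less_top)
  finally have "t * jump_rate c x W - two_step_rate c x * jump_rate c x W * t\<^sup>2 \<le> measure ?M W"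
    by (simp add: algebra_simps power2_eq_square)
  moreover have "two_step_rate c x * jump_rate c x W * t\<^sup>2 \<le> jump_error c x * t\<^sup>2"
    unfolding jump_error_def using jump_rate_le(1,2)[where c = c and x = x and W = W, OF c] jump_rate_le(4)[where c = c and x = x, OF c] by (intro mult_right_mono mult_left_mono) auto
  ultimately show ?thesis by linarith
qed

lemma law_at_stay_ge:
  assumes c: "\<And>x \<sigma>. c x \<sigma> \<ge> 0" and t: "t \<ge> 0"
  shows "measure (law_at c (return_pmf x) t) {x} \<ge> 1 - total_rate c x * t"
proof -
  let ?M = "law_at c (return_pmf x) t"
  have "emeasure ?M {x} = trans_prob c t x x"
    unfolding emeasure_law_at_return by (simp add: nn_integral_indicator_singleton mult.commute)
  moreover have "emeasure ?M {x} = ennreal (measure ?M {x})"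
    using law_at_mass_le[where c = c and x = x and A = "{x}", OF c t]
    by (intro emeasure_eq_ennreal_measure) (auto simp: top_unique)
  ultimately have "ennreal (1 - total_rate c x * t) \<le> ennreal (measure ?M {x})"
    using trans_prob_stay[of c x t] by simp
  then show ?thesis by (simp add: ennreal_le_iff)
qed

lemma jump_rate_Compl:
  assumes stay: "\<And>\<sigma>. act \<sigma> x = x \<Longrightarrow> c x \<sigma> = 0" and "x \<notin> W"
  shows "jump_rate c x W + jump_rate c x (- W - {x}) = total_rate c x"
proof -
  have "c x \<sigma> * of_bool (act \<sigma> x \<in> W) + c x \<sigma> * of_bool (act \<sigma> x \<in> - W - {x}) = c x \<sigma>" for \<sigma>
    using assms(2) stay[of \<sigma>] by auto
  then show ?thesis
    unfolding jump_rate_def total_rate_def sum.distrib[symmetric] by simp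
qed

text \<open>The upper bound comes from the lower bounds on the complement, since the total mass is
  at most 1. The moves at x are all effective, so the jump rates into \<open>W\<close> and into the
  rest add up to the total rate, and the first order terms match.\<close>

lemma law_at_small_time:
  assumes c: "\<And>x \<sigma>. c x \<sigma> \<ge> 0" and t: "t \<ge> 0"
    and stay: "\<And>\<sigma>. act \<sigma> x = x \<Longrightarrow> c x \<sigma> = 0"
  shows "measure (law_at c (return_pmf x) t) UNIV \<ge> 1 - jump_error c x * t\<^sup>2"
    and "x \<notin> W \<Longrightarrow> measure (law_at c (return_pmf x) t) W \<le> t * jump_rate c x W + jump_error c x * t\<^sup>2"
proof -
  let ?M = "law_at c (return_pmf x) t"
  have le1: "emeasure ?M A \<le> 1" for A
    by (rule law_at_mass_le[where c = c, OF c t])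
  interpret finite_measure ?M
    by (rule finite_measureI) (use le1[of "space ?M"] in \<open>auto simp: top_unique\<close>)
  have sets: "sets ?M = UNIV" by (simp add: law_at_def)
  have split: "measure ?M (insert x W) = measure ?M {x} + measure ?M W" if "x \<notin> W" for W
    using finite_measure_Union[of "{x}" W] that by (simp add: sets)
  have low: "measure ?M (insert x W) \<ge> 1 - total_rate c x * t + t * jump_rate c x W - jump_error c x * t\<^sup>2"
    if "x \<notin> W" for W
    using split[OF that] law_at_stay_ge[where c = c and x = x, OF c t] law_at_ge[where c = c and x = x and W = W, OF c t] by linarith
  have eq: "t * jump_rate c x W + t * jump_rate c x (- W - {x}) = total_rate c x * t" if "x \<notin> W" for W
    using jump_rate_Compl[where c = c and W = W, OF stay that] by (metis distrib_left mult.commute)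
  show "measure ?M UNIV \<ge> 1 - jump_error c x * t\<^sup>2"
  proof -
    have "measure ?M (insert x (- {} - {x})) = measure ?M UNIV"
      by (rule arg_cong[of _ _ "measure ?M"]) auto
    moreover have "t * jump_rate c x {} = 0" by (simp add: jump_rate_def)
    moreover have "t * jump_rate c x {} + t * jump_rate c x (- {} - {x}) = total_rate c x * t"
      by (rule eq) simp
    moreover have "measure ?M (insert x (- {} - {x}))
        \<ge> 1 - total_rate c x * t + t * jump_rate c x (- {} - {x}) - jump_error c x * t\<^sup>2"
      by (rule low) simp
    ultimately show ?thesis by linarith
  qed
  assume W: "x \<notin> W"
  have "measure ?M W + measure ?M (insert x (- W - {x})) = measure ?M UNIV"
    using finite_measure_Union[of W "insert x (- W - {x})"] W by (simp add: sets)
  moreover have "measure ?M UNIV \<le> 1"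
    using le1[of UNIV] by (simp add: measure_def enn2real_leI)
  ultimately show "measure ?M W \<le> t * jump_rate c x W + jump_error c x * t\<^sup>2"
    using low[of "- W - {x}"] eq[OF W] by simp
qed

section \<open>Couplings obtained from large exponents\<close>

lemma dist1_nat: "\<exists>n. dist1 x y = real n"
proof -
  have "dist1 x y = real_of_int (\<Sum>i\<in>UNIV. \<bar>int (x $ i) - int (y $ i)\<bar>)"
    by (simp add: dist1_def)
  moreover obtain n where "(\<Sum>i\<in>UNIV. \<bar>int (x $ i) - int (y $ i)\<bar>) = int n"
    by (rule nonneg_int_cases[OF sum_nonneg[of UNIV "\<lambda>i. \<bar>int (x $ i) - int (y $ i)\<bar>"]]) auto
  ultimately show ?thesis by (intro exI[of _ n]) simp
qed

lemma dist1_eq_0_iff: "dist1 x y = 0 \<longleftrightarrow> x = y"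
  by (auto simp: dist1_def sum_nonneg_eq_0_iff vec_eq_iff)

lemma dist1_ge: assumes "x \<noteq> y" shows "dist1 x y \<ge> 1"
proof -
  obtain n where n: "dist1 x y = real n" using dist1_nat by blast
  then have "n \<noteq> 0" using assms dist1_eq_0_iff[of x y] by auto
  then show ?thesis using n by simp
qed

lemma dist1_gt_1: assumes "dist1 x y > 1" shows "dist1 x y \<ge> 2"
proof -
  obtain n where "dist1 x y = real n" using dist1_nat by blast
  then show ?thesis using assms by simp
qed

lemma root_ennreal_leD:
  assumes "root_ennreal p x \<le> ennreal (a powr (1 / p))" "p \<ge> 1" "a > 0"
  shows "x \<le> ennreal a"
proof -
  have fin: "x \<noteq> \<infinity>" using assms(1) by (auto simp: root_ennreal_def top_unique)
  then have "enn2real x powr (1 / p) \<le> a powr (1 / p)"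
    using assms by (simp add: root_ennreal_def)
  then have "enn2real x \<le> a"
    using assms powr_less_mono2[of "1 / p" a "enn2real x"] by (simp add: not_less[symmetric]) argo
  then show ?thesis
    using fin by (metis ennreal_enn2real ennreal_leI infinity_ennreal_def less_top)
qed

lemma root_ennreal_le_1:
  assumes "x \<le> 1" "p \<ge> 1"
  shows "root_ennreal p x \<le> 1"
proof -
  have "x \<noteq> \<infinity>" "enn2real x \<le> 1"
    using assms by (auto simp: top_unique enn2real_leI)
  moreover from this have "enn2real x powr (1 / p) \<le> 1"
    using assms by (intro powr_le1) auto
  ultimately show ?thesis
    unfolding root_ennreal_def by (simp flip: ennreal_1 add: ennreal_leI)
qed

text \<open>The exponent \<open>p\<close> is so large that \<open>2 powr p * t\<^sup>2 \<ge> 2\<close>; Markov's inequality for \<open>dist1 powr p\<close> then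
  gives both bounds.\<close>

lemma almost_adjacent_coupling:
  fixes c :: "'d::finite rates"
  assumes W: "\<And>p. p \<ge> 1 \<Longrightarrow> wasserstein p (law_at c (return_pmf x) t) (law_at c (return_pmf y) t)
      \<le> ennreal (exp (- (\<kappa> / p) * t)) * wasserstein p (measure_pmf (return_pmf x)) (measure_pmf (return_pmf y))"
    and xy: "dist1 x y = 1" and t: "t > 0" "\<kappa> > 0"
  obtains \<pi> where "\<pi> \<in> couplings (law_at c (return_pmf x) t) (law_at c (return_pmf y) t)"
    "emeasure \<pi> {(a, b). dist1 a b > 1} \<le> ennreal (t\<^sup>2)"
    "emeasure \<pi> {(a, b). a \<noteq> b} \<le> ennreal (exp (- \<kappa> * t) + t\<^sup>2)"
proof -
  \<comment> \<open>The infimum over couplings need not be attained, so the cost is allowed to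
    exceed it by \<epsilon>. The cap at 1 keeps the cost below 2.\<close>
  define \<epsilon> where "\<epsilon> = min 1 (t\<^sup>2)"
  have \<epsilon>: "0 < \<epsilon>" "\<epsilon> \<le> 1" "\<epsilon> \<le> t\<^sup>2" using t by (auto simp: \<epsilon>_def)
  define p where "p = max 1 (log 2 (2 / t\<^sup>2))"
  have p: "p \<ge> 1" by (simp add: p_def)
  have "2 / t\<^sup>2 = 2 powr (log 2 (2 / t\<^sup>2))" using t by simp
  also have "\<dots> \<le> 2 powr p" by (rule powr_mono) (auto simp: p_def)
  finally have p2: "2 \<le> t\<^sup>2 * 2 powr p" using t by (simp add: field_simps)
  let ?M = "law_at c (return_pmf x) t" and ?N = "law_at c (return_pmf y) t"
  let ?cost = "\<lambda>\<pi>. \<integral>\<^sup>+ (\<eta>, \<xi>). ennreal (dist1 \<eta> \<xi> powr p) \<partial>\<pi>"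
  have start: "wasserstein p (measure_pmf (return_pmf x)) (measure_pmf (return_pmf y)) \<le> 1"
  proof -
    have mem: "measure_pmf (return_pmf (x, y)) \<in> couplings (measure_pmf (return_pmf x)) (measure_pmf (return_pmf y))"
      unfolding couplings_def
      by (auto simp flip: map_pmf_rep_eq)
    have "(INF \<pi>\<in>couplings (measure_pmf (return_pmf x)) (measure_pmf (return_pmf y)). ?cost \<pi>) \<le> 1"
      by (rule INF_lower2[OF mem]) (simp add: xy)
    then show ?thesis
      unfolding wasserstein_def using p by (rule root_ennreal_le_1)
  qed
  have "wasserstein p ?M ?N \<le> ennreal (exp (- (\<kappa> / p) * t)) * 1"
    by (rule order_trans[OF W[OF p]]) (rule mult_left_mono[OF start], simp)
  also have "exp (- (\<kappa> / p) * t) = exp (- \<kappa> * t) powr (1 / p)"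
    by (simp add: powr_def)
  \<comment> \<open>From starting distance one, the p-th power of the contraction factor is
    \<open>exp (- \<kappa> * t)\<close> for every p; hence p is free to depend on t.\<close>
  finally have contr: "wasserstein p ?M ?N \<le> ennreal (exp (- \<kappa> * t) powr (1 / p))"
    by (simp only: mult_1_right)
  have "(INF \<pi>\<in>couplings ?M ?N. ?cost \<pi>) \<le> ennreal (exp (- \<kappa> * t))"
    by (rule root_ennreal_leD[OF contr[unfolded wasserstein_def] p]) simp
  also have "\<dots> < ennreal (exp (- \<kappa> * t) + \<epsilon>)"
    using \<epsilon> by (intro ennreal_lessI) (auto intro: add_pos_pos)
  finally obtain \<pi> where \<pi>: "\<pi> \<in> couplings ?M ?N" and cost: "?cost \<pi> < ennreal (exp (- \<kappa> * t) + \<epsilon>)"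
    unfolding INF_less_iff by blast
  have sets: "sets \<pi> = UNIV" using \<pi> by (simp add: couplings_def)
  then have [measurable]: "A \<in> sets \<pi>" for A by simp
  have bound: "ennreal r * emeasure \<pi> A \<le> ennreal (exp (- \<kappa> * t) + \<epsilon>)"
    if "r \<ge> 0" "\<And>a b. (a, b) \<in> A \<Longrightarrow> r \<le> dist1 a b powr p" for r A
  proof -
    have "ennreal r * emeasure \<pi> A = (\<integral>\<^sup>+z. ennreal r * indicator A z \<partial>\<pi>)"
      by (simp add: nn_integral_cmult_indicator)
    also have "\<dots> \<le> ?cost \<pi>"
      using that by (intro nn_integral_mono) (auto simp: indicator_def intro: ennreal_leI split: prod.splits)
    finally show ?thesis using cost by simp
  qed
  show ?thesis
  proof (rule that[OF \<pi>])
    have "ennreal 1 * emeasure \<pi> {(a, b). a \<noteq> b} \<le> ennreal (exp (- \<kappa> * t) + \<epsilon>)"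
      by (rule bound) (use dist1_ge p in \<open>auto intro!: ge_one_powr_ge_zero\<close>)
    also have "\<dots> \<le> ennreal (exp (- \<kappa> * t) + t\<^sup>2)"
      using \<epsilon> by (intro ennreal_leI) simp
    finally show "emeasure \<pi> {(a, b). a \<noteq> b} \<le> ennreal (exp (- \<kappa> * t) + t\<^sup>2)" by simp
    have "ennreal (2 powr p) * emeasure \<pi> {(a, b). dist1 a b > 1} \<le> ennreal (exp (- \<kappa> * t) + \<epsilon>)"
      by (rule bound) (use dist1_gt_1 p in \<open>auto intro!: powr_mono2\<close>)
    also have "\<dots> \<le> ennreal (2 powr p * t\<^sup>2)"
    proof (rule ennreal_leI)
      have "exp (- \<kappa> * t) \<le> 1" using t by simp
      then show "exp (- \<kappa> * t) + \<epsilon> \<le> 2 powr p * t\<^sup>2" using p2 \<epsilon> unfolding mult.commute[of "2 powr p"] by linarith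
    qed
    also have "\<dots> = ennreal (2 powr p) * ennreal (t\<^sup>2)" by (simp add: ennreal_mult)
    finally show "emeasure \<pi> {(a, b). dist1 a b > 1} \<le> ennreal (t\<^sup>2)"
      by (subst (asm) ennreal_mult_le_mult_iff) auto
  qed
qed

lemma le_of_small_quadratic:
  fixes l r C :: real
  assumes "\<And>t. 0 < t \<Longrightarrow> t * l \<le> t * r + C * t\<^sup>2"
  shows "l \<le> r"
proof (rule tendsto_upperbound)
  show "((\<lambda>t. l - C * t) \<longlongrightarrow> l) (at_right 0)"
    by (auto intro!: tendsto_eq_intros)
  have "l - C * t \<le> r" if "0 < t" for t
  proof -
    have "t * (l - C * t) \<le> t * r"
      using assms[OF that] by (simp add: algebra_simps power2_eq_square)
    then show ?thesis using that by simp
  qed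
  then show "\<forall>\<^sub>F t in at_right 0. l - C * t \<le> r"
    by (auto simp: eventually_at_right_less eventually_at_filter)
qed simp

lemma exp_minus_le_quadratic:
  fixes s :: real
  assumes "s \<ge> 0"
  shows "exp (- s) \<le> 1 - s + s\<^sup>2"
proof -
  have "exp (- s) = 1 / exp s" by (simp add: exp_minus field_simps)
  also have "\<dots> \<le> 1 / (1 + s)"
    using assms exp_ge_add_one_self[of s] by (intro divide_left_mono) auto
  also have "\<dots> \<le> 1 - s + s\<^sup>2"
  proof -
    have "1 \<le> (1 - s + s\<^sup>2) * (1 + s)"
      using assms by (simp add: algebra_simps power2_eq_square power3_eq_cube)
    then show ?thesis using assms by (simp add: divide_le_eq)
  qed
  finally show ?thesis .
qed

text \<open>The dual form of a coupling of the jumps: testing with events avoids passing to a limit of the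
  couplings as \<open>t\<close> tends to 0.\<close>

lemma rate_comparison:
  fixes c :: "'d::finite rates"
  assumes c: "\<And>x \<sigma>. c x \<sigma> \<ge> 0"
    and stay: "\<And>x \<sigma>. act \<sigma> x = x \<Longrightarrow> c x \<sigma> = 0"
    and W: "\<And>p t. p \<ge> 1 \<Longrightarrow> t > 0 \<Longrightarrow> wasserstein p (law_at c (return_pmf x) t) (law_at c (return_pmf y) t)
      \<le> ennreal (exp (- (\<kappa> / p) * t)) * wasserstein p (measure_pmf (return_pmf x)) (measure_pmf (return_pmf y))"
    and \<kappa>: "\<kappa> > 0" and xy: "dist1 x y = 1"
    and k: "0 \<le> k" "k \<le> (1 :: real)"
    and sets: "y \<notin> U" "x \<notin> V" "x \<notin> U'" "y \<notin> V'"
    and le: "\<And>a b. dist1 x a \<le> 1 \<Longrightarrow> dist1 y b \<le> 1 \<Longrightarrow> dist1 a b \<le> 1 \<Longrightarrow>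
       indicator U b + indicator V a + k * of_bool (a = b) \<le> (indicator U' a + indicator V' b :: real)"
  shows "jump_rate c y U + jump_rate c x V + k * \<kappa> \<le> jump_rate c x U' + jump_rate c y V'"
proof (rule le_of_small_quadratic)
  let ?e = "jump_error c x + jump_error c y"
  fix t :: real assume t: "0 < t"
  let ?M = "law_at c (return_pmf x) t" and ?N = "law_at c (return_pmf y) t"
  obtain \<pi> where \<pi>: "\<pi> \<in> couplings ?M ?N"
    and far: "emeasure \<pi> {(a, b). dist1 a b > 1} \<le> ennreal (t\<^sup>2)"
    and neq: "emeasure \<pi> {(a, b). a \<noteq> b} \<le> ennreal (exp (- \<kappa> * t) + t\<^sup>2)"
    by (rule almost_adjacent_coupling[OF W xy t \<kappa>]) (use t in auto)
  have sets_\<pi>: "sets \<pi> = UNIV" using \<pi> by (simp add: couplings_def)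
  then have space_\<pi>: "space \<pi> = UNIV" by (metis UNIV_I sets.sets_into_space top.extremum_uniqueI)
  have [measurable]: "A \<in> sets \<pi>" for A using sets_\<pi> by simp
  have mf: "fst \<in> \<pi> \<rightarrow>\<^sub>M count_space UNIV" and ms: "snd \<in> \<pi> \<rightarrow>\<^sub>M count_space UNIV"
    by (auto simp: measurable_def space_\<pi> sets_\<pi>)
  have M: "?M = distr \<pi> (count_space UNIV) fst" and N: "?N = distr \<pi> (count_space UNIV) snd"
    using \<pi> by (auto simp: couplings_def)
  have "emeasure \<pi> (space \<pi>) \<le> 1"
    using law_at_mass_le[where c = c and x = x and t = t and A = UNIV, OF c] t
    unfolding M by (simp add: emeasure_distr mf space_\<pi>)
  then interpret finite_measure \<pi>
    by (intro finite_measureI) (auto simp: top_unique)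
  have mM: "measure ?M A = measure \<pi> {(a, b). a \<in> A}" for A
    unfolding M by (subst measure_distr[OF mf]) (auto simp: space_\<pi> intro!: arg_cong[of _ _ "measure \<pi>"])
  have mN: "measure ?N A = measure \<pi> {(a, b). b \<in> A}" for A
    unfolding N by (subst measure_distr[OF ms]) (auto simp: space_\<pi> intro!: arg_cong[of _ _ "measure \<pi>"])
  have int: "integrable \<pi> (indicator A :: _ \<Rightarrow> real)" for A
    by (intro integrable_const_bound[of _ 1]) (auto simp: indicator_def)
  let ?X = "{a. dist1 x a > 1}" and ?Y = "{b. dist1 y b > 1}"
  let ?D = "{(a, b). a \<noteq> b}" and ?F = "{(a, b). dist1 a b > 1}"
  let ?I = "\<lambda>A z. indicator A z :: real"
  have "(\<integral>z. ?I {(a, b). b \<in> U} z + ?I {(a, b). a \<in> V} z + k * ?I (- ?D) z \<partial>\<pi>)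
     \<le> (\<integral>z. ?I {(a, b). a \<in> U'} z + ?I {(a, b). b \<in> V'} z
          + 3 * (?I ?F z + ?I {(a, b). a \<in> ?X} z + ?I {(a, b). b \<in> ?Y} z) \<partial>\<pi>)"
  proof (rule integral_mono)
    fix z :: "(nat ^ 'd) \<times> (nat ^ 'd)"
    obtain a b where z: "z = (a, b)" by (cases z)
    show "?I {(a, b). b \<in> U} z + ?I {(a, b). a \<in> V} z + k * ?I (- ?D) z
      \<le> ?I {(a, b). a \<in> U'} z + ?I {(a, b). b \<in> V'} z
          + 3 * (?I ?F z + ?I {(a, b). a \<in> ?X} z + ?I {(a, b). b \<in> ?Y} z)"
    proof (cases "dist1 x a \<le> 1 \<and> dist1 y b \<le> 1 \<and> dist1 a b \<le> 1")
      case True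
      then show ?thesis
        using le[of a b] by (simp add: z indicator_def split: if_splits)
    next
      case False
      have aux: "p \<le> 1 + 1 + 1 \<Longrightarrow> 1 \<le> f \<Longrightarrow> 0 \<le> r \<Longrightarrow> 0 \<le> s \<Longrightarrow> p \<le> r + s + 3 * f" for p f r s :: real
        by linarith
      have "?I {(a, b). b \<in> U} z + ?I {(a, b). a \<in> V} z + k * ?I (- ?D) z \<le> 1 + 1 + 1"
        using k by (intro add_mono) (auto simp: indicator_def)
      moreover have "1 \<le> ?I ?F z + ?I {(a, b). a \<in> ?X} z + ?I {(a, b). b \<in> ?Y} z"
        using False by (auto simp: z indicator_def not_le)
      moreover have "0 \<le> ?I {(a, b). a \<in> U'} z" "0 \<le> ?I {(a, b). b \<in> V'} z" by auto
      ultimately show ?thesis by (rule aux)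
    qed
  qed (intro Bochner_Integration.integrable_add integrable_mult_right int)+
  then have main: "measure ?N U + measure ?M V + k * measure \<pi> (- ?D)
     \<le> measure ?M U' + measure ?N V' + 3 * (measure \<pi> ?F + measure ?M ?X + measure ?N ?Y)"
    unfolding mM mN by (simp add: int space_\<pi>)
  have t0: "t \<ge> 0" using t by simp
  note ge = law_at_ge[where c = c and t = t, OF c t0]
  note ms = law_at_small_time[where c = c and t = t, OF c t0 stay]
  have lower: "measure ?N U \<ge> t * jump_rate c y U - jump_error c y * t\<^sup>2"
    "measure ?M V \<ge> t * jump_rate c x V - jump_error c x * t\<^sup>2"
    by (rule ge)+
  have upper: "measure ?M U' \<le> t * jump_rate c x U' + jump_error c x * t\<^sup>2"
    "measure ?N V' \<le> t * jump_rate c y V' + jump_error c y * t\<^sup>2"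
    using sets by (auto intro: ms(2))
  have act_near: "dist1 z (act \<sigma> z) \<le> 1" for z :: "nat ^ 'd" and \<sigma>
  proof -
    have "dist1 z (act \<sigma> z) \<le> (\<Sum>j\<in>UNIV. of_bool (j = (case \<sigma> of Up i \<Rightarrow> i | Down i \<Rightarrow> i)))"
      unfolding dist1_def by (rule sum_mono) (cases \<sigma>, auto)
    then show ?thesis by simp
  qed
  have X: "measure ?M ?X \<le> jump_error c x * t\<^sup>2" "measure ?N ?Y \<le> jump_error c y * t\<^sup>2"
    using ms(2)[of x ?X] ms(2)[of y ?Y] act_near
    by (auto simp: jump_rate_def dist1_def not_less[symmetric])
  have F: "measure \<pi> ?F \<le> t\<^sup>2"
    using far by (simp add: measure_def enn2real_leI)
  \<comment> \<open>The mass of the coupling is known to be 1 only up to order t^2; subtracting the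
    mass off the diagonal leaves about \<kappa> t on it.\<close>
  have D: "measure \<pi> (- ?D) \<ge> \<kappa> * t - jump_error c x * t\<^sup>2 - (\<kappa>\<^sup>2 + 1) * t\<^sup>2"
  proof -
    have "measure \<pi> ?D \<le> exp (- \<kappa> * t) + t\<^sup>2"
      using neq by (simp add: measure_def enn2real_leI)
    also have "\<dots> \<le> 1 - \<kappa> * t + (\<kappa> * t)\<^sup>2 + t\<^sup>2"
      using exp_minus_le_quadratic[of "\<kappa> * t"] \<kappa> t by simp
    finally have "measure \<pi> ?D \<le> 1 - \<kappa> * t + (\<kappa>\<^sup>2 + 1) * t\<^sup>2"
      by (simp add: power_mult_distrib algebra_simps)
    moreover have "measure \<pi> UNIV = measure \<pi> ?D + measure \<pi> (- ?D)"
      using finite_measure_Union[of ?D "- ?D"] by (simp add: sets_\<pi>)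
    moreover have "measure ?M UNIV = measure \<pi> UNIV"
      unfolding mM by (simp add: case_prod_unfold)
    ultimately show ?thesis using ms(1)[of x] by linarith
  qed
  let ?C = "jump_error c x + \<kappa>\<^sup>2 + 1"
  have "0 \<le> jump_error c x" using jump_rate_le(3)[where c = c and x = x, OF c] .
  have "k * (\<kappa> * t) - ?C * t\<^sup>2 \<le> k * (\<kappa> * t) - k * (?C * t\<^sup>2)"
    using k \<open>0 \<le> jump_error c x\<close> mult_right_mono[of k 1 "?C * t\<^sup>2"] by simp
  also have "\<dots> = k * (\<kappa> * t - jump_error c x * t\<^sup>2 - (\<kappa>\<^sup>2 + 1) * t\<^sup>2)" by (simp add: algebra_simps)
  also have "\<dots> \<le> k * measure \<pi> (- ?D)" using D k(1) by (rule mult_left_mono)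
  finally have "k * (\<kappa> * t) - ?C * t\<^sup>2 \<le> k * measure \<pi> (- ?D)" .
  with main lower upper X F
  have "t * jump_rate c y U + t * jump_rate c x V + k * (\<kappa> * t)
      \<le> t * jump_rate c x U' + t * jump_rate c y V' + (2 * ?e + ?C + 3 * (1 + ?e)) * t\<^sup>2"
    by (simp add: algebra_simps)
  then show "t * (jump_rate c y U + jump_rate c x V + k * \<kappa>)
      \<le> t * (jump_rate c x U' + jump_rate c y V') + (2 * ?e + ?C + 3 * (1 + ?e)) * t\<^sup>2"
    by (simp add: algebra_simps)
qed


section \<open>Rate conditions implied by contraction\<close>

primrec coordinate :: "'d move \<Rightarrow> 'd" where
  "coordinate (Up i) = i"
| "coordinate (Down i) = i"

text \<open>Integer increments turn the composition of effective moves into addition, away from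
  truncated subtraction.\<close>

primrec displacement :: "'d move \<Rightarrow> 'd \<Rightarrow> int" where
  "displacement (Up i) k = (if i = k then 1 else 0)"
| "displacement (Down i) k = (if i = k then - 1 else 0)"

lemma act_displacement: "act \<sigma> x \<noteq> x \<Longrightarrow> int (act \<sigma> x $ k) = int (x $ k) + displacement \<sigma> k"
  by (cases \<sigma>) (auto split: if_splits)

lemma displacement_eq_iff: "(\<forall>k. displacement \<sigma> k = displacement \<tau> k) \<longleftrightarrow> \<sigma> = \<tau>"
proof
  assume h: "\<forall>k. displacement \<sigma> k = displacement \<tau> k"
  show "\<sigma> = \<tau>"
    using h[rule_format, of "coordinate \<sigma>"] by (cases \<sigma>; cases \<tau>) (auto split: if_splits)
qed simp

lemma displacement_sum_ne_0:
  assumes "\<tau> \<noteq> inv_move \<alpha>"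
  shows "\<exists>k. displacement \<alpha> k + displacement \<tau> k \<noteq> 0"
  using assms by (intro exI[of _ "coordinate \<alpha>"]) (cases \<alpha>; cases \<tau>; auto)

text \<open>Parity: two unit steps change the coordinate sum by an even number, a single step by an
  odd one.\<close>

lemma displacement_sum_ne_displacement: "\<exists>k. displacement \<alpha> k + displacement \<tau> k \<noteq> displacement \<sigma> k"
proof (rule ccontr)
  assume "\<not> ?thesis"
  then have h: "displacement \<alpha> k + displacement \<tau> k = displacement \<sigma> k" for k by auto
  show False
    using h[of "coordinate \<alpha>"] h[of "coordinate \<tau>"] h[of "coordinate \<sigma>"]
    by (cases \<alpha>; cases \<tau>; cases \<sigma>) (auto split: if_splits)
qed

lemma displacement_sum_eq_sum:
  assumes h: "\<And>k. displacement \<alpha> k + displacement \<tau> k = displacement \<sigma> k + displacement \<rho> k"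
    and "\<tau> \<noteq> inv_move \<alpha>"
  shows "\<sigma> = \<alpha> \<or> \<sigma> = \<tau>"
  using h[of "coordinate \<alpha>"] h[of "coordinate \<tau>"] h[of "coordinate \<sigma>"] assms(2)
  by (cases \<alpha>; cases \<tau>; cases \<sigma>; cases \<rho>) (auto split: if_splits)

lemma act_inj:
  assumes "act \<sigma> x = act \<tau> x" "act \<sigma> x \<noteq> x"
  shows "\<sigma> = \<tau>"
proof -
  have "displacement \<sigma> k = displacement \<tau> k" for k
    using act_displacement[of \<sigma> x k] act_displacement[of \<tau> x k] assms by simp
  then show ?thesis by (simp add: displacement_eq_iff[symmetric])
qed

lemma dist1_commute: "dist1 x y = dist1 y x"
  by (simp add: dist1_def abs_minus_commute)

lemma dist1_le_1D:
  assumes "dist1 x a \<le> 1"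
  shows "a = x \<or> (\<exists>\<sigma>. a = act \<sigma> x \<and> act \<sigma> x \<noteq> x)"
proof (cases "a = x")
  case False
  then obtain j where j: "a $ j \<noteq> x $ j" by (auto simp: vec_eq_iff)
  let ?t = "\<lambda>i. \<bar>real (x $ i) - real (a $ i)\<bar>"
  have tot: "?t j + (\<Sum>i\<in>-{j}. ?t i) \<le> 1"
    using assms unfolding dist1_def by (simp add: sum.remove[of UNIV j] Compl_eq_Diff_UNIV)
  have tj: "?t j \<ge> 1" using j by linarith
  have "(\<Sum>i\<in>-{j}. ?t i) \<ge> 0" by (rule sum_nonneg) simp
  then have "(\<Sum>i\<in>-{j}. ?t i) = 0" and tj1: "?t j = 1"
    using tot tj by linarith+
  then have rest: "a $ i = x $ i" if "i \<noteq> j" for i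
    using that by (simp add: sum_nonneg_eq_0_iff)
  show ?thesis
  proof (cases "x $ j < a $ j")
    case True
    then have "a $ j = x $ j + 1" using tj1 by linarith
    then have "a = act (Up j) x" using rest by (auto simp: vec_eq_iff)
    then show ?thesis using \<open>a \<noteq> x\<close> by (intro disjI2 exI[of _ "Up j"]) simp
  next
    case False
    then have "x $ j = a $ j + 1" using tj1 j by linarith
    then have "a = act (Down j) x" using rest by (auto simp: vec_eq_iff)
    then show ?thesis using \<open>a \<noteq> x\<close> by (intro disjI2 exI[of _ "Down j"]) simp
  qed
qed simp

text \<open>Here b is two steps from x, and a is close to both, so a lies halfway. A displacement
  composed of two unit steps that do not cancel determines them up to order, which leaves \<alpha>
  or \<tau> as the step taken by x.\<close>

lemma adjacent_moves:
  assumes y: "y = act \<alpha> x" "y \<noteq> x" and b: "b = act \<tau> y" "b \<noteq> y" "\<tau> \<noteq> inv_move \<alpha>"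
    and a: "dist1 x a \<le> 1" and ab: "dist1 a b \<le> 1"
  shows "a \<noteq> x \<and> a \<noteq> b \<and> (a = act \<alpha> x \<or> a = act \<tau> x)"
proof -
  have dy: "int (y $ k) = int (x $ k) + displacement \<alpha> k" for k
    using act_displacement[of \<alpha> x k] y by simp
  have db: "int (b $ k) = int (x $ k) + displacement \<alpha> k + displacement \<tau> k" for k
    using act_displacement[of \<tau> y k] b dy by simp
  obtain k0 where k0: "displacement \<alpha> k0 + displacement \<tau> k0 \<noteq> 0"
    using displacement_sum_ne_0[OF b(3)] by blast
  have ax: "a \<noteq> x"
  proof
    assume ax: "a = x"
    show False
    proof (cases "b = a")
      case True
      then show False using db[of k0] k0 ax by simp
    next
      case False
      then obtain \<rho> where r: "b = act \<rho> a" "act \<rho> a \<noteq> a" using dist1_le_1D[OF ab] by blast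
      obtain k where "displacement \<alpha> k + displacement \<tau> k \<noteq> displacement \<rho> k"
        using displacement_sum_ne_displacement[of \<alpha> \<tau> \<rho>] by blast
      then show False using db[of k] act_displacement[OF r(2), of k] r ax by simp
    qed
  qed
  then obtain \<sigma> where s: "a = act \<sigma> x" "act \<sigma> x \<noteq> x" using dist1_le_1D[OF a] by blast
  have da: "int (a $ k) = int (x $ k) + displacement \<sigma> k" for k
    using act_displacement[OF s(2), of k] s by simp
  have "a \<noteq> b"
  proof
    assume "a = b"
    obtain k where "displacement \<alpha> k + displacement \<tau> k \<noteq> displacement \<sigma> k"
      using displacement_sum_ne_displacement[of \<alpha> \<tau> \<sigma>] by blast
    then show False using db[of k] da[of k] \<open>a = b\<close> by simp
  qed
  moreover obtain \<rho> where r: "b = act \<rho> a" "act \<rho> a \<noteq> a"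
    using dist1_le_1D[OF ab] \<open>a \<noteq> b\<close> by blast
  have "displacement \<alpha> k + displacement \<tau> k = displacement \<sigma> k + displacement \<rho> k" for k
    using db[of k] da[of k] act_displacement[OF r(2), of k] r by simp
  then have "\<sigma> = \<alpha> \<or> \<sigma> = \<tau>" by (rule displacement_sum_eq_sum) (rule b(3))
  ultimately show ?thesis using ax s by auto
qed

text \<open>By parity the lattice contains no triangles.\<close>

lemma adjacent_common_neighbours:
  assumes y: "y = act \<alpha> x" "y \<noteq> x" and a: "dist1 x a \<le> 1" "dist1 y a \<le> 1"
  shows "a = x \<or> a = y"
proof (rule ccontr)
  assume h: "\<not> ?thesis"
  obtain \<sigma> where s: "a = act \<sigma> x" "act \<sigma> x \<noteq> x" using dist1_le_1D[OF a(1)] h by blast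
  obtain \<rho> where r: "a = act \<rho> y" "act \<rho> y \<noteq> y" using dist1_le_1D[OF a(2)] h by blast
  obtain k where "displacement \<alpha> k + displacement \<rho> k \<noteq> displacement \<sigma> k"
    using displacement_sum_ne_displacement[of \<alpha> \<rho> \<sigma>] by blast
  then show False
    using act_displacement[OF s(2), of k] act_displacement[OF r(2), of k] act_displacement[of \<alpha> x k] s r y
    by simp
qed

text \<open>The point x is removed because a downward move at the boundary acts trivially.\<close>

definition reached :: "nat ^ 'd::finite \<Rightarrow> 'd move set \<Rightarrow> (nat ^ 'd) set" where
  "reached x A = (\<lambda>\<sigma>. act \<sigma> x) ` A - {x}"

lemma jump_rate_reached:
  assumes stay: "\<And>x \<sigma>. act \<sigma> x = x \<Longrightarrow> c x \<sigma> = 0"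
  shows "jump_rate c x (reached x A) = (\<Sum>\<sigma>\<in>A. c x \<sigma>)"
proof -
  have "c x \<sigma> * of_bool (act \<sigma> x \<in> reached x A) = (if \<sigma> \<in> A then c x \<sigma> else 0)" for \<sigma>
    using stay[of \<sigma> x] by (auto simp: reached_def dest: act_inj)
  then show ?thesis
    unfolding jump_rate_def by (simp add: sum.If_cases)
qed

lemma sum_max_0_diff:
  fixes f g :: "'a \<Rightarrow> real"
  assumes "finite A"
  shows "(\<Sum>\<sigma>\<in>A. max 0 (f \<sigma> - g \<sigma>)) = (\<Sum>\<sigma>\<in>{\<sigma>\<in>A. g \<sigma> < f \<sigma>}. f \<sigma>) - (\<Sum>\<sigma>\<in>{\<sigma>\<in>A. g \<sigma> < f \<sigma>}. g \<sigma>)"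
  unfolding sum_subtractf[symmetric] using assms by (intro sum.mono_neutral_cong_right) (auto simp: max_def)

text \<open>Suppose y = x + e_i performs \<open>Up i\<close> or a move that is faster at y. If the
  pair is to stay adjacent, x must follow by \<open>Up i\<close> or by the same move; comparing the
  rates of these events with k = 0 gives the sign of \<open>up_slack\<close>, and symmetrically for
  \<open>down_slack\<close>. With k = 1 both events and the meeting of the ends are tested at once,
  which is possible because they exclude each other.\<close>

lemma contraction_slacks:
  fixes c :: "'d::finite rates"
  assumes c: "\<And>x \<sigma>. c x \<sigma> \<ge> 0"
    and stay: "\<And>x \<sigma>. act \<sigma> x = x \<Longrightarrow> c x \<sigma> = 0"
    and W: "\<And>p x y t. p \<ge> 1 \<Longrightarrow> t > 0 \<Longrightarrow> wasserstein p (law_at c (return_pmf x) t) (law_at c (return_pmf y) t)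
      \<le> ennreal (exp (- (\<kappa> / p) * t)) * wasserstein p (measure_pmf (return_pmf x)) (measure_pmf (return_pmf y))"
    and \<kappa>: "\<kappa> > 0"
  shows "up_slack c x i \<ge> 0" "down_slack c x i \<ge> 0" "up_slack c x i + down_slack c x i \<ge> \<kappa>"
proof -
  define y where "y = x + axis i 1"
  \<comment> \<open>The worst choices of events: on \<open>S\<close> and \<open>T\<close> the
    positive parts in the slacks become plain differences of rates.\<close>
  define S where "S = {\<sigma> \<in> -{Up i, Down i}. c x \<sigma> < c y \<sigma>}"
  define T where "T = {\<sigma> \<in> -{Up i, Down i}. c y \<sigma> < c x \<sigma>}"
  have xy: "dist1 x y = 1"
  proof -
    have "dist1 x y = (\<Sum>j\<in>UNIV. if i = j then 1 else 0)"
      unfolding dist1_def y_def by (rule sum.cong) auto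
    then show ?thesis by simp
  qed
  have yx: "y = act (Up i) x" "y \<noteq> x" "x = act (Down i) y" "x \<noteq> y"
    by (auto simp: y_def vec_eq_iff intro: exI[of _ i])
  let ?U = "reached y (insert (Up i) S)" and ?U' = "reached x (insert (Up i) S)"
  let ?V = "reached x (insert (Down i) T)" and ?V' = "reached y (insert (Down i) T)"
  note cmp = rate_comparison[where c = c and x = x and y = y and \<kappa> = \<kappa>, OF c stay W \<kappa> xy]
  have U: "a \<in> ?U' \<and> a \<notin> ?V \<and> a \<noteq> b" if U: "b \<in> ?U" "dist1 x a \<le> 1" "dist1 a b \<le> 1" for a b
  proof -
    obtain \<tau> where t: "b = act \<tau> y" "b \<noteq> y" "\<tau> \<in> insert (Up i) S" using U(1) unfolding reached_def by blast
    have "\<tau> \<noteq> inv_move (Up i)" using t(3) by (auto simp: S_def)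
    from adjacent_moves[OF yx(1,2) t(1,2) this U(2,3)] t(3)
    obtain \<sigma> where s: "a \<noteq> x" "a \<noteq> b" "a = act \<sigma> x" "\<sigma> \<in> insert (Up i) S"
      by blast
    have "a \<notin> ?V"
    proof
      assume "a \<in> ?V"
      then obtain \<rho> where "act \<rho> x = act \<sigma> x" "\<rho> \<in> insert (Down i) T"
        using s(3) unfolding reached_def by blast
      then show False
        using act_inj[of \<sigma> x \<rho>] s by (auto simp: S_def T_def)
    qed
    then show ?thesis using s unfolding reached_def by blast
  qed
  have V: "b \<in> ?V' \<and> a \<noteq> b" if V: "a \<in> ?V" "dist1 y b \<le> 1" "dist1 a b \<le> 1" for a b
  proof -
    obtain \<tau> where t: "a = act \<tau> x" "a \<noteq> x" "\<tau> \<in> insert (Down i) T" using V(1) unfolding reached_def by blast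
    have ne: "\<tau> \<noteq> inv_move (Down i)" using t(3) by (auto simp: T_def)
    have "dist1 b a \<le> 1" using V(3) by (simp add: dist1_commute)
    from adjacent_moves[OF yx(3,4) t(1,2) ne V(2) this] t(3)
    show ?thesis unfolding reached_def by blast
  qed
  \<comment> \<open>Within one step of either end the two can meet only at y, when x jumps up, or at
    x, when y jumps down.\<close>
  have diag: "a \<in> ?U' \<or> a \<in> ?V'" if "dist1 x a \<le> 1" "dist1 y a \<le> 1" for a
    using adjacent_common_neighbours[OF yx(1,2) that] yx unfolding reached_def by blast
  have sums: "up_slack c x i = (\<Sum>\<sigma>\<in>insert (Up i) S. c x \<sigma>) - (\<Sum>\<sigma>\<in>insert (Up i) S. c y \<sigma>)"
    "down_slack c x i = (\<Sum>\<sigma>\<in>insert (Down i) T. c y \<sigma>) - (\<Sum>\<sigma>\<in>insert (Down i) T. c x \<sigma>)"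
    unfolding up_slack_def down_slack_def y_def[symmetric]
    by (simp_all add: sum_max_0_diff S_def T_def)
  note rates = jump_rate_reached[where c = c, OF stay]
  have empty: "jump_rate c z {} = 0" for z by (simp add: jump_rate_def)
  have "jump_rate c y ?U + jump_rate c x {} + 0 * \<kappa> \<le> jump_rate c x ?U' + jump_rate c y {}"
  proof (rule cmp)
    fix a b assume "dist1 x a \<le> 1" "dist1 y b \<le> 1" "dist1 a b \<le> 1"
    then show "indicator ?U b + indicator {} a + 0 * of_bool (a = b) \<le> (indicator ?U' a + indicator {} b :: real)"
      using U[of b a] by (cases "b \<in> ?U") simp_all
  qed (simp_all add: reached_def)
  then show "up_slack c x i \<ge> 0" by (simp add: sums(1) rates empty)
  have "jump_rate c y {} + jump_rate c x ?V + 0 * \<kappa> \<le> jump_rate c x {} + jump_rate c y ?V'"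
  proof (rule cmp)
    fix a b assume "dist1 x a \<le> 1" "dist1 y b \<le> 1" "dist1 a b \<le> 1"
    then show "indicator {} b + indicator ?V a + 0 * of_bool (a = b) \<le> (indicator {} a + indicator ?V' b :: real)"
      using V[of a b] by (cases "a \<in> ?V") simp_all
  qed (simp_all add: reached_def)
  then show "down_slack c x i \<ge> 0" by (simp add: sums(2) rates empty)
  have "jump_rate c y ?U + jump_rate c x ?V + 1 * \<kappa> \<le> jump_rate c x ?U' + jump_rate c y ?V'"
  proof (rule cmp)
    fix a b assume ab: "dist1 x a \<le> 1" "dist1 y b \<le> 1" "dist1 a b \<le> 1"
    show "indicator ?U b + indicator ?V a + 1 * of_bool (a = b) \<le> (indicator ?U' a + indicator ?V' b :: real)"
    proof (cases "b \<in> ?U")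
      case True
      then show ?thesis using U[OF True ab(1,3)] by simp
    next
      case False
      then show ?thesis
        using V[OF _ ab(2,3)] diag[of a] ab by (cases "a \<in> ?V"; cases "a = b") (auto simp: indicator_def)
    qed
  qed (simp_all add: reached_def)
  then show "up_slack c x i + down_slack c x i \<ge> \<kappa>" by (simp add: sums rates)
qed


section \<open>Passage to the infinite chain\<close>

text \<open>Summing over all moves counts every edge from both of its ends, with equal weights by
  detailed balance. The factor 2 cancels the 1/2 in the convex Sobolev inequality.\<close>

lemma (in cube_chain) boundary_sum_eq_energy:
  assumes sym: "\<And>x y. \<Phi> (f x) (f y) = \<Phi> (f y) (f x)"
  shows "(\<Sum>x\<in>cube N. \<Sum>\<sigma>\<in>UNIV. m x * (c x \<sigma> * \<Phi> (f x) (f (act \<sigma> x)))) = 2 * energy \<Phi> f"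
proof -
  let ?G = "\<lambda>i x. m x * (c x (Down i) * \<Phi> (f x) (f (act (Down i) x)))"
  let ?H = "\<lambda>i x. m x * c x (Up i) * \<Phi> (f x) (f (x + axis i 1))"
  have shift: "sum (?G i) (cube N) = sum (?H i) (cube N)" for i
  proof (rule sum_cube_shift[where i = i])
    fix x :: "nat ^ 'd" assume "x $ i < N"
    then show "?G i (x + axis i 1) = ?H i x"
      using detailed_balance[of x i] sym unfolding act_Down_Up by (simp add: mult.assoc[symmetric])
  qed (auto simp: down_zero up_zero)
  have "(\<Sum>x\<in>cube N. \<Sum>\<sigma>\<in>UNIV. m x * (c x \<sigma> * \<Phi> (f x) (f (act \<sigma> x))))
     = (\<Sum>x\<in>cube N. \<Sum>i\<in>UNIV. ?H i x) + (\<Sum>x\<in>cube N. \<Sum>i\<in>UNIV. ?G i x)"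
    unfolding sum_moves sum.distrib by (simp add: mult.assoc)
  also have "(\<Sum>x\<in>cube N. \<Sum>i\<in>UNIV. ?G i x) = (\<Sum>i\<in>UNIV. \<Sum>x\<in>cube N. ?G i x)"
    by (rule sum.swap)
  also have "\<dots> = (\<Sum>i\<in>UNIV. \<Sum>x\<in>cube N. ?H i x)"
    by (simp only: shift)
  also have "\<dots> = (\<Sum>x\<in>cube N. \<Sum>i\<in>UNIV. ?H i x)"
    by (rule sum.swap)
  finally show ?thesis by (simp add: energy_def)
qed

section \<open>Detailed balance and truncation to cubes\<close>

lemma infsum_singleton_support:
  fixes f :: "'a \<Rightarrow> real"
  assumes "\<And>x. x \<noteq> a \<Longrightarrow> f x = 0"
  shows "infsum f UNIV = f a"
proof -
  have "infsum f UNIV = infsum f {a}"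
    by (rule infsum_cong_neutral) (use assms in auto)
  then show ?thesis by simp
qed

lemma Rev_detailed_balance:
  fixes c :: "'d::finite rates"
  assumes "Rev c m" and stay: "\<And>x. x $ i = 0 \<Longrightarrow> c x (Down i) = 0"
  shows "pmf m x * c x (Up i) = pmf m (x + axis i 1) * c (x + axis i 1) (Down i)"
proof -
  let ?F = "\<lambda>\<eta> \<sigma>. of_bool (\<eta> = x \<and> \<sigma> = Up i) :: real"
  have "bounded (range (\<lambda>(\<eta>, \<sigma>). ?F \<eta> \<sigma>))"
    by (rule bounded_subset[of "{0, 1}"]) auto
  then have "(\<Sum>\<^sub>\<infinity>(\<eta>, \<sigma>)\<in>UNIV. ?F \<eta> \<sigma> * c \<eta> \<sigma> * pmf m \<eta>) =
        (\<Sum>\<^sub>\<infinity>(\<eta>, \<sigma>)\<in>UNIV. ?F (act \<sigma> \<eta>) (inv_move \<sigma>) * c \<eta> \<sigma> * pmf m \<eta>)"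
    using assms(1) unfolding Rev_def by blast
  also have "(\<Sum>\<^sub>\<infinity>(\<eta>, \<sigma>)\<in>UNIV. ?F \<eta> \<sigma> * c \<eta> \<sigma> * pmf m \<eta>) = c x (Up i) * pmf m x"
    by (subst infsum_singleton_support[where a = "(x, Up i)"]) auto
  also have "(\<Sum>\<^sub>\<infinity>(\<eta>, \<sigma>)\<in>UNIV. ?F (act \<sigma> \<eta>) (inv_move \<sigma>) * c \<eta> \<sigma> * pmf m \<eta>)
      = c (x + axis i 1) (Down i) * pmf m (x + axis i 1)"
  proof (subst infsum_singleton_support[where a = "(x + axis i 1, Down i)"])
    fix p :: "(nat ^ 'd) \<times> 'd move"
    assume ne: "p \<noteq> (x + axis i 1, Down i)"
    obtain \<eta> \<sigma> where p: "p = (\<eta>, \<sigma>)" by (cases p)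
    show "(case p of (\<eta>, \<sigma>) \<Rightarrow> ?F (act \<sigma> \<eta>) (inv_move \<sigma>) * c \<eta> \<sigma> * pmf m \<eta>) = 0"
    proof (cases "act \<sigma> \<eta> = x \<and> inv_move \<sigma> = Up i")
      case True
      then have \<sigma>: "\<sigma> = Down i" by (cases \<sigma>) auto
      \<comment> \<open>A second preimage of x under \<open>Down i\<close> exists only on the
        boundary, where the move is trivial and its rate zero.\<close>
      have "\<eta> $ i = 0"
      proof (rule ccontr)
        assume "\<eta> $ i \<noteq> 0"
        moreover from this have "x = \<eta> - axis i 1" using True by (simp add: \<sigma>)
        ultimately have "\<eta> = x + axis i 1" by (auto simp: vec_eq_iff)
        then show False using ne p \<sigma> by simp
      qed
      then show ?thesis using stay p \<sigma> by simp
    qed (auto simp: p)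
  qed simp
  finally show ?thesis by (simp add: mult.commute)
qed

definition truncated_rates :: "nat \<Rightarrow> 'd::finite rates \<Rightarrow> 'd rates" where
  "truncated_rates N c x \<sigma> = c x \<sigma> * (case \<sigma> of Up i \<Rightarrow> of_bool (x $ i < N) | Down i \<Rightarrow> 1)"

text \<open>In a direction other than i both ends of the edge have the same coordinate, so
  truncation keeps or kills both rates together. In direction i it can only lower the rate at the
  upper end, which enters \<open>up_slack\<close> with a minus sign.\<close>

lemma truncated_slacks:
  assumes c: "\<And>x \<sigma>. c x \<sigma> \<ge> 0" and i: "x $ i < N"
  shows "up_slack (truncated_rates N c) x i \<ge> up_slack c x i"
    "down_slack (truncated_rates N c) x i \<ge> down_slack c x i"
proof -
  let ?c = "truncated_rates N c" and ?y = "x + axis i 1"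
  have le: "max 0 (?c ?y \<sigma> - ?c x \<sigma>) \<le> max 0 (c ?y \<sigma> - c x \<sigma>)"
    "max 0 (?c x \<sigma> - ?c ?y \<sigma>) \<le> max 0 (c x \<sigma> - c ?y \<sigma>)" if "\<sigma> \<in> -{Up i, Down i}" for \<sigma>
    using that by (cases \<sigma>; auto simp: truncated_rates_def)+
  have "?c x (Up i) = c x (Up i)" "?c ?y (Up i) \<le> c ?y (Up i)"
    "?c x (Down i) = c x (Down i)" "?c ?y (Down i) = c ?y (Down i)"
    using i c[of ?y "Up i"] by (auto simp: truncated_rates_def)
  moreover have "(\<Sum>\<sigma>\<in>-{Up i, Down i}. max 0 (?c ?y \<sigma> - ?c x \<sigma>)) \<le> (\<Sum>\<sigma>\<in>-{Up i, Down i}. max 0 (c ?y \<sigma> - c x \<sigma>))"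
    "(\<Sum>\<sigma>\<in>-{Up i, Down i}. max 0 (?c x \<sigma> - ?c ?y \<sigma>)) \<le> (\<Sum>\<sigma>\<in>-{Up i, Down i}. max 0 (c x \<sigma> - c ?y \<sigma>))"
    by (intro sum_mono le(1), assumption) (intro sum_mono le(2), assumption)
  ultimately show "up_slack ?c x i \<ge> up_slack c x i" "down_slack ?c x i \<ge> down_slack c x i"
    unfolding up_slack_def down_slack_def by linarith+
qed

lemma potential_rates_nonneg: "potential_rates Vp Vm x \<sigma> \<ge> 0"
  by (cases \<sigma>) simp_all

lemma potential_rates_stay: "act \<sigma> x = x \<Longrightarrow> potential_rates Vp Vm x \<sigma> = 0"
  by (cases \<sigma>) (auto simp: vec_eq_iff split: if_splits)

text \<open>Both rates across an edge are positive, so detailed balance carries positivity of the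
  weight from one end to the other, and the edges connect the lattice.\<close>

lemma pmf_pos_of_Rev:
  fixes m :: "(nat ^ 'd::finite) pmf"
  assumes "Rev (potential_rates Vp Vm) m"
  shows "pmf m x > 0"
proof -
  let ?c = "potential_rates Vp Vm"
  have iff: "pmf m (x + axis i 1) > 0 \<longleftrightarrow> pmf m x > 0" for x i
  proof -
    have "pmf m x * ?c x (Up i) = pmf m (x + axis i 1) * ?c (x + axis i 1) (Down i)"
      by (rule Rev_detailed_balance[OF assms]) simp
    then have "0 < pmf m x * ?c x (Up i) \<longleftrightarrow> 0 < pmf m (x + axis i 1) * ?c (x + axis i 1) (Down i)"
      by simp
    moreover have "?c x (Up i) > 0" "?c (x + axis i 1) (Down i) > 0" by simp_all
    ultimately show ?thesis by (simp add: zero_less_mult_iff del: potential_rates.simps)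
  qed
  have zero: "pmf m x > 0 \<longleftrightarrow> pmf m 0 > 0" for x
    by (induction x rule: nat_vec_induct) (simp_all add: iff)
  obtain z where "z \<in> set_pmf m" using set_pmf_not_empty[of m] by blast
  then have "pmf m z > 0" by (simp add: pmf_positive)
  then show ?thesis using zero by blast
qed

section \<open>Limits along growing cubes\<close>

lemma in_cube_sum:
  fixes x :: "nat ^ 'd::finite"
  assumes "(\<Sum>i\<in>UNIV. x $ i) \<le> N"
  shows "x \<in> cube N"
  unfolding cube_def
proof safe
  fix i
  have "x $ i \<le> (\<Sum>i\<in>UNIV. x $ i)" by (rule member_le_sum) auto
  then show "x $ i \<le> N" using assms by simp
qed

lemma nn_integral_indicator_cube:
  fixes m :: "(nat ^ 'd::finite) pmf" and g :: "nat ^ 'd \<Rightarrow> real"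
  assumes "\<And>x. g x \<ge> 0"
  shows "(\<integral>\<^sup>+x\<in>cube N. ennreal (g x) \<partial>measure_pmf m) = ennreal (\<Sum>x\<in>cube N. pmf m x * g x)"
  using assms by (subst nn_integral_measure_pmf_support[OF finite_cube[of N]])
    (auto simp: ennreal_mult[symmetric] mult.commute simp flip: sum_ennreal intro!: sum.cong)

lemma cube_tendsto_integral:
  fixes m :: "(nat ^ 'd::finite) pmf" and f :: "nat ^ 'd \<Rightarrow> real"
  assumes "integrable (measure_pmf m) f"
  shows "(\<lambda>N. \<Sum>x\<in>cube N. pmf m x * f x) \<longlonglongrightarrow> (\<integral>x. f x \<partial>measure_pmf m)"
proof -
  have "(\<lambda>N. \<integral>x. f x * indicator (cube N) x \<partial>measure_pmf m) \<longlonglongrightarrow> (\<integral>x. f x \<partial>measure_pmf m)"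
  proof (rule integral_dominated_convergence[where w = "\<lambda>x. \<bar>f x\<bar>"])
    show "AE x in measure_pmf m. (\<lambda>N. f x * indicator (cube N) x) \<longlonglongrightarrow> f x"
    proof (rule AE_I2)
      fix x :: "nat ^ 'd"
      have "\<forall>N\<ge>\<Sum>i\<in>UNIV. x $ i. x \<in> cube N"
        by (simp add: in_cube_sum)
      then have "\<forall>\<^sub>F N in sequentially. f x * indicator (cube N) x = f x"
        unfolding eventually_sequentially by (intro exI) auto
      then show "(\<lambda>N. f x * indicator (cube N) x) \<longlonglongrightarrow> f x"
        by (rule tendsto_eventually)
    qed
  qed (use assms in \<open>auto simp: indicator_def\<close>)
  moreover have "(\<integral>x. f x * indicator (cube N) x \<partial>measure_pmf m) = (\<Sum>x\<in>cube N. pmf m x * f x)" for N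
    by (subst integral_measure_pmf_real[OF finite_cube[of N]])
      (auto simp: indicator_def mult.commute intro!: sum.cong split: if_splits)
  ultimately show ?thesis by simp
qed

lemma nn_integral_le_of_cube:
  fixes m :: "(nat ^ 'd::finite) pmf" and g :: "nat ^ 'd \<Rightarrow> real"
  assumes g: "\<And>x. g x \<ge> 0" and le: "\<And>N. (\<Sum>x\<in>cube N. pmf m x * g x) \<le> b N" and b: "b \<longlonglongrightarrow> B"
  shows "(\<integral>\<^sup>+x. ennreal (g x) \<partial>measure_pmf m) \<le> ennreal B"
proof (rule LIMSEQ_le)
  show "(\<lambda>N. ennreal (b N)) \<longlonglongrightarrow> ennreal B" by (rule tendsto_ennrealI[OF b])
  have inc: "incseq (\<lambda>N x. ennreal (g x) * indicator (cube N) x)"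
    by (auto simp: incseq_def le_fun_def indicator_def cube_def intro: order_trans)
  have "(SUP N. ennreal (g x) * indicator (cube N) x) = ennreal (g x)" for x :: "nat ^ 'd"
  proof (rule antisym)
    have "x \<in> cube (\<Sum>i\<in>UNIV. x $ i)" by (simp add: in_cube_sum)
    then show "ennreal (g x) \<le> (SUP N. ennreal (g x) * indicator (cube N) x)"
      by (intro SUP_upper2[of "\<Sum>i\<in>UNIV. x $ i"]) auto
  qed (auto intro!: SUP_least simp: indicator_def)
  then have "(\<integral>\<^sup>+x. ennreal (g x) \<partial>measure_pmf m) = (SUP N. \<integral>\<^sup>+x. ennreal (g x) * indicator (cube N) x \<partial>measure_pmf m)"
    using nn_integral_monotone_convergence_SUP[OF inc, of "measure_pmf m"] by simp
  moreover have "incseq (\<lambda>N. \<integral>\<^sup>+x. ennreal (g x) * indicator (cube N) x \<partial>measure_pmf m)"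
    using inc by (auto simp: incseq_def le_fun_def intro!: nn_integral_mono)
  ultimately show "(\<lambda>N. \<integral>\<^sup>+x. ennreal (g x) * indicator (cube N) x \<partial>measure_pmf m)
      \<longlonglongrightarrow> (\<integral>\<^sup>+x. ennreal (g x) \<partial>measure_pmf m)"
    by (simp add: LIMSEQ_SUP)
  show "\<exists>N. \<forall>n\<ge>N. (\<integral>\<^sup>+x. ennreal (g x) * indicator (cube n) x \<partial>measure_pmf m) \<le> ennreal (b n)"
    using le g by (simp add: nn_integral_indicator_cube ennreal_leI)
qed

lemma cube_sum_le_nn_integral:
  fixes m :: "(nat ^ 'd::finite) pmf" and g :: "nat ^ 'd \<Rightarrow> real"
  assumes g: "\<And>x. g x \<ge> 0"
  shows "ennreal (\<Sum>x\<in>cube N. pmf m x * g x) \<le> (\<integral>\<^sup>+x. ennreal (g x) \<partial>measure_pmf m)"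
proof -
  have "ennreal (\<Sum>x\<in>cube N. pmf m x * g x) = (\<integral>\<^sup>+x. ennreal (g x) * indicator (cube N) x \<partial>measure_pmf m)"
    using g by (simp add: nn_integral_indicator_cube)
  also have "\<dots> \<le> (\<integral>\<^sup>+x. ennreal (g x) \<partial>measure_pmf m)"
    by (intro nn_integral_mono) (simp add: indicator_def)
  finally show ?thesis .
qed

text \<open>The Dirichlet form may be assumed finite. Truncation only decreases it, so the bounds on
  all cubes share the constant d. As N grows, the entropy integral converges monotonically, while
  total weight and mean converge to those of the full chain.\<close>

lemma contraction_imp_convex_sobolev:
  fixes Vp Vm :: "nat ^ 'd::finite \<Rightarrow> real"
    and m :: "(nat ^ 'd) pmf"
  assumes c: "c = potential_rates Vp Vm" and rev: "Rev c m" and \<kappa>: "\<kappa> > 0"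
    and W: "\<And>p \<mu> \<nu> t. p \<ge> 1 \<Longrightarrow> \<mu> \<in> finite_moment p \<Longrightarrow> \<nu> \<in> finite_moment p \<Longrightarrow> t > 0 \<Longrightarrow>
           wasserstein p (law_at c \<mu> t) (law_at c \<nu> t)
             \<le> ennreal (exp (- (\<kappa> / p) * t)) * wasserstein p (measure_pmf \<mu>) (measure_pmf \<nu>)"
    and \<phi>: "entropy_density \<phi>" and \<Phi>: "edge_functional \<beta> (bregman_symm \<phi>)" and \<beta>: "1 \<le> \<beta>" "\<beta> \<le> 2"
  shows "convex_sobolev c m \<phi> (\<beta> * \<kappa>)"
proof -
  have c_nonneg: "c x \<sigma> \<ge> 0" for x \<sigma> by (simp add: c potential_rates_nonneg)
  have stay: "c x \<sigma> = 0" if "act \<sigma> x = x" for x \<sigma> using that by (simp add: c potential_rates_stay)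
  have moment: "return_pmf x \<in> finite_moment p" for p and x :: "nat ^ 'd"
    by (simp add: finite_moment_def integrable_measure_pmf_finite)
  note slacks = contraction_slacks[where c = c and \<kappa> = \<kappa>, OF c_nonneg stay W[OF _ moment moment] \<kappa>]
  have chain: "cube_chain N (truncated_rates N c) (pmf m) \<kappa>" for N
  proof
    show "truncated_rates N c x \<sigma> \<ge> 0" for x \<sigma>
      using c_nonneg by (simp add: truncated_rates_def split: move.split)
    show "x $ i < N \<Longrightarrow> truncated_rates N c x (Up i) > 0" for x i
      by (simp add: truncated_rates_def c)
    show "x $ i \<ge> N \<Longrightarrow> truncated_rates N c x (Up i) = 0" for x i
      by (simp add: truncated_rates_def)
    show "x $ i = 0 \<Longrightarrow> truncated_rates N c x (Down i) = 0" for x i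
      by (simp add: truncated_rates_def c)
    show "pmf m x > 0" for x
      using pmf_pos_of_Rev rev c by blast
    show "pmf m x * truncated_rates N c x (Up i) = pmf m (x + axis i 1) * truncated_rates N c (x + axis i 1) (Down i)"
      if "x $ i < N" for x i
      using Rev_detailed_balance[OF rev, of i x] that by (simp add: truncated_rates_def c)
    \<comment> \<open>Both products are the exponential of minus the increment of \<open>Vp\<close>
      from x to the opposite corner, and for distinct directions the truncation conditions
      agree.\<close>
    show "truncated_rates N c x (Up i) * truncated_rates N c (x + axis i 1) (Up j)
        = truncated_rates N c x (Up j) * truncated_rates N c (x + axis j 1) (Up i)" if "i \<noteq> j" for x i j
      using that by (auto simp: truncated_rates_def c grad_def add_ac simp flip: exp_add)
    fix x :: "nat ^ 'd" and i :: 'd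
    assume i: "x $ i < N"
    note tr = truncated_slacks[where c = c, OF c_nonneg i]
    show "up_slack (truncated_rates N c) x i \<ge> 0" "down_slack (truncated_rates N c) x i \<ge> 0"
      "\<kappa> \<le> up_slack (truncated_rates N c) x i + down_slack (truncated_rates N c) x i"
      using slacks[of x i] tr by linarith+
  qed (rule \<kappa>)
  show ?thesis
    unfolding convex_sobolev_def
  proof (intro allI impI)
    fix f :: "nat ^ 'd \<Rightarrow> real"
    assume "\<forall>\<eta>. f \<eta> > 0" and int: "integrable (measure_pmf m) f"
    then have f: "f \<eta> > 0" for \<eta> by simp
    have nn: "bregman_symm \<phi> (f x) (f y) \<ge> 0" for x y
      by (rule entropy_density_bregman_nonneg[OF \<phi> f f])
    let ?D = "dirichlet c \<phi> m f"
    let ?g = "\<lambda>x. \<Sum>\<sigma>\<in>UNIV. c x \<sigma> * bregman_symm \<phi> (f x) (f (act \<sigma> x))"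
    have D: "?D = (\<integral>\<^sup>+x. ennreal (?g x) \<partial>measure_pmf m)"
      unfolding dirichlet_def using c_nonneg nn by (intro nn_integral_cong) simp
    show "ennreal (\<beta> * \<kappa>) * phi_entropy \<phi> m f \<le> ennreal (1 / 2) * ?D"
    proof (cases "?D = \<infinity>")
      case True
      then show ?thesis by (simp add: ennreal_mult_top)
    next
      case False
      define d where "d = enn2real ?D"
      have d: "?D = ennreal d" "d \<ge> 0" using False by (simp_all add: d_def less_top)
      have \<beta>\<kappa>: "\<beta> * \<kappa> > 0" using \<beta> \<kappa> by simp
      define A where "A N = (\<Sum>x\<in>cube N. pmf m x * f x)" for N
      define M where "M N = sum (pmf m) (cube N)" for N
      have bound: "(\<Sum>x\<in>cube N. pmf m x * \<phi> (f x)) \<le> M N * \<phi> (A N / M N) + d / (2 * (\<beta> * \<kappa>))" for N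
      proof -
        interpret cube_chain N "truncated_rates N c" "pmf m" \<kappa> by (rule chain)
        have "2 * energy (bregman_symm \<phi>) f
            = (\<Sum>x\<in>cube N. \<Sum>\<sigma>\<in>UNIV. pmf m x * (truncated_rates N c x \<sigma> * bregman_symm \<phi> (f x) (f (act \<sigma> x))))"
          by (rule boundary_sum_eq_energy[symmetric]) (simp add: bregman_symm_def algebra_simps)
        also have "\<dots> \<le> (\<Sum>x\<in>cube N. \<Sum>\<sigma>\<in>UNIV. pmf m x * (c x \<sigma> * bregman_symm \<phi> (f x) (f (act \<sigma> x))))"
          using c_nonneg nn by (intro sum_mono mult_left_mono mult_right_mono)
            (auto simp: truncated_rates_def split: move.split)
        also have "\<dots> = (\<Sum>x\<in>cube N. pmf m x * ?g x)"
          by (simp only: sum_distrib_left)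
        also have "\<dots> \<le> d"
        proof -
          have "ennreal (\<Sum>x\<in>cube N. pmf m x * ?g x) \<le> ennreal d"
            unfolding d(1)[symmetric] D using c_nonneg nn by (intro cube_sum_le_nn_integral sum_nonneg) simp
          then show ?thesis using d(2) by (simp add: ennreal_le_iff)
        qed
        finally have "\<beta> * \<kappa> * ((\<Sum>x\<in>cube N. pmf m x * \<phi> (f x)) - M N * \<phi> (A N / M N)) \<le> d / 2"
          using entropy_energy_bound[where f = f, OF \<phi> \<Phi> \<beta> f] by (simp add: A_def M_def)
        then have "(\<Sum>x\<in>cube N. pmf m x * \<phi> (f x)) - M N * \<phi> (A N / M N) \<le> (d / 2) / (\<beta> * \<kappa>)"
          using \<beta>\<kappa> by (simp only: pos_le_divide_eq mult.commute[of "\<beta> * \<kappa>"])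
        then show ?thesis by simp
      qed
      let ?mean = "\<integral>x. f x \<partial>measure_pmf m"
      have M1: "M \<longlonglongrightarrow> 1"
        using cube_tendsto_integral[of m "\<lambda>_. 1"] by (simp add: M_def[abs_def])
      have A1: "A \<longlonglongrightarrow> ?mean"
        using cube_tendsto_integral[OF int] by (simp add: A_def[abs_def])
      \<comment> \<open>Positivity matters because \<phi> is known to be continuous only at positive
        arguments.\<close>
      have mean: "?mean > 0"
      proof -
        have "pmf m 0 * f 0 \<le> A N" for N
          unfolding A_def using f by (intro member_le_sum zero_in_cube) (auto simp: finite_cube less_imp_le)
        then have "pmf m 0 * f 0 \<le> ?mean"
          by (intro LIMSEQ_le_const[OF A1]) auto
        moreover have "0 < pmf m 0" using pmf_pos_of_Rev rev c by blast
        then have "0 < pmf m 0 * f 0" using f by simp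
        ultimately show ?thesis by linarith
      qed
      have "(\<lambda>N. M N * \<phi> (A N / M N) + d / (2 * (\<beta> * \<kappa>))) \<longlonglongrightarrow> 1 * \<phi> (?mean / 1) + d / (2 * (\<beta> * \<kappa>))"
        using \<phi> mean by (intro tendsto_intros M1 A1 isCont_tendsto_compose[of _ \<phi>]) (auto simp: entropy_density_def)
      then have "(\<integral>\<^sup>+x. ennreal (\<phi> (f x)) \<partial>measure_pmf m) \<le> ennreal (1 * \<phi> (?mean / 1) + d / (2 * (\<beta> * \<kappa>)))"
        using \<phi> f by (intro nn_integral_le_of_cube[OF _ bound]) (auto simp: entropy_density_def)
      also have "\<dots> = ennreal (\<phi> ?mean) + ennreal (d / (2 * (\<beta> * \<kappa>)))"
        using \<phi> mean d(2) \<beta>\<kappa> by (subst ennreal_plus[symmetric]) (auto simp: entropy_density_def)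
      finally have "phi_entropy \<phi> m f \<le> ennreal (d / (2 * (\<beta> * \<kappa>)))"
        unfolding phi_entropy_def by (simp add: ennreal_minus_le_iff)
      then have "ennreal (\<beta> * \<kappa>) * phi_entropy \<phi> m f \<le> ennreal (\<beta> * \<kappa>) * ennreal (d / (2 * (\<beta> * \<kappa>)))"
        by (rule mult_left_mono) simp
      also have "\<dots> = ennreal (\<beta> * \<kappa> * (d / (2 * (\<beta> * \<kappa>))))"
        using \<beta>\<kappa> d(2) by (intro ennreal_mult[symmetric]) auto
      also have "\<beta> * \<kappa> * (d / (2 * (\<beta> * \<kappa>))) = 1 / 2 * d"
        using \<beta>\<kappa> by (auto simp: field_simps)
      also have "ennreal (1 / 2 * d) = ennreal (1 / 2) * ?D"
        unfolding d(1) using d(2) by (intro ennreal_mult) auto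
      finally show ?thesis .
    qed
  qed
qed

theorem corollary3p3:
  fixes Vp Vm :: "nat ^ 'd::finite \<Rightarrow> real"
    and c :: "'d rates"
    and m :: "(nat ^ 'd) pmf"
    and \<kappa> :: real
  assumes "c = potential_rates Vp Vm"
    and "Irr c m"
    and "Rev c m"
    and "bdd_below {grad (Up i) Vp \<eta> | i \<eta>. True}"
    and "\<And>K i. K > (0::real) \<Longrightarrow> bdd_below {grad (Down i) Vm \<eta> | \<eta>. real (\<eta> $ i) \<le> K}"
    and "\<kappa> > 0"
    and "\<And>p \<mu> \<nu> t. p \<ge> 1 \<Longrightarrow> \<mu> \<in> finite_moment p \<Longrightarrow> \<nu> \<in> finite_moment p \<Longrightarrow> t > 0 \<Longrightarrow>
           wasserstein p (law_at c \<mu> t) (law_at c \<nu> t)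
             \<le> ennreal (exp (- (\<kappa> / p) * t)) * wasserstein p (measure_pmf \<mu>) (measure_pmf \<nu>)"
  shows "(\<forall>\<phi>. admissible \<phi> \<longrightarrow> convex_sobolev c m \<phi> \<kappa>) \<and>
         (\<forall>\<alpha>. 1 \<le> \<alpha> \<and> \<alpha> \<le> 2 \<longrightarrow> beckner c m \<alpha> (\<alpha> * \<kappa>))"
proof (intro conjI allI impI)
  fix \<phi> :: "real \<Rightarrow> real"
  assume "admissible \<phi>"
  then have "convex_sobolev c m \<phi> (1 * \<kappa>)"
    by (intro contraction_imp_convex_sobolev[OF assms(1,3,6,7)] entropy_density_admissible edge_functional_admissible)
      simp_all
  then show "convex_sobolev c m \<phi> \<kappa>" by simp
next
  fix \<alpha> :: real
  assume "1 \<le> \<alpha> \<and> \<alpha> \<le> 2"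
  then show "beckner c m \<alpha> (\<alpha> * \<kappa>)"
    unfolding beckner_def
    by (intro contraction_imp_convex_sobolev[OF assms(1,3,6,7)] entropy_density_beckner edge_functional_beckner)
      simp_all
qed

end
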